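(* Let $(M,g,f)$ be a complete weighted manifold of positive $1$-weighted Ricci curvature. Then there is no complete two-sided immersed stable $f$-minimal hypersurface $\Sigma$ in $M$ with $m_{f,\Sigma}(\Sigma)<+\infty$.
   Context: Manifolds are smooth and without boundary, hypersurfaces are non-empty, and $n:=\dim M\ge2$. A weighted manifold $(M,g,f)$ of dimension $n$ is an $n$-dimensional Riemannian manifold $(M,g)$ together with $f\in C^\infty(M)$. Set $\mathrm{Ric}_f^\infty:=\mathrm{Ric}+\mathrm{Hess}\,f$ and $\mathrm{Ric}_f^1:=\mathrm{Ric}+\mathrm{Hess}\,f+\frac{df\otimes df}{n-1}$ (the $1$-weighted Ricci curvature); the latter is positive if $\mathrm{Ric}_f^1(v,v)>0$ for every non-zero tangent vector $v$. Let $\Sigma$ be a two-sided immersed hypersurface with globally defined unit normal field $\nu$. $g_\Sigma$ is the induced metric; $m_{f,\Sigma}:=e^{-f}v_{g_\Sigma}$, where $v_{g_\Sigma}$ is the Riemannian volume measure of $g_\Sigma$; $f_\nu:=\langle\nabla f,\nu\rangle$; $\mathrm{II}_\Sigma(X,Y):=\langle\nabla_X\nu,Y\rangle$; $H_\Sigma:=\mathrm{tr}\,\mathrm{II}_\Sigma$. $\Sigma$ is $f$-minimal if $H_\Sigma-f_\nu\equiv0$. An $f$-minimal $\Sigma$ is stable if for every $\phi\in C_0^\infty(\Sigma)$ $$\int_\Sigma\left(\mathrm{Ric}_f^\infty(\nu,\nu)+|\mathrm{II}_\Sigma|^2\right)\phi^2\,dm_{f,\Sigma}\le\int_\Sigma|\nabla_\Sigma\phi|^2\,dm_{f,\Sigma}.$$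 *)

theory Defs
  imports "HOL-Analysis.Analysis"
begin

section \<open>Smooth functions of several real variables\<close>

definition pd :: "'n::finite \<Rightarrow> (real^'n \<Rightarrow> 'c::real_normed_vector) \<Rightarrow> real^'n \<Rightarrow> 'c" where
  "pd i h = (\<lambda>x. frechet_derivative h (at x) (axis i 1))"

text \<open>For open \<open>S\<close> (the only case used below) this is \<open>C\<^sup>\<infinity>\<close> on \<open>S\<close>.\<close>

definition smooth_on :: "(real^'n::finite) set \<Rightarrow> (real^'n \<Rightarrow> 'c::real_normed_vector) \<Rightarrow> bool" where
  "smooth_on S h \<longleftrightarrow> (\<forall>is. (foldr pd is h) differentiable_on S)"


section \<open>Smooth manifolds\<close>

text \<open>A manifold is a whole type with a Hausdorff, second countable topology, together with a
  smooth (not necessarily maximal) atlas. The dimension is the cardinality of the index type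
  \<open>'n\<close>. Connectedness is not required.\<close>

type_synonym ('a, 'n) chart = "'a set \<times> ('a \<Rightarrow> real^'n)"

abbreviation chart_dom :: "('a, 'n::finite) chart \<Rightarrow> 'a set" where
  "chart_dom c \<equiv> fst c"

abbreviation coord :: "('a, 'n::finite) chart \<Rightarrow> 'a \<Rightarrow> real^'n" where
  "coord c \<equiv> snd c"

abbreviation chart_img :: "('a, 'n::finite) chart \<Rightarrow> (real^'n) set" where
  "chart_img c \<equiv> coord c ` chart_dom c"

definition chart_inv :: "('a, 'n::finite) chart \<Rightarrow> real^'n \<Rightarrow> 'a" where
  "chart_inv c = inv_into (chart_dom c) (coord c)"

definition smooth_atlas ::
  "('a::{t2_space,second_countable_topology}, 'n::finite) chart set \<Rightarrow> bool" where
  "smooth_atlas A \<longleftrightarrow>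
     (\<Union>c\<in>A. chart_dom c) = UNIV \<and>
     (\<forall>c\<in>A. open (chart_dom c) \<and> open (chart_img c) \<and> homeomorphism (chart_dom c) (chart_img c) (coord c) (chart_inv c)) \<and>
     (\<forall>c\<in>A. \<forall>d\<in>A. smooth_on (coord c ` (chart_dom c \<inter> chart_dom d)) (coord d \<circ> chart_inv c))"

definition chart_at :: "('a, 'n::finite) chart set \<Rightarrow> 'a \<Rightarrow> ('a, 'n) chart" where
  "chart_at A p = (SOME c. c \<in> A \<and> p \<in> chart_dom c)"

definition smooth_fun :: "('a, 'n::finite) chart set \<Rightarrow> ('a \<Rightarrow> real) \<Rightarrow> bool" where
  "smooth_fun A u \<longleftrightarrow> (\<forall>c\<in>A. smooth_on (chart_img c) (u \<circ> chart_inv c))"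

text \<open>Jacobian matrix at \<open>p\<close> of a map between manifolds, in the charts \<open>c\<close> and \<open>d\<close>.\<close>

definition jac :: "('b, 'm::finite) chart \<Rightarrow> ('a, 'n::finite) chart \<Rightarrow> ('b \<Rightarrow> 'a) \<Rightarrow> 'b \<Rightarrow> real^'m^'n" where
  "jac c d F p = matrix (frechet_derivative (coord d \<circ> F \<circ> chart_inv c) (at (coord c p)))"


section \<open>Riemannian metrics\<close>

text \<open>Tensor fields are given by their components in each chart of the atlas; \<open>g c p\<close> is the
  matrix \<open>g\<^sub>i\<^sub>j(p)\<close> in the chart \<open>c\<close>.\<close>

type_synonym ('a, 'n) metric = "('a, 'n) chart \<Rightarrow> 'a \<Rightarrow> real^'n^'n"

definition riemannian_metric ::
  "('a::{t2_space,second_countable_topology}, 'n::finite) chart set \<Rightarrow> ('a, 'n) metric \<Rightarrow> bool" where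
  "riemannian_metric A g \<longleftrightarrow>
     (\<forall>c\<in>A. smooth_on (chart_img c) (g c \<circ> chart_inv c)) \<and>
     (\<forall>c\<in>A. \<forall>p\<in>chart_dom c. transpose (g c p) = g c p \<and> (\<forall>v. v \<noteq> 0 \<longrightarrow> v \<bullet> (g c p *v v) > 0)) \<and>
     (\<forall>c\<in>A. \<forall>d\<in>A. \<forall>p\<in>chart_dom c \<inter> chart_dom d.
        g c p = transpose (jac c d id p) ** g d p ** jac c d id p)"

definition weighted_manifold ::
  "('a::{t2_space,second_countable_topology}, 'n::finite) chart set \<Rightarrow> ('a, 'n) metric \<Rightarrow>
   ('a \<Rightarrow> real) \<Rightarrow> bool" where
  "weighted_manifold A g f \<longleftrightarrow> smooth_atlas A \<and> riemannian_metric A g \<and> smooth_fun A f"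

text \<open>The gradient of \<open>u\<close> at \<open>p\<close>, in components with respect to the chart \<open>c\<close>.\<close>

definition grad :: "('a, 'n::finite) metric \<Rightarrow> ('a \<Rightarrow> real) \<Rightarrow> ('a, 'n) chart \<Rightarrow> 'a \<Rightarrow> real^'n" where
  "grad g u c p = matrix_inv (g c p) *v (\<chi> i. pd i (u \<circ> chart_inv c) (coord c p))"


section \<open>Completeness\<close>

text \<open>Lengths are nonnegative integrals, so that a curve whose speed is not integrable has
  infinite length; the distance between different components is infinite.\<close>

definition piecewise_C1_curve ::
  "('a::topological_space, 'n::finite) chart set \<Rightarrow> (real \<Rightarrow> 'a) \<Rightarrow> bool" where
  "piecewise_C1_curve A \<gamma> \<longleftrightarrow> continuous_on {0..1} \<gamma> \<and>
     (\<forall>c\<in>A. \<forall>a b. 0 \<le> a \<and> a \<le> b \<and> b \<le> 1 \<and> \<gamma> ` {a..b} \<subseteq> chart_dom c \<longrightarrow>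
        (coord c \<circ> \<gamma>) piecewise_C1_differentiable_on {a..b})"

definition speed ::
  "('a, 'n::finite) chart set \<Rightarrow> ('a, 'n) metric \<Rightarrow> (real \<Rightarrow> 'a) \<Rightarrow> real \<Rightarrow> real" where
  "speed A g \<gamma> t =
     (let c = chart_at A (\<gamma> t); v = vector_derivative (coord c \<circ> \<gamma>) (at t)
      in sqrt (v \<bullet> (g c (\<gamma> t) *v v)))"

definition curve_length ::
  "('a, 'n::finite) chart set \<Rightarrow> ('a, 'n) metric \<Rightarrow> (real \<Rightarrow> 'a) \<Rightarrow> ennreal" where
  "curve_length A g \<gamma> = (\<integral>\<^sup>+ t\<in>{0..1}. ennreal (speed A g \<gamma> t) \<partial>lborel)"

definition riem_dist ::
  "('a::topological_space, 'n::finite) chart set \<Rightarrow> ('a, 'n) metric \<Rightarrow> 'a \<Rightarrow> 'a \<Rightarrow> ennreal" where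
  "riem_dist A g p q =
     (INF \<gamma>\<in>{\<gamma>. piecewise_C1_curve A \<gamma> \<and> \<gamma> 0 = p \<and> \<gamma> 1 = q}. curve_length A g \<gamma>)"

definition riem_complete ::
  "('a::topological_space, 'n::finite) chart set \<Rightarrow> ('a, 'n) metric \<Rightarrow> bool" where
  "riem_complete A g \<longleftrightarrow>
     (\<forall>x :: nat \<Rightarrow> 'a.
        (\<forall>e>0. \<exists>N. \<forall>i\<ge>N. \<forall>j\<ge>N. riem_dist A g (x i) (x j) < ennreal e) \<longrightarrow>
        (\<exists>p. (\<lambda>k. riem_dist A g (x k) p) \<longlonglongrightarrow> 0))"


section \<open>Curvature\<close>

text \<open>Coordinate expressions for a matrix-valued function \<open>G\<close> on an open subset of
  \<open>\<real>\<^sup>n\<close>: \<open>christoffel G k i j\<close> is \<open>\<Gamma>\<^sup>k\<^sub>i\<^sub>j\<close>, and \<open>riemann G l k i j\<close> is the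
  \<open>\<partial>\<^sub>l\<close>-component of \<open>R(\<partial>\<^sub>i,\<partial>\<^sub>j)\<partial>\<^sub>k\<close>, where
  \<open>R(X,Y)Z = \<nabla>\<^sub>X\<nabla>\<^sub>YZ - \<nabla>\<^sub>Y\<nabla>\<^sub>XZ - \<nabla>\<^bsub>[X,Y]\<^esub>Z\<close>. Then \<open>Ric(Y,Z)\<close> is the
  trace of \<open>X \<mapsto> R(X,Y)Z\<close>, which is positive on round spheres.\<close>

definition christoffel ::
  "(real^'n::finite \<Rightarrow> real^'n^'n) \<Rightarrow> 'n \<Rightarrow> 'n \<Rightarrow> 'n \<Rightarrow> real^'n \<Rightarrow> real" where
  "christoffel G k i j x =
     1/2 * (\<Sum>l\<in>UNIV. matrix_inv (G x) $ k $ l *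
        (pd i (\<lambda>y. G y $ j $ l) x + pd j (\<lambda>y. G y $ i $ l) x - pd l (\<lambda>y. G y $ i $ j) x))"

definition riemann ::
  "(real^'n::finite \<Rightarrow> real^'n^'n) \<Rightarrow> 'n \<Rightarrow> 'n \<Rightarrow> 'n \<Rightarrow> 'n \<Rightarrow> real^'n \<Rightarrow> real" where
  "riemann G l k i j x =
     pd i (christoffel G l j k) x - pd j (christoffel G l i k) x +
     (\<Sum>m\<in>UNIV. christoffel G l i m x * christoffel G m j k x -
               christoffel G l j m x * christoffel G m i k x)"

definition ricci_coord :: "(real^'n::finite \<Rightarrow> real^'n^'n) \<Rightarrow> real^'n \<Rightarrow> real^'n^'n" where
  "ricci_coord G x = (\<chi> j k. \<Sum>i\<in>UNIV. riemann G i k i j x)"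

definition hess_coord ::
  "(real^'n::finite \<Rightarrow> real^'n^'n) \<Rightarrow> (real^'n \<Rightarrow> real) \<Rightarrow> real^'n \<Rightarrow> real^'n^'n" where
  "hess_coord G u x =
     (\<chi> i j. pd i (pd j u) x - (\<Sum>k\<in>UNIV. christoffel G k i j x * pd k u x))"

definition ricci :: "('a, 'n::finite) metric \<Rightarrow> ('a, 'n) chart \<Rightarrow> 'a \<Rightarrow> real^'n^'n" where
  "ricci g c p = ricci_coord (g c \<circ> chart_inv c) (coord c p)"

definition hess ::
  "('a, 'n::finite) metric \<Rightarrow> ('a \<Rightarrow> real) \<Rightarrow> ('a, 'n) chart \<Rightarrow> 'a \<Rightarrow> real^'n^'n" where
  "hess g u c p = hess_coord (g c \<circ> chart_inv c) (u \<circ> chart_inv c) (coord c p)"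

definition ric_inf ::
  "('a, 'n::finite) metric \<Rightarrow> ('a \<Rightarrow> real) \<Rightarrow> ('a, 'n) chart \<Rightarrow> 'a \<Rightarrow> real^'n^'n" where
  "ric_inf g f c p = ricci g c p + hess g f c p"

definition ric_one ::
  "('a, 'n::finite) metric \<Rightarrow> ('a \<Rightarrow> real) \<Rightarrow> ('a, 'n) chart \<Rightarrow> 'a \<Rightarrow> real^'n^'n" where
  "ric_one g f c p = ricci g c p + hess g f c p +
     (\<chi> i j. pd i (f \<circ> chart_inv c) (coord c p) * pd j (f \<circ> chart_inv c) (coord c p)
             / (real CARD('n) - 1))"

definition positive_ric_one ::
  "('a, 'n::finite) chart set \<Rightarrow> ('a, 'n) metric \<Rightarrow> ('a \<Rightarrow> real) \<Rightarrow> bool" where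
  "positive_ric_one A g f \<longleftrightarrow>
     (\<forall>c\<in>A. \<forall>p\<in>chart_dom c. \<forall>v. v \<noteq> 0 \<longrightarrow> v \<bullet> (ric_one g f c p *v v) > 0)"


section \<open>Riemannian volume\<close>

text \<open>The volume of the part of \<open>S\<close> inside the chart \<open>c\<close>, \<open>\<integral> \<surd>det(g\<^sub>i\<^sub>j) dx\<close>.\<close>

definition chart_volume ::
  "('a, 'n::finite) metric \<Rightarrow> ('a, 'n) chart \<Rightarrow> 'a set \<Rightarrow> ennreal" where
  "chart_volume g c S =
     (\<integral>\<^sup>+ x\<in>chart_img c. indicator S (chart_inv c x) * ennreal (sqrt (det (g c (chart_inv c x)))) \<partial>lborel)"

definition countable_cover :: "('a, 'n::finite) chart set \<Rightarrow> nat \<Rightarrow> ('a, 'n) chart" where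
  "countable_cover A = (SOME C. range C \<subseteq> A \<and> (\<Union>k. chart_dom (C k)) = UNIV)"

text \<open>A countable family of charts covers the manifold (second countability); its domains are
  made disjoint. By the change of variables formula, the result does not depend on the family.\<close>

definition riem_volume ::
  "('a::topological_space, 'n::finite) chart set \<Rightarrow> ('a, 'n) metric \<Rightarrow> 'a measure" where
  "riem_volume A g = measure_of UNIV (sets borel)
     (\<lambda>S. \<Sum>k. chart_volume g (countable_cover A k)
                (S \<inter> disjointed (\<lambda>j. chart_dom (countable_cover A j)) k))"


section \<open>Immersed hypersurfaces\<close>

text \<open>\<open>B\<close> is an atlas of the hypersurface, \<open>\<iota>\<close> its immersion into the manifold with atlas \<open>A\<close>.\<close>

definition immersed_hypersurface ::
  "('b::{t2_space,second_countable_topology}, 'm::finite) chart set \<Rightarrow>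
   ('a::{t2_space,second_countable_topology}, 'n::finite) chart set \<Rightarrow> ('b \<Rightarrow> 'a) \<Rightarrow> bool" where
  "immersed_hypersurface B A \<iota> \<longleftrightarrow>
     CARD('m) + 1 = CARD('n) \<and> smooth_atlas B \<and> continuous_on UNIV \<iota> \<and>
     (\<forall>c\<in>B. \<forall>d\<in>A. smooth_on (coord c ` (chart_dom c \<inter> \<iota> -` chart_dom d)) (coord d \<circ> \<iota> \<circ> chart_inv c)) \<and>
     (\<forall>c\<in>B. \<forall>d\<in>A. \<forall>p\<in>chart_dom c \<inter> \<iota> -` chart_dom d. inj ((*v) (jac c d \<iota> p)))"

text \<open>A vector field along \<open>\<iota>\<close> is given by its components \<open>\<nu> d p\<close> at \<open>\<iota> p\<close> in the charts \<open>d\<close>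
  of the ambient manifold.\<close>

definition unit_normal_field ::
  "('b::{t2_space,second_countable_topology}, 'm::finite) chart set \<Rightarrow>
   ('a::{t2_space,second_countable_topology}, 'n::finite) chart set \<Rightarrow> ('a, 'n) metric \<Rightarrow>
   ('b \<Rightarrow> 'a) \<Rightarrow> (('a, 'n) chart \<Rightarrow> 'b \<Rightarrow> real^'n) \<Rightarrow> bool" where
  "unit_normal_field B A g \<iota> \<nu> \<longleftrightarrow>
     (\<forall>d\<in>A. \<forall>d'\<in>A. \<forall>p. \<iota> p \<in> chart_dom d \<inter> chart_dom d' \<longrightarrow> \<nu> d' p = jac d d' id (\<iota> p) *v \<nu> d p) \<and>
     (\<forall>c\<in>B. \<forall>d\<in>A. smooth_on (coord c ` (chart_dom c \<inter> \<iota> -` chart_dom d)) (\<nu> d \<circ> chart_inv c)) \<and>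
     (\<forall>d\<in>A. \<forall>p\<in>\<iota> -` chart_dom d. \<nu> d p \<bullet> (g d (\<iota> p) *v \<nu> d p) = 1) \<and>
     (\<forall>c\<in>B. \<forall>d\<in>A. \<forall>p\<in>chart_dom c \<inter> \<iota> -` chart_dom d. \<forall>w.
        (jac c d \<iota> p *v w) \<bullet> (g d (\<iota> p) *v \<nu> d p) = 0)"

text \<open>The objects below do not depend on the choices of charts made by \<open>chart_at\<close>.\<close>

definition induced_metric ::
  "('a, 'n::finite) chart set \<Rightarrow> ('a, 'n) metric \<Rightarrow> ('b \<Rightarrow> 'a) \<Rightarrow> ('b, 'm::finite) metric" where
  "induced_metric A g \<iota> c p =
     (let d = chart_at A (\<iota> p)
      in transpose (jac c d \<iota> p) ** g d (\<iota> p) ** jac c d \<iota> p)"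

text \<open>Components \<open>\<langle>\<nabla>\<^sub>i\<nu>, \<partial>\<^sub>j\<iota>\<rangle>\<close>, where
  \<open>(\<nabla>\<^sub>i\<nu>)\<^sup>k = \<partial>\<^sub>i\<nu>\<^sup>k + \<Gamma>\<^sup>k\<^sub>a\<^sub>b \<partial>\<^sub>i\<iota>\<^sup>a \<nu>\<^sup>b\<close>.\<close>

definition second_form ::
  "('a, 'n::finite) chart set \<Rightarrow> ('a, 'n) metric \<Rightarrow> ('b \<Rightarrow> 'a) \<Rightarrow>
   (('a, 'n) chart \<Rightarrow> 'b \<Rightarrow> real^'n) \<Rightarrow> ('b, 'm::finite) chart \<Rightarrow> 'b \<Rightarrow> real^'m^'m" where
  "second_form A g \<iota> \<nu> c p =
     (let d = chart_at A (\<iota> p);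
          D\<iota> = (\<lambda>i. pd i (coord d \<circ> \<iota> \<circ> chart_inv c) (coord c p));
          \<Gamma> = (\<lambda>k a b. christoffel (g d \<circ> chart_inv d) k a b (coord d (\<iota> p)));
          D\<nu> = (\<lambda>i. pd i (\<nu> d \<circ> chart_inv c) (coord c p) +
                    (\<chi> k. \<Sum>a\<in>UNIV. \<Sum>b\<in>UNIV. \<Gamma> k a b * D\<iota> i $ a * \<nu> d p $ b))
      in \<chi> i j. D\<nu> i \<bullet> (g d (\<iota> p) *v D\<iota> j))"

definition mean_curvature ::
  "('b, 'm::finite) chart set \<Rightarrow> ('a, 'n::finite) chart set \<Rightarrow> ('a, 'n) metric \<Rightarrow> ('b \<Rightarrow> 'a) \<Rightarrow>
   (('a, 'n) chart \<Rightarrow> 'b \<Rightarrow> real^'n) \<Rightarrow> 'b \<Rightarrow> real" where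
  "mean_curvature B A g \<iota> \<nu> p =
     (let c = chart_at B p
      in trace (matrix_inv (induced_metric A g \<iota> c p) ** second_form A g \<iota> \<nu> c p))"

definition second_form_norm2 ::
  "('b, 'm::finite) chart set \<Rightarrow> ('a, 'n::finite) chart set \<Rightarrow> ('a, 'n) metric \<Rightarrow> ('b \<Rightarrow> 'a) \<Rightarrow>
   (('a, 'n) chart \<Rightarrow> 'b \<Rightarrow> real^'n) \<Rightarrow> 'b \<Rightarrow> real" where
  "second_form_norm2 B A g \<iota> \<nu> p =
     (let c = chart_at B p; h = second_form A g \<iota> \<nu> c p;
          K = matrix_inv (induced_metric A g \<iota> c p)
      in \<Sum>i\<in>UNIV. \<Sum>j\<in>UNIV. \<Sum>k\<in>UNIV. \<Sum>l\<in>UNIV. K $ i $ k * K $ j $ l * h $ i $ j * h $ k $ l)"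

definition normal_derivative ::
  "('a, 'n::finite) chart set \<Rightarrow> ('a, 'n) metric \<Rightarrow> ('a \<Rightarrow> real) \<Rightarrow> ('b \<Rightarrow> 'a) \<Rightarrow>
   (('a, 'n) chart \<Rightarrow> 'b \<Rightarrow> real^'n) \<Rightarrow> 'b \<Rightarrow> real" where
  "normal_derivative A g f \<iota> \<nu> p =
     (let d = chart_at A (\<iota> p) in grad g f d (\<iota> p) \<bullet> (g d (\<iota> p) *v \<nu> d p))"

definition ric_inf_normal ::
  "('a, 'n::finite) chart set \<Rightarrow> ('a, 'n) metric \<Rightarrow> ('a \<Rightarrow> real) \<Rightarrow> ('b \<Rightarrow> 'a) \<Rightarrow>
   (('a, 'n) chart \<Rightarrow> 'b \<Rightarrow> real^'n) \<Rightarrow> 'b \<Rightarrow> real" where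
  "ric_inf_normal A g f \<iota> \<nu> p =
     (let d = chart_at A (\<iota> p) in \<nu> d p \<bullet> (ric_inf g f d (\<iota> p) *v \<nu> d p))"

definition grad_norm2 ::
  "('b, 'm::finite) chart set \<Rightarrow> ('b, 'm) metric \<Rightarrow> ('b \<Rightarrow> real) \<Rightarrow> 'b \<Rightarrow> real" where
  "grad_norm2 B h \<phi> p =
     (let c = chart_at B p in grad h \<phi> c p \<bullet> (h c p *v grad h \<phi> c p))"

definition weighted_measure ::
  "('b::topological_space, 'm::finite) chart set \<Rightarrow> ('a, 'n::finite) chart set \<Rightarrow>
   ('a, 'n) metric \<Rightarrow> ('a \<Rightarrow> real) \<Rightarrow> ('b \<Rightarrow> 'a) \<Rightarrow> 'b measure" where
  "weighted_measure B A g f \<iota> =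
     density (riem_volume B (induced_metric A g \<iota>)) (\<lambda>p. ennreal (exp (- f (\<iota> p))))"

definition f_minimal ::
  "('b, 'm::finite) chart set \<Rightarrow> ('a, 'n::finite) chart set \<Rightarrow> ('a, 'n) metric \<Rightarrow>
   ('a \<Rightarrow> real) \<Rightarrow> ('b \<Rightarrow> 'a) \<Rightarrow> (('a, 'n) chart \<Rightarrow> 'b \<Rightarrow> real^'n) \<Rightarrow> bool" where
  "f_minimal B A g f \<iota> \<nu> \<longleftrightarrow>
     (\<forall>p. mean_curvature B A g \<iota> \<nu> p - normal_derivative A g f \<iota> \<nu> p = 0)"

text \<open>For test functions \<open>\<phi>\<close> as below both integrands are continuous with compact support, hence
  integrable.\<close>

definition f_stable ::
  "('b::topological_space, 'm::finite) chart set \<Rightarrow> ('a, 'n::finite) chart set \<Rightarrow>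
   ('a, 'n) metric \<Rightarrow> ('a \<Rightarrow> real) \<Rightarrow> ('b \<Rightarrow> 'a) \<Rightarrow> (('a, 'n) chart \<Rightarrow> 'b \<Rightarrow> real^'n) \<Rightarrow> bool" where
  "f_stable B A g f \<iota> \<nu> \<longleftrightarrow>
     (\<forall>\<phi>. smooth_fun B \<phi> \<and> compact (closure {p. \<phi> p \<noteq> 0}) \<longrightarrow>
        (LINT p|weighted_measure B A g f \<iota>.
           (ric_inf_normal A g f \<iota> \<nu> p + second_form_norm2 B A g \<iota> \<nu> p) * (\<phi> p)\<^sup>2)
        \<le> (LINT p|weighted_measure B A g f \<iota>. grad_norm2 B (induced_metric A g \<iota>) \<phi> p))"

end

theory Submission
  imports Defs
begin

text \<open>
  Since \<open>H = f\<^sub>\<nu>\<close> on an \<open>f\<close>-minimal hypersurface, \<open>|II|\<^sup>2 \<ge> H\<^sup>2 / (n - 1)\<close> gives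
  \<open>Ric\<^sub>f\<^sup>\<infinity>(\<nu>,\<nu>) + |II|\<^sup>2 \<ge> Ric\<^sub>f\<^sup>1(\<nu>,\<nu>) > 0\<close>. Testing stability with cutoff functions
  \<open>\<phi>\<close> that are at least \<open>1/2\<close> near a point and satisfy \<open>|\<nabla>\<phi>| \<le> 1/R\<close> bounds the integral of
  this positive function over a fixed open set by \<open>4 m(\<Sigma>) / R\<^sup>2\<close>, which tends to \<open>0\<close>.

  The cutoffs are obtained from completeness without the Hopf-Rinow theorem and without mollifying the
  distance. Let \<open>D\<close> be the supremum of the smooth functions \<open>u\<close> with \<open>|\<nabla>u| \<le> 1\<close> and compact
  \<open>closure {u > 0}\<close>. If \<open>D\<close> were finite somewhere, Ekeland's variational principle would give a point
  \<open>p\<close> near which \<open>D\<close> decreases at most at a small rate. There a smoothed maximum of an almost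
  optimal \<open>u\<close> with a paraboloid of slope at most \<open>1\<close> centred at \<open>p\<close> is admissible and exceeds
  \<open>D\<close> at \<open>p\<close>. Hence \<open>D = \<infinity>\<close> everywhere.
\<close>

section \<open>Smooth functions\<close>

text \<open>The integrands of the stability inequality are evaluated at \<open>p\<close> in charts
  picked by \<open>chart_at\<close>, which jump with \<open>p\<close>. Yet the potential
  \<open>Ric(\<nu>,\<nu>) + |II|^2\<close> has to be shown continuous: a Bochner integral that does
  not exist equals 0, and the inequality would then say nothing. Continuity is visible only in a
  fixed chart, so the tensor laws of Ricci curvature, Hessian and second fundamental form are
  derived from the coordinate formulas, although Christoffel symbols transform inhomogeneously. A
  large part of the proof goes into this. Why a finite \<open>D\<close> is absurd: it is 1-Lipschitz
  along curves and, being maximal, would have to descend from every point at a definite rate, as a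
  distance to infinity does. A nonnegative function on a complete manifold cannot do so: points
  chosen greedily among those reached at rate at least 1/100 have summable distances, hence
  converge, and near the limit hardly any descent is left. The gap between 1/100 and the slope 1
  allowed to competitors leaves room for all other constants.\<close>

lemma has_derivative_pd:
  fixes h :: "real^'n::finite \<Rightarrow> 'c::real_normed_vector"
  assumes "h differentiable at x"
  shows "(h has_derivative (\<lambda>v. \<Sum>i\<in>UNIV. v $ i *\<^sub>R pd i h x)) (at x)"
proof -
  have d: "(h has_derivative frechet_derivative h (at x)) (at x)"
    using assms frechet_derivative_works by blast
  have lin: "linear (frechet_derivative h (at x))"
    using d has_derivative_linear by blast
  have "frechet_derivative h (at x) v = (\<Sum>i\<in>UNIV. v $ i *\<^sub>R pd i h x)" for v
  proof -
    have "frechet_derivative h (at x) v = frechet_derivative h (at x) (\<Sum>i\<in>UNIV. v $ i *\<^sub>R axis i 1)"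
      using basis_expansion[of v] by (simp add: scalar_mult_eq_scaleR)
    also have "\<dots> = (\<Sum>i\<in>UNIV. v $ i *\<^sub>R pd i h x)"
      by (simp add: linear_sum[OF lin] linear_scale[OF lin] pd_def)
    finally show ?thesis .
  qed
  then have "frechet_derivative h (at x) = (\<lambda>v. \<Sum>i\<in>UNIV. v $ i *\<^sub>R pd i h x)" by blast
  with d show ?thesis by simp
qed

lemma pd_eqI: "(h has_derivative h') (at x) \<Longrightarrow> pd i h x = h' (axis i 1)"
  unfolding pd_def using frechet_derivative_at by metis

text \<open>Near \<open>x\<close> both functions have the same derivatives, so the choice operator
  in \<open>frechet_derivative\<close> returns the same map for both, whether or not a derivative
  exists.\<close>

lemma pd_cong_open:
  assumes "open S" "x \<in> S" "\<And>y. y \<in> S \<Longrightarrow> h y = k y"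
  shows "pd i h x = pd i k x"
proof -
  have "(h has_derivative D) (at x) \<longleftrightarrow> (k has_derivative D) (at x)" for D
    using assms by (metis has_derivative_transform_within_open)
  then show ?thesis by (simp add: pd_def frechet_derivative_def)
qed

lemma pd_const [simp]: "pd i (\<lambda>x. c) x = 0"
  by (simp add: pd_def)

lemma pd_linear:
  assumes "bounded_linear L" "h differentiable at x"
  shows "pd i (\<lambda>y. L (h y)) x = L (pd i h x)"
proof -
  have "((\<lambda>y. L (h y)) has_derivative (\<lambda>v. L (frechet_derivative h (at x) v))) (at x)"
    using assms bounded_linear.has_derivative frechet_derivative_works by blast
  from pd_eqI[OF this] show ?thesis by (simp add: pd_def)
qed

lemma pd_add:
  assumes "h differentiable at x" "k differentiable at x"
  shows "pd i (\<lambda>y. h y + k y) x = pd i h x + pd i k x"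
  by (rule pd_eqI[THEN trans, OF has_derivative_add[OF assms[unfolded frechet_derivative_works]]])
     (simp add: pd_def)

lemma (in bounded_bilinear) pd_bilinear:
  assumes "h differentiable at x" "k differentiable at x"
  shows "pd i (\<lambda>y. prod (h y) (k y)) x = prod (h x) (pd i k x) + prod (pd i h x) (k x)"
  by (rule pd_eqI[THEN trans, OF FDERIV[OF assms[unfolded frechet_derivative_works]]])
     (simp add: pd_def)

lemma pd_sum:
  assumes "\<And>j. j \<in> I \<Longrightarrow> h j differentiable at x"
  shows "pd i (\<lambda>y. \<Sum>j\<in>I. h j y) x = (\<Sum>j\<in>I. pd i (h j) x)"
  by (rule pd_eqI[THEN trans, OF has_derivative_sum[OF assms[unfolded frechet_derivative_works]]])
     (auto simp add: pd_def)

lemma pd_chain: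
  fixes F :: "real^'m::finite \<Rightarrow> real^'n::finite"
  assumes "F differentiable at x" "k differentiable at (F x)"
  shows "pd i (\<lambda>y. k (F y)) x = (\<Sum>j\<in>UNIV. pd i F x $ j *\<^sub>R pd j k (F x))"
  by (rule pd_eqI[THEN trans, OF has_derivative_compose[OF
      assms(1)[unfolded frechet_derivative_works] has_derivative_pd[OF assms(2)]]])
     (simp add: pd_def)

lemma pd_nth:
  fixes F :: "real^'m::finite \<Rightarrow> 'c::real_normed_vector^'n::finite"
  assumes "F differentiable at x"
  shows "pd i (\<lambda>y. F y $ k) x = pd i F x $ k"
  using pd_linear[OF bounded_linear_vec_nth assms] .


section \<open>Differentiability of finite order\<close>

text \<open>The derivatives of \<open>smooth_on\<close>, but counted: the calculus rules below
  follow by induction on \<open>n\<close>, since the derivative of a product or composite is built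
  from functions of one order less.\<close>

primrec Ck_on :: "nat \<Rightarrow> (real^'n::finite) set \<Rightarrow> (real^'n \<Rightarrow> 'c::real_normed_vector) \<Rightarrow> bool" where
  "Ck_on 0 S h \<longleftrightarrow> h differentiable_on S"
| "Ck_on (Suc n) S h \<longleftrightarrow> h differentiable_on S \<and> (\<forall>i. Ck_on n S (pd i h))"

text \<open>\<open>foldr\<close> takes first the derivative named last, so the index split off by
  \<open>Suc\<close> sits at the end of the list; hence \<open>is @ [i]\<close> and
  \<open>rev_cases\<close>.\<close>

lemma Ck_on_iff: "Ck_on n S h \<longleftrightarrow> (\<forall>is. length is \<le> n \<longrightarrow> foldr pd is h differentiable_on S)"
proof (induction n arbitrary: h)
  case (Suc n)
  have "(\<forall>is. length is \<le> Suc n \<longrightarrow> foldr pd is h differentiable_on S) \<longleftrightarrow>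
     h differentiable_on S \<and> (\<forall>i is. length is \<le> n \<longrightarrow> foldr pd is (pd i h) differentiable_on S)"
    (is "?l = ?r")
  proof
    assume l: ?l
    show ?r
    proof (intro conjI allI impI)
      show "h differentiable_on S" using l[rule_format, of "[]"] by simp
      fix i "is" assume "length (is::'a list) \<le> n"
      then show "foldr pd is (pd i h) differentiable_on S" using l[rule_format, of "is @ [i]"] by simp
    qed
  next
    assume r: ?r
    show ?l
    proof (intro allI impI)
      fix "is" :: "'a list" assume "length is \<le> Suc n"
      then show "foldr pd is h differentiable_on S"
        using r by (cases "is" rule: rev_cases) auto
    qed
  qed
  then show ?case using Suc by simp
qed simp

lemma smooth_on_Ck_on: "smooth_on S h \<longleftrightarrow> (\<forall>n. Ck_on n S h)"
  by (auto simp: smooth_on_def Ck_on_iff)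

lemma Ck_on_differentiable: "Ck_on n S h \<Longrightarrow> h differentiable_on S"
  by (cases n) auto

lemma Ck_on_Suc_D: "Ck_on (Suc n) S h \<Longrightarrow> Ck_on n S h"
  by (simp add: Ck_on_iff)

lemma Ck_on_at: "\<lbrakk>Ck_on n S h; open S; x \<in> S\<rbrakk> \<Longrightarrow> h differentiable at x"
  using Ck_on_differentiable differentiable_on_eq_differentiable_at by blast

lemma differentiable_on_cong:
  assumes "\<And>x. x \<in> S \<Longrightarrow> h x = k x" "h differentiable_on S"
  shows "k differentiable_on S"
  unfolding differentiable_on_def
proof
  fix x assume "x \<in> S"
  then show "k differentiable at x within S"
    using differentiable_transform_within[of h x S 1 k] assms by (simp add: differentiable_on_def)
qed

lemma Ck_on_cong:
  assumes "open S" "\<And>x. x \<in> S \<Longrightarrow> h x = k x" "Ck_on n S h"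
  shows "Ck_on n S k"
  using assms(2,3)
proof (induction n arbitrary: h k)
  case 0
  then show ?case using differentiable_on_cong[of S h k] by simp
next
  case (Suc n)
  have "k differentiable_on S"
    using Suc.prems(1) Ck_on_differentiable[OF Suc.prems(2)] differentiable_on_cong by blast
  moreover have "Ck_on n S (pd i k)" for i
    using Suc.prems(2) by (intro Suc.IH[of "pd i h" "pd i k"] pd_cong_open[OF assms(1)] Suc.prems(1)) auto
  ultimately show ?case by simp
qed

lemma Ck_on_const: "Ck_on n S (\<lambda>x. c)"
proof (induction n arbitrary: c)
  case (Suc n)
  have "pd i (\<lambda>x::real^'a. c) = (\<lambda>x. 0)" for i by (rule ext) simp
  then show ?case using Suc by simp
qed simp

lemma Ck_on_linear:
  assumes "open S" "bounded_linear L" "Ck_on n S h"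
  shows "Ck_on n S (\<lambda>x. L (h x))"
  using assms(3)
proof (induction n arbitrary: h)
  case 0
  then show ?case
    using assms(1,2) by (simp add: differentiable_on_eq_differentiable_at) (metis bounded_linear.has_derivative differentiable_def)
next
  case (Suc n)
  have d: "h differentiable at x" if "x \<in> S" for x using Ck_on_at[OF Suc.prems assms(1) that] .
  then have "(\<lambda>x. L (h x)) differentiable_on S"
    using assms(1,2) by (simp add: differentiable_on_eq_differentiable_at) (metis bounded_linear.has_derivative differentiable_def)
  moreover have "Ck_on n S (pd i (\<lambda>x. L (h x)))" for i
    by (rule Ck_on_cong[OF assms(1) _ Suc.IH[of "pd i h"]])
      (use Suc.prems d in \<open>auto simp: pd_linear[OF assms(2)]\<close>)
  ultimately show ?case by simp
qed

lemma Ck_on_add: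
  assumes "open S" "Ck_on n S h" "Ck_on n S k"
  shows "Ck_on n S (\<lambda>x. h x + k x)"
  using assms(2,3)
proof (induction n arbitrary: h k)
  case 0
  then show ?case using differentiable_on_add[of h S k] by simp
next
  case (Suc n)
  have d: "h differentiable at x" "k differentiable at x" if "x \<in> S" for x
    using Ck_on_at[OF Suc.prems(1) assms(1) that] Ck_on_at[OF Suc.prems(2) assms(1) that] .
  have "Ck_on n S (pd i (\<lambda>x. h x + k x))" for i
    by (rule Ck_on_cong[OF assms(1) _ Suc.IH[of "pd i h" "pd i k"]])
      (use Suc.prems d in \<open>auto simp: pd_add\<close>)
  then show ?case using Suc.prems by simp
qed

lemma (in bounded_bilinear) differentiable_bilinear:
  assumes "h differentiable at x" "k differentiable at x"
  shows "(\<lambda>x. prod (h x) (k x)) differentiable at x"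
  using FDERIV[OF assms[unfolded frechet_derivative_works]] by (rule differentiableI)

lemma (in bounded_bilinear) Ck_on_bilinear:
  assumes "open S" "Ck_on n S h" "Ck_on n S k"
  shows "Ck_on n S (\<lambda>x. prod (h x) (k x))"
  using assms(2,3)
proof (induction n arbitrary: h k)
  case 0
  then show ?case
    using assms(1) by (simp add: differentiable_on_eq_differentiable_at) (blast intro: differentiable_bilinear)
next
  case (Suc n)
  have d: "h differentiable at x" "k differentiable at x" if "x \<in> S" for x
    using Ck_on_at[OF Suc.prems(1) assms(1) that] Ck_on_at[OF Suc.prems(2) assms(1) that] .
  then have "(\<lambda>x. prod (h x) (k x)) differentiable_on S"
    using assms(1) by (simp add: differentiable_on_eq_differentiable_at) (blast intro: differentiable_bilinear)
  moreover have "Ck_on n S (pd i (\<lambda>x. prod (h x) (k x)))" for i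
    by (rule Ck_on_cong[OF assms(1) _ Ck_on_add[OF assms(1) Suc.IH[of h "pd i k"] Suc.IH[of "pd i h" k]]])
      (use Suc.prems d Suc.prems[THEN Ck_on_Suc_D] in \<open>auto simp: pd_bilinear\<close>)
  ultimately show ?case by simp
qed

lemma Ck_on_sum:
  assumes "open S" "\<And>j. j \<in> I \<Longrightarrow> Ck_on n S (h j)"
  shows "Ck_on n S (\<lambda>x. \<Sum>j\<in>I. h j x)"
  using assms(2) by (induction I rule: infinite_finite_induct) (auto intro: Ck_on_const Ck_on_add[OF assms(1)])

lemma differentiable_compose_at:
  "F differentiable at x \<Longrightarrow> k differentiable at (F x) \<Longrightarrow> (\<lambda>x. k (F x)) differentiable at x"
  by (rule differentiable_compose)

text \<open>By the chain rule the derivative is a sum of products of \<open>pd i F\<close> with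
  \<open>pd j k\<close> composed with \<open>F\<close>. The second factor is again a composite with
  the same \<open>F\<close>, so only \<open>k\<close> varies in the induction.\<close>

lemma Ck_on_compose:
  fixes F :: "real^'m::finite \<Rightarrow> real^'n::finite"
  assumes "open S" "open T" "F ` S \<subseteq> T" "Ck_on n S F" "Ck_on n T k"
  shows "Ck_on n S (\<lambda>x. k (F x))"
  using assms(4,5)
proof (induction n arbitrary: k)
  case 0
  then show ?case
    using assms(1-3) differentiable_compose_at[of F _ k]
    by (simp add: differentiable_on_eq_differentiable_at image_subset_iff)
next
  case (Suc n)
  have d: "F differentiable at x" "k differentiable at (F x)" if "x \<in> S" for x
    using Ck_on_at[OF Suc.prems(1) assms(1) that] Ck_on_at[OF Suc.prems(2) assms(2)] assms(3) that by auto
  then have "(\<lambda>x. k (F x)) differentiable_on S"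
    using assms(1) differentiable_compose_at[of F _ k]
    by (simp add: differentiable_on_eq_differentiable_at)
  moreover have "Ck_on n S (pd i (\<lambda>x. k (F x)))" for i
  proof (rule Ck_on_cong[OF assms(1)])
    show "Ck_on n S (\<lambda>x. \<Sum>j\<in>UNIV. pd i F x $ j *\<^sub>R pd j k (F x))"
    proof (intro Ck_on_sum assms(1) bounded_bilinear.Ck_on_bilinear[OF bounded_bilinear_scaleR])
      fix j
      show "Ck_on n S (\<lambda>x. pd i F x $ j)"
        using Suc.prems(1) Ck_on_linear[OF assms(1) bounded_linear_vec_nth, of n "pd i F" j] by simp
      show "Ck_on n S (\<lambda>x. pd j k (F x))"
        using Suc.IH[OF Ck_on_Suc_D[OF Suc.prems(1)]] Suc.prems(2) by simp
    qed
  qed (simp add: d pd_chain)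
  ultimately show ?case by simp
qed

lemmas Ck_on_mult = bounded_bilinear.Ck_on_bilinear[OF bounded_bilinear_mult]
lemmas Ck_on_uminus = Ck_on_linear[OF _ bounded_linear_minus[OF bounded_linear_ident]]

text \<open>The derivative \<open>- u' / u^2\<close> contains the reciprocal of the same
  \<open>u\<close>, needed one order lower, so the induction runs on \<open>n\<close> alone.\<close>

lemma Ck_on_inverse:
  fixes u :: "real^'n::finite \<Rightarrow> real"
  assumes "open S" "\<And>x. x \<in> S \<Longrightarrow> u x \<noteq> 0" "Ck_on n S u"
  shows "Ck_on n S (\<lambda>x. inverse (u x))"
proof -
  have dinv: "(\<lambda>x. inverse (u x)) differentiable_on S" if "u differentiable_on S"
    unfolding differentiable_on_def
  proof
    fix x assume "x \<in> S"
    then show "(\<lambda>x. inverse (u x)) differentiable at x within S"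
      using that unfolding differentiable_on_def by (intro differentiable_inverse assms(2)) auto
  qed
  show ?thesis
    using assms(3)
  proof (induction n)
    case 0
    then show ?case unfolding Ck_on.simps by (rule dinv)
  next
    case (Suc n)
    have d: "u differentiable at x" if "x \<in> S" for x using Ck_on_at[OF Suc.prems assms(1) that] .
    have "(\<lambda>x. inverse (u x)) differentiable_on S"
      using Suc.prems dinv Ck_on_differentiable by blast
    moreover have "Ck_on n S (pd i (\<lambda>x. inverse (u x)))" for i
    proof (rule Ck_on_cong[OF assms(1)])
      show "Ck_on n S (\<lambda>x. - (inverse (u x) * pd i u x * inverse (u x)))"
      proof -
        have 1: "Ck_on n S (\<lambda>x. inverse (u x))" by (rule Suc.IH[OF Ck_on_Suc_D[OF Suc.prems]])
        have 2: "Ck_on n S (pd i u)" using Suc.prems by simp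
        show ?thesis
          by (rule Ck_on_uminus[OF assms(1) Ck_on_mult[OF assms(1) Ck_on_mult[OF assms(1) 1 2] 1]])
      qed
      fix x assume x: "x \<in> S"
      have "((\<lambda>x. inverse (u x)) has_derivative
          (\<lambda>h. - (inverse (u x) * frechet_derivative u (at x) h * inverse (u x)))) (at x)"
        by (rule Deriv.has_derivative_inverse[OF assms(2)[OF x] d[OF x, unfolded frechet_derivative_works]])
      from pd_eqI[OF this] show "- (inverse (u x) * pd i u x * inverse (u x)) = pd i (\<lambda>x. inverse (u x)) x"
        unfolding pd_def by (rule sym)
    qed
    ultimately show ?case unfolding Ck_on.simps by blast
  qed
qed

text \<open>Smoothness of the outer function is encoded as membership in a set \<open>P\<close>
  closed under differentiation. In \<open>smooth_on_flat_softplus\<close> this set consists of all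
  \<open>flat p\<close> together with \<open>softplus\<close>.\<close>

lemma Ck_on_real_compose:
  fixes u :: "real^'n::finite \<Rightarrow> real" and P :: "(real \<Rightarrow> real) set"
  assumes "open S" "\<And>\<theta>. \<theta> \<in> P \<Longrightarrow> \<exists>\<theta>'\<in>P. \<forall>t. (\<theta> has_real_derivative \<theta>' t) (at t)"
    "\<theta> \<in> P" "Ck_on n S u"
  shows "Ck_on n S (\<lambda>x. \<theta> (u x))"
  using assms(3,4)
proof (induction n arbitrary: \<theta>)
  case 0
  then obtain \<theta>' where "\<And>t. (\<theta> has_real_derivative \<theta>' t) (at t)" using assms(2) by blast
  then have "\<theta> differentiable at t" for t
    using field_differentiable_imp_differentiable field_differentiable_def by blast
  then show ?case using 0 assms(1) differentiable_compose[of \<theta> u]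
    by (auto simp: differentiable_on_eq_differentiable_at)
next
  case (Suc n)
  then obtain \<theta>' where \<theta>': "\<theta>' \<in> P" "\<And>t. (\<theta> has_real_derivative \<theta>' t) (at t)" using assms(2) by blast
  then have "\<theta> differentiable at t" for t
    using field_differentiable_imp_differentiable field_differentiable_def by blast
  moreover have d: "u differentiable at x" if "x \<in> S" for x using Ck_on_at[OF Suc.prems(2) assms(1) that] .
  ultimately have "(\<lambda>x. \<theta> (u x)) differentiable_on S"
    using assms(1) differentiable_compose[of \<theta> u] by (auto simp: differentiable_on_eq_differentiable_at)
  moreover have "Ck_on n S (pd i (\<lambda>x. \<theta> (u x)))" for i
  proof (rule Ck_on_cong[OF assms(1)])
    show "Ck_on n S (\<lambda>x. \<theta>' (u x) * pd i u x)"
      using Suc.IH[OF \<theta>'(1)] Suc.prems(2) Ck_on_Suc_D[OF Suc.prems(2)]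
      by (intro bounded_bilinear.Ck_on_bilinear[OF bounded_bilinear_mult] assms(1)) auto
    fix x assume x: "x \<in> S"
    have "((\<lambda>x. \<theta> (u x)) has_derivative (\<lambda>h. \<theta>' (u x) * frechet_derivative u (at x) h)) (at x)"
      by (rule has_derivative_compose[OF d[OF x, unfolded frechet_derivative_works]
            \<theta>'(2)[unfolded has_field_derivative_def]])
    from pd_eqI[OF this] show "\<theta>' (u x) * pd i u x = pd i (\<lambda>x. \<theta> (u x)) x"
      by (simp add: pd_def)
  qed
  ultimately show ?case by simp
qed

section \<open>Rules for smooth functions\<close>

lemma smooth_on_at: "\<lbrakk>smooth_on S h; open S; x \<in> S\<rbrakk> \<Longrightarrow> h differentiable at x"
  using Ck_on_at smooth_on_Ck_on by blast

lemma smooth_on_pd: "smooth_on S h \<Longrightarrow> smooth_on S (pd i h)"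
  unfolding smooth_on_Ck_on using Ck_on.simps(2) by blast

lemma smooth_on_imp_continuous_on: "smooth_on S h \<Longrightarrow> continuous_on S h"
  using smooth_on_Ck_on Ck_on_differentiable differentiable_imp_continuous_on by blast

lemma smooth_on_cong:
  assumes "open S" "\<And>x. x \<in> S \<Longrightarrow> h x = k x"
  shows "smooth_on S h \<longleftrightarrow> smooth_on S k"
  unfolding smooth_on_Ck_on by (metis Ck_on_cong[OF assms(1)] assms(2))

lemma smooth_on_subset: "\<lbrakk>smooth_on S h; T \<subseteq> S\<rbrakk> \<Longrightarrow> smooth_on T h"
  unfolding smooth_on_def using differentiable_on_subset by blast

lemma smooth_on_local:
  assumes "\<And>x. x \<in> S \<Longrightarrow> \<exists>T. open T \<and> x \<in> T \<and> smooth_on T h"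
  shows "smooth_on S h"
  unfolding smooth_on_def differentiable_on_def
proof (intro allI ballI)
  fix "is" x assume "x \<in> S"
  then obtain T where "open T" "x \<in> T" "smooth_on T h" using assms by blast
  then have "foldr pd is h differentiable at x"
    unfolding smooth_on_def using differentiable_on_eq_differentiable_at by blast
  then show "foldr pd is h differentiable at x within S"
    by (rule differentiable_at_withinI)
qed

lemma smooth_on_const: "smooth_on S (\<lambda>x. c)"
  by (simp add: smooth_on_Ck_on Ck_on_const)

lemma smooth_on_linear:
  "\<lbrakk>open S; bounded_linear L; smooth_on S h\<rbrakk> \<Longrightarrow> smooth_on S (\<lambda>x. L (h x))"
  by (simp add: smooth_on_Ck_on Ck_on_linear)

lemma smooth_on_ident: "open S \<Longrightarrow> smooth_on S (\<lambda>x::real^'n::finite. x)"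
proof -
  assume S: "open S"
  have "pd i (\<lambda>x::real^'n. x) = (\<lambda>x. axis i 1)" for i by (rule ext) (simp add: pd_def)
  then have "Ck_on n S (\<lambda>x::real^'n. x)" for n by (cases n) (auto simp: Ck_on_const)
  then show ?thesis by (simp add: smooth_on_Ck_on)
qed

lemma smooth_on_add:
  "\<lbrakk>open S; smooth_on S h; smooth_on S k\<rbrakk> \<Longrightarrow> smooth_on S (\<lambda>x. h x + k x)"
  by (simp add: smooth_on_Ck_on Ck_on_add)

lemma smooth_on_uminus: "\<lbrakk>open S; smooth_on S h\<rbrakk> \<Longrightarrow> smooth_on S (\<lambda>x. - h x)"
  by (rule smooth_on_linear[OF _ bounded_linear_minus[OF bounded_linear_ident]])

lemma smooth_on_diff:
  "\<lbrakk>open S; smooth_on S h; smooth_on S k\<rbrakk> \<Longrightarrow> smooth_on S (\<lambda>x. h x - k x)"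
  using smooth_on_add[OF _ _ smooth_on_uminus, of S h k] by simp

lemma smooth_on_sum:
  "\<lbrakk>open S; \<And>j. j \<in> I \<Longrightarrow> smooth_on S (h j)\<rbrakk> \<Longrightarrow> smooth_on S (\<lambda>x. \<Sum>j\<in>I. h j x)"
  by (simp add: smooth_on_Ck_on Ck_on_sum)

lemma (in bounded_bilinear) smooth_on_bilinear:
  "\<lbrakk>open S; smooth_on S h; smooth_on S k\<rbrakk> \<Longrightarrow> smooth_on S (\<lambda>x. prod (h x) (k x))"
  by (simp add: smooth_on_Ck_on Ck_on_bilinear)

lemmas smooth_on_mult = bounded_bilinear.smooth_on_bilinear[OF bounded_bilinear_mult]
lemmas smooth_on_scaleR = bounded_bilinear.smooth_on_bilinear[OF bounded_bilinear_scaleR]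
lemmas smooth_on_inner = bounded_bilinear.smooth_on_bilinear[OF bounded_bilinear_inner]

lemma smooth_on_nth: "\<lbrakk>open S; smooth_on S h\<rbrakk> \<Longrightarrow> smooth_on S (\<lambda>x. h x $ k)"
  by (rule smooth_on_linear[OF _ bounded_linear_vec_nth])

lemma smooth_on_prod:
  fixes h :: "'j \<Rightarrow> real^'n::finite \<Rightarrow> real"
  assumes "open S" "\<And>j. j \<in> I \<Longrightarrow> smooth_on S (h j)"
  shows "smooth_on S (\<lambda>x. \<Prod>j\<in>I. h j x)"
  using assms(2)
  by (induction I rule: infinite_finite_induct) (auto intro: smooth_on_const smooth_on_mult[OF assms(1)])

lemma smooth_on_inverse:
  fixes u :: "real^'n::finite \<Rightarrow> real"
  shows "\<lbrakk>open S; smooth_on S u; \<And>x. x \<in> S \<Longrightarrow> u x \<noteq> 0\<rbrakk> \<Longrightarrow> smooth_on S (\<lambda>x. inverse (u x))"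
  by (simp add: smooth_on_Ck_on Ck_on_inverse)

lemma smooth_on_divide:
  fixes u v :: "real^'n::finite \<Rightarrow> real"
  shows "\<lbrakk>open S; smooth_on S u; smooth_on S v; \<And>x. x \<in> S \<Longrightarrow> v x \<noteq> 0\<rbrakk> \<Longrightarrow> smooth_on S (\<lambda>x. u x / v x)"
  unfolding divide_inverse by (intro smooth_on_mult smooth_on_inverse)

lemma smooth_on_compose:
  fixes F :: "real^'m::finite \<Rightarrow> real^'n::finite"
  assumes "open S" "open T" "F ` S \<subseteq> T" "smooth_on S F" "smooth_on T k"
  shows "smooth_on S (\<lambda>x. k (F x))"
  using assms(4,5) Ck_on_compose[where k = k, OF assms(1-3)] unfolding smooth_on_Ck_on by blast

lemma bounded_linear_axis: "bounded_linear (axis i :: 'c::euclidean_space \<Rightarrow> 'c^'k::finite)"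
  by (intro linear_conv_bounded_linear[THEN iffD1] linearI) (auto simp: vec_eq_iff axis_def)

lemma vec_lambda_axis: "(\<chi> i. w i) = (\<Sum>i\<in>UNIV. axis i (w i :: 'c::comm_monoid_add))"
  by (simp add: vec_eq_iff axis_def if_distrib)

lemma smooth_on_vec_lambda:
  fixes h :: "'k::finite \<Rightarrow> real^'n::finite \<Rightarrow> 'c::euclidean_space"
  assumes "open S" "\<And>k. smooth_on S (h k)"
  shows "smooth_on S (\<lambda>x. \<chi> k. h k x)"
  unfolding vec_lambda_axis
  by (intro smooth_on_sum assms(1) smooth_on_linear[OF _ bounded_linear_axis] assms(2))

lemma smooth_on_matrix_vector_mult:
  fixes A :: "real^'n::finite \<Rightarrow> real^'k::finite^'l::finite"
  shows "\<lbrakk>open S; smooth_on S A; smooth_on S v\<rbrakk> \<Longrightarrow> smooth_on S (\<lambda>x. A x *v v x)"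
  unfolding matrix_vector_mult_def
  by (intro smooth_on_vec_lambda smooth_on_sum smooth_on_mult smooth_on_nth)

lemma smooth_on_matrix_mult:
  fixes A :: "real^'n::finite \<Rightarrow> real^'k::finite^'l::finite"
  shows "\<lbrakk>open S; smooth_on S A; smooth_on S B\<rbrakk> \<Longrightarrow> smooth_on S (\<lambda>x. A x ** B x)"
  unfolding matrix_matrix_mult_def
  by (intro smooth_on_vec_lambda smooth_on_sum smooth_on_mult smooth_on_nth)

lemma smooth_on_transpose:
  fixes A :: "real^'n::finite \<Rightarrow> real^'k::finite^'l::finite"
  shows "\<lbrakk>open S; smooth_on S A\<rbrakk> \<Longrightarrow> smooth_on S (\<lambda>x. transpose (A x))"
  unfolding transpose_def by (intro smooth_on_vec_lambda smooth_on_nth)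

lemma smooth_on_det:
  fixes A :: "real^'n::finite \<Rightarrow> real^'k::finite^'k"
  shows "\<lbrakk>open S; smooth_on S A\<rbrakk> \<Longrightarrow> smooth_on S (\<lambda>x. det (A x))"
  unfolding det_def
  by (intro smooth_on_sum smooth_on_mult smooth_on_prod smooth_on_nth smooth_on_const)

lemma matrix_inv_right: "invertible A \<Longrightarrow> A ** matrix_inv A = mat 1"
  and matrix_inv_left: "invertible A \<Longrightarrow> matrix_inv A ** A = mat 1"
  unfolding invertible_def matrix_inv_def by (metis (mono_tags, lifting) someI_ex)+

text \<open>\<open>matrix_inv\<close> is defined by choice; Cramer's rule turns its entries into
  quotients of determinants, whose smooth dependence on the matrix is evident.\<close>

lemma matrix_inv_cramer:
  fixes A :: "real^'k::finite^'k"
  assumes "invertible A"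
  shows "matrix_inv A = (\<chi> k l. det (\<chi> i j. if j = k then (axis l 1 :: real^'k) $ i else A $ i $ j) / det A)"
proof -
  have "column l (matrix_inv A) = (\<chi> k. det (\<chi> i j. if j = k then (axis l 1 :: real^'k) $ i else A $ i $ j) / det A)" for l
  proof -
    have "A *v (matrix_inv A *v axis l 1) = axis l 1"
      by (simp add: matrix_vector_mul_assoc matrix_inv_right assms)
    moreover have "det A \<noteq> 0" using assms invertible_det_nz by blast
    ultimately show ?thesis using cramer[of A "matrix_inv A *v axis l 1" "axis l 1"]
      by (simp add: matrix_vector_mult_basis)
  qed
  then show ?thesis by (simp add: vec_eq_iff column_def)
qed

lemma smooth_on_matrix_inv:
  fixes A :: "real^'n::finite \<Rightarrow> real^'k::finite^'k"
  assumes "open S" "smooth_on S A" "\<And>x. x \<in> S \<Longrightarrow> invertible (A x)"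
  shows "smooth_on S (\<lambda>x. matrix_inv (A x))"
proof -
  have *: "smooth_on S (\<lambda>x. \<chi> k l. det (\<chi> i j. if j = k then (axis l 1 :: real^'k) $ i else A x $ i $ j) / det (A x))"
  proof (intro smooth_on_vec_lambda smooth_on_divide smooth_on_det assms(1,2))
    fix k l i j :: 'k
    show "smooth_on S (\<lambda>x. if j = k then (axis l 1 :: real^'k) $ i else A x $ i $ j)"
      by (cases "j = k") (simp_all add: smooth_on_const smooth_on_nth assms(1,2))
  qed (use assms(3) invertible_det_nz in blast)
  show ?thesis
    by (rule smooth_on_cong[THEN iffD1, OF assms(1) _ *]) (simp add: matrix_inv_cramer assms(3))
qed

section \<open>Symmetry of second derivatives\<close>

lemma pd_line:
  fixes h :: "real^'n::finite \<Rightarrow> real"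
  assumes "h differentiable at (y + s *\<^sub>R axis i 1)"
  shows "((\<lambda>s. h (y + s *\<^sub>R axis i 1)) has_real_derivative pd i h (y + s *\<^sub>R axis i 1)) (at s)"
proof -
  have l: "((\<lambda>s. y + s *\<^sub>R axis i 1) has_vector_derivative (axis i 1)) (at s)"
    by (auto intro!: derivative_eq_intros)
  have "((h \<circ> (\<lambda>s. y + s *\<^sub>R axis i 1)) has_vector_derivative
      frechet_derivative h (at (y + s *\<^sub>R axis i 1)) (axis i 1)) (at s)"
    by (rule vector_derivative_diff_chain_within[OF l has_derivative_at_withinI[OF assms[unfolded frechet_derivative_works]]])
  then show ?thesis
    by (simp add: o_def pd_def has_real_derivative_iff_has_vector_derivative)
qed

text \<open>Mean value theorem twice, first in direction \<open>i\<close>, then in direction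
  \<open>j\<close>. The left side is symmetric in \<open>i\<close> and \<open>j\<close>, so
  exchanging them gives a value of the other mixed derivative.\<close>

lemma second_difference:
  fixes h :: "real^'n::finite \<Rightarrow> real"
  assumes sm: "smooth_on S h" and S: "open S" and b: "ball x (3 * t) \<subseteq> S" and t: "0 < t"
  shows "\<exists>y\<in>ball x (3 * t). h (x + t *\<^sub>R axis i 1 + t *\<^sub>R axis j 1) - h (x + t *\<^sub>R axis i 1)
      - h (x + t *\<^sub>R axis j 1) + h x = t\<^sup>2 * pd j (pd i h) y"
proof -
  \<comment> \<open>Such a point has distance at most \<open>2 * t\<close> from \<open>x\<close>, so
    it lies inside the open ball of radius \<open>3 * t\<close>.\<close>
  have nb: "x + s *\<^sub>R axis i 1 + r *\<^sub>R axis j 1 \<in> ball x (3 * t)" if "0 \<le> s" "s \<le> t" "0 \<le> r" "r \<le> t" for s r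
  proof -
    have "norm (s *\<^sub>R axis i 1 + r *\<^sub>R axis j (1::real)) \<le> s + r"
      by (rule order_trans[OF norm_triangle_ineq]) (use that in simp)
    moreover have "dist x (x + s *\<^sub>R axis i 1 + r *\<^sub>R axis j 1) = norm (s *\<^sub>R axis i 1 + r *\<^sub>R axis j (1::real))"
      by (metis add.assoc add_diff_cancel_left' dist_commute dist_norm)
    ultimately show ?thesis using that t by simp
  qed
  have in_S: "x + s *\<^sub>R axis i 1 + r *\<^sub>R axis j 1 \<in> S" if "0 \<le> s" "s \<le> t" "0 \<le> r" "r \<le> t" for s r
    using nb[OF that] b by blast
  let ?\<phi> = "\<lambda>s. h ((x + t *\<^sub>R axis j 1) + s *\<^sub>R axis i 1) - h (x + s *\<^sub>R axis i 1)"
  let ?\<phi>' = "\<lambda>s. pd i h ((x + t *\<^sub>R axis j 1) + s *\<^sub>R axis i 1) - pd i h (x + s *\<^sub>R axis i 1)"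
  have "(?\<phi> has_real_derivative ?\<phi>' s) (at s)" if "0 \<le> s" "s \<le> t" for s
    using that t in_S[of s t] in_S[of s 0]
    by (intro DERIV_diff pd_line smooth_on_at[OF sm S]) (simp_all add: add_ac)
  from MVT2[OF t this] obtain s where s: "0 < s" "s < t" "?\<phi> t - ?\<phi> 0 = (t - 0) * ?\<phi>' s" by blast
  let ?\<psi> = "\<lambda>r. pd i h ((x + s *\<^sub>R axis i 1) + r *\<^sub>R axis j 1)"
  let ?\<psi>' = "\<lambda>r. pd j (pd i h) ((x + s *\<^sub>R axis i 1) + r *\<^sub>R axis j 1)"
  have "(?\<psi> has_real_derivative ?\<psi>' r) (at r)" if "0 \<le> r" "r \<le> t" for r
    using that s in_S[of s r] by (intro pd_line smooth_on_at[OF smooth_on_pd[OF sm] S]) auto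
  from MVT2[OF t this] obtain r where r: "0 < r" "r < t" "?\<psi> t - ?\<psi> 0 = (t - 0) * ?\<psi>' r" by blast
  have "?\<phi> t - ?\<phi> 0 = t * (t * ?\<psi>' r)"
    using s(3) r(3) by (simp add: add_ac)
  then have "h (x + t *\<^sub>R axis i 1 + t *\<^sub>R axis j 1) - h (x + t *\<^sub>R axis i 1)
      - h (x + t *\<^sub>R axis j 1) + h x = t\<^sup>2 * ?\<psi>' r"
    by (simp add: add_ac power2_eq_square)
  then show ?thesis using nb[of s r] s r by (intro bexI[of _ "x + s *\<^sub>R axis i 1 + r *\<^sub>R axis j 1"]) simp_all
qed

text \<open>The two versions of the same second difference give equal values of the mixed
  derivatives at points arbitrarily near \<open>x\<close>; continuity carries the equality to
  \<open>x\<close>.\<close>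

lemma pd_commute_real:
  fixes h :: "real^'n::finite \<Rightarrow> real"
  assumes sm: "smooth_on S h" and S: "open S" and x: "x \<in> S"
  shows "pd i (pd j h) x = pd j (pd i h) x"
proof (rule ccontr)
  assume ne: "pd i (pd j h) x \<noteq> pd j (pd i h) x"
  \<comment> \<open>Half the gap: two errors below \<open>e\<close> cannot bridge it.\<close>
  define e where "e = \<bar>pd i (pd j h) x - pd j (pd i h) x\<bar> / 2"
  have e: "e > 0" using ne by (simp add: e_def)
  have c: "isCont (pd i (pd j h)) x" "isCont (pd j (pd i h)) x"
    using smooth_on_imp_continuous_on[OF smooth_on_pd[OF smooth_on_pd[OF sm]]] S x
    by (auto simp: continuous_on_eq_continuous_at)
  obtain d1 where d1: "d1 > 0" "\<And>y. dist y x < d1 \<Longrightarrow> dist (pd i (pd j h) y) (pd i (pd j h) x) < e"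
    using c(1) e unfolding continuous_at_eps_delta by blast
  obtain d2 where d2: "d2 > 0" "\<And>y. dist y x < d2 \<Longrightarrow> dist (pd j (pd i h) y) (pd j (pd i h) x) < e"
    using c(2) e unfolding continuous_at_eps_delta by blast
  obtain d3 where d3: "d3 > 0" "ball x d3 \<subseteq> S" using S x openE by blast
  define t where "t = min d1 (min d2 d3) / 3"
  have t: "t > 0" "3 * t \<le> d1" "3 * t \<le> d2" "3 * t \<le> d3" using d1 d2 d3 by (auto simp: t_def)
  have b: "ball x (3 * t) \<subseteq> S" using d3 t by fastforce
  obtain y where y: "y \<in> ball x (3 * t)"
    "h (x + t *\<^sub>R axis i 1 + t *\<^sub>R axis j 1) - h (x + t *\<^sub>R axis i 1)
      - h (x + t *\<^sub>R axis j 1) + h x = t\<^sup>2 * pd j (pd i h) y"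
    using second_difference[OF sm S b t(1), of i j] by blast
  obtain z where z: "z \<in> ball x (3 * t)"
    "h (x + t *\<^sub>R axis j 1 + t *\<^sub>R axis i 1) - h (x + t *\<^sub>R axis j 1)
      - h (x + t *\<^sub>R axis i 1) + h x = t\<^sup>2 * pd i (pd j h) z"
    using second_difference[OF sm S b t(1), of j i] by blast
  have "t\<^sup>2 * pd j (pd i h) y = t\<^sup>2 * pd i (pd j h) z"
    using y(2) z(2) by (simp add: algebra_simps)
  then have "pd j (pd i h) y = pd i (pd j h) z" using t by simp
  moreover have "dist (pd i (pd j h) z) (pd i (pd j h) x) < e"
    using z t by (intro d1(2)) (auto simp: dist_commute)
  moreover have "dist (pd j (pd i h) y) (pd j (pd i h) x) < e"
    using y t by (intro d2(2)) (auto simp: dist_commute)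
  ultimately show False unfolding e_def dist_real_def by argo
qed

lemma pd_commute:
  fixes F :: "real^'n::finite \<Rightarrow> 'c::euclidean_space"
  assumes sm: "smooth_on S F" and S: "open S" and x: "x \<in> S"
  shows "pd i (pd j F) x = pd j (pd i F) x"
proof -
  have "pd i (pd j F) x \<bullet> b = pd i (pd j (\<lambda>y. F y \<bullet> b)) x" for i j b
  proof -
    have "pd i (pd j F) x \<bullet> b = pd i (\<lambda>y. pd j F y \<bullet> b) x"
      by (rule pd_linear[OF bounded_linear_inner_left smooth_on_at[OF smooth_on_pd[OF sm] S x], symmetric])
    also have "\<dots> = pd i (pd j (\<lambda>y. F y \<bullet> b)) x"
      by (rule pd_cong_open[OF S x]) (rule pd_linear[OF bounded_linear_inner_left smooth_on_at[OF sm S], symmetric])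
    finally show ?thesis .
  qed
  moreover have "pd i (pd j (\<lambda>y. F y \<bullet> b)) x = pd j (pd i (\<lambda>y. F y \<bullet> b)) x" for b
    by (rule pd_commute_real[OF smooth_on_linear[OF S bounded_linear_inner_left sm] S x])
  ultimately have "pd i (pd j F) x \<bullet> b = pd j (pd i F) x \<bullet> b" for b
    by metis
  then show ?thesis by (blast intro: euclidean_eqI)
qed

section \<open>Connection and curvature under coordinate changes\<close>

lemma bounded_bilinear_matrix_vector_mult:
  "bounded_bilinear ((*v) :: real^'n::finite^'m::finite \<Rightarrow> _)"
  unfolding bilinear_conv_bounded_bilinear[symmetric] bilinear_def
  by (auto intro!: linearI simp: matrix_vector_right_distrib matrix_vector_mult_add_rdistrib
      matrix_vector_mult_scaleR scaleR_matrix_vector_assoc)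

lemma bounded_bilinear_matrix_mult:
  "bounded_bilinear ((**) :: real^'n::finite^'m::finite \<Rightarrow> real^'k::finite^'n \<Rightarrow> _)"
  unfolding bilinear_conv_bounded_bilinear[symmetric] bilinear_def
  by (auto intro!: linearI simp: vec_eq_iff
      matrix_matrix_mult_def sum_distrib_left sum.distrib algebra_simps)

lemmas pd_inner = bounded_bilinear.pd_bilinear[OF bounded_bilinear_inner]
lemmas pd_matrix_vector_mult = bounded_bilinear.pd_bilinear[OF bounded_bilinear_matrix_vector_mult]
lemmas pd_matrix_mult = bounded_bilinear.pd_bilinear[OF bounded_bilinear_matrix_mult]
lemmas pd_scaleR = bounded_bilinear.pd_bilinear[OF bounded_bilinear_scaleR]
lemmas mv_sum_left = bounded_bilinear.sum_left[OF bounded_bilinear_matrix_vector_mult]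
lemmas mv_sum_right = bounded_bilinear.sum_right[OF bounded_bilinear_matrix_vector_mult]
lemmas mv_scaleR_left = bounded_bilinear.scaleR_left[OF bounded_bilinear_matrix_vector_mult]
lemmas mv_scaleR_right = bounded_bilinear.scaleR_right[OF bounded_bilinear_matrix_vector_mult]
lemmas mm_sum_left = bounded_bilinear.sum_left[OF bounded_bilinear_matrix_mult]
lemmas mm_sum_right = bounded_bilinear.sum_right[OF bounded_bilinear_matrix_mult]
lemmas mm_scaleR_left = bounded_bilinear.scaleR_left[OF bounded_bilinear_matrix_mult]
lemmas mm_scaleR_right = bounded_bilinear.scaleR_right[OF bounded_bilinear_matrix_mult]
lemmas mv_add_left = bounded_bilinear.add_left[OF bounded_bilinear_matrix_vector_mult]
lemmas mv_add_right = bounded_bilinear.add_right[OF bounded_bilinear_matrix_vector_mult]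
lemmas mv_diff_left = bounded_bilinear.diff_left[OF bounded_bilinear_matrix_vector_mult]
lemmas mv_diff_right = bounded_bilinear.diff_right[OF bounded_bilinear_matrix_vector_mult]

lemma bounded_linear_matrix_vector_mult_left:
  "bounded_linear (\<lambda>A::real^'n::finite^'m::finite. A *v v)"
  by (rule bounded_bilinear.bounded_linear_left[OF bounded_bilinear_matrix_vector_mult])

lemma inner_transpose_mult:
  fixes A :: "real^'n::finite^'m::finite"
  shows "x \<bullet> (transpose A *v y) = (A *v x) \<bullet> y"
  using dot_lmul_matrix[of y A x] by (simp add: inner_commute)

lemma matrix_eq_bilinear:
  fixes M M' :: "real^'n::finite^'m::finite"
  assumes "\<And>v w. v \<bullet> (M *v w) = v \<bullet> (M' *v w)"
  shows "M = M'"
  by (metis assms matrix_eq vector_eq_rdot inner_commute)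

lemma posdef_invertible:
  fixes M :: "real^'n::finite^'n"
  assumes "\<And>v. v \<noteq> 0 \<Longrightarrow> v \<bullet> (M *v v) > 0"
  shows "invertible M"
  unfolding invertible_left_inverse matrix_left_invertible_ker
  by (metis assms inner_zero_right less_irrefl)

section \<open>The Levi-Civita connection in coordinates\<close>

definition christoffel_vec :: "(real^'n::finite \<Rightarrow> real^'n^'n) \<Rightarrow> real^'n \<Rightarrow> real^'n \<Rightarrow> real^'n \<Rightarrow> real^'n" where
  "christoffel_vec G x u v = (\<chi> k. \<Sum>a\<in>UNIV. \<Sum>b\<in>UNIV. christoffel G k a b x * u $ a * v $ b)"

text \<open>The derivative of the metric in direction \<open>u\<close>, evaluated on
  \<open>v\<close> and \<open>w\<close>: \<open>(\<partial>\<^sub>u g)(v,w)\<close>.\<close>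

definition metric_deriv :: "(real^'n::finite \<Rightarrow> real^'n^'n) \<Rightarrow> real^'n \<Rightarrow> real^'n \<Rightarrow> real^'n \<Rightarrow> real^'n \<Rightarrow> real" where
  "metric_deriv G x u v w = (\<Sum>c\<in>UNIV. u $ c * (v \<bullet> (pd c G x *v w)))"

lemma metric_deriv_expand:
  "metric_deriv G x u v w = (\<Sum>a\<in>UNIV. \<Sum>b\<in>UNIV. \<Sum>l\<in>UNIV. u $ a * (v $ b * (w $ l * pd a G x $ b $ l)))"
  unfolding metric_deriv_def inner_vec_def matrix_vector_mult_def
  by (simp add: sum_distrib_left mult_ac)

text \<open>The Koszul formula for fields with constant coefficients, whose brackets vanish;
  multiplication by \<open>G\<close> cancels the inverse matrix in \<open>christoffel\<close>. Since
  only first derivatives of the metric remain, the transformation law of \<Gamma> can be read off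
  from that of \<open>metric_deriv\<close>.\<close>

lemma koszul:
  assumes inv: "invertible (G x)" and d: "G differentiable at x"
  shows "w \<bullet> (G x *v christoffel_vec G x u v) = (metric_deriv G x u v w + metric_deriv G x v u w - metric_deriv G x w u v) / 2"
proof -
  have dn: "(\<lambda>y. G y $ j) differentiable at x" for j
    using bounded_linear.has_derivative[OF bounded_linear_vec_nth d[unfolded frechet_derivative_works]]
    by (rule differentiableI)
  \<comment> \<open>Christoffel symbols of the first kind, that is, with the upper index
    lowered.\<close>
  define K where "K a b l = (pd a G x $ b $ l + pd b G x $ a $ l - pd l G x $ a $ b) / 2" for a b l
  have christoffel_vec_expand: "christoffel G k a b x = (\<Sum>l\<in>UNIV. matrix_inv (G x) $ k $ l * K a b l)" for k a b
    unfolding christoffel_def K_def by (simp add: pd_nth[OF dn] pd_nth[OF d] sum_distrib_left)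
  define Z where "Z = (\<chi> l. \<Sum>a\<in>UNIV. \<Sum>b\<in>UNIV. K a b l * u $ a * v $ b)"
  have "christoffel_vec G x u v = matrix_inv (G x) *v Z"
  proof (rule vec_eq_iff[THEN iffD2], rule allI)
    fix k
    have "christoffel_vec G x u v $ k = (\<Sum>a\<in>UNIV. \<Sum>b\<in>UNIV. \<Sum>l\<in>UNIV. matrix_inv (G x) $ k $ l * (K a b l * u $ a * v $ b))"
      by (simp add: christoffel_vec_def christoffel_vec_expand sum_distrib_right sum_distrib_left mult_ac)
    also have "\<dots> = (\<Sum>a\<in>UNIV. \<Sum>l\<in>UNIV. \<Sum>b\<in>UNIV. matrix_inv (G x) $ k $ l * (K a b l * u $ a * v $ b))"
      by (rule sum.cong[OF refl], rule sum.swap)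
    also have "\<dots> = (\<Sum>l\<in>UNIV. \<Sum>a\<in>UNIV. \<Sum>b\<in>UNIV. matrix_inv (G x) $ k $ l * (K a b l * u $ a * v $ b))"
      by (rule sum.swap)
    also have "\<dots> = (matrix_inv (G x) *v Z) $ k"
      by (simp add: Z_def matrix_vector_mult_def sum_distrib_left)
    finally show "christoffel_vec G x u v $ k = (matrix_inv (G x) *v Z) $ k" .
  qed
  then have "G x *v christoffel_vec G x u v = Z"
    by (simp add: matrix_vector_mul_assoc matrix_inv_right inv)
  then have "w \<bullet> (G x *v christoffel_vec G x u v) = (\<Sum>l\<in>UNIV. \<Sum>a\<in>UNIV. \<Sum>b\<in>UNIV. w $ l * (u $ a * (v $ b * K a b l)))"
    by (simp add: Z_def inner_vec_def sum_distrib_left mult_ac)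
  also have "\<dots> = ((\<Sum>l\<in>UNIV. \<Sum>a\<in>UNIV. \<Sum>b\<in>UNIV. u $ a * (v $ b * (w $ l * pd a G x $ b $ l)))
     + (\<Sum>l\<in>UNIV. \<Sum>a\<in>UNIV. \<Sum>b\<in>UNIV. v $ b * (u $ a * (w $ l * pd b G x $ a $ l)))
     - (\<Sum>l\<in>UNIV. \<Sum>a\<in>UNIV. \<Sum>b\<in>UNIV. w $ l * (u $ a * (v $ b * pd l G x $ a $ b)))) / 2"
    unfolding sum_divide_distrib sum.distrib[symmetric] sum_subtractf[symmetric]
    by (intro sum.cong refl) (simp add: K_def algebra_simps add_divide_distrib diff_divide_distrib)
  also have "(\<Sum>l\<in>UNIV. \<Sum>a\<in>UNIV. \<Sum>b\<in>UNIV. u $ a * (v $ b * (w $ l * pd a G x $ b $ l))) = metric_deriv G x u v w"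
    unfolding metric_deriv_expand
    by (subst sum.swap, rule sum.cong[OF refl], rule sum.swap)
  also have "(\<Sum>l\<in>UNIV. \<Sum>a\<in>UNIV. \<Sum>b\<in>UNIV. v $ b * (u $ a * (w $ l * pd b G x $ a $ l))) = metric_deriv G x v u w"
  proof -
    have "(\<Sum>l\<in>UNIV. \<Sum>a\<in>UNIV. \<Sum>b\<in>UNIV. v $ b * (u $ a * (w $ l * pd b G x $ a $ l)))
       = (\<Sum>l\<in>UNIV. \<Sum>b\<in>UNIV. \<Sum>a\<in>UNIV. v $ b * (u $ a * (w $ l * pd b G x $ a $ l)))"
      by (rule sum.cong[OF refl], rule sum.swap)
    also have "\<dots> = (\<Sum>b\<in>UNIV. \<Sum>l\<in>UNIV. \<Sum>a\<in>UNIV. v $ b * (u $ a * (w $ l * pd b G x $ a $ l)))"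
      by (rule sum.swap)
    also have "\<dots> = (\<Sum>b\<in>UNIV. \<Sum>a\<in>UNIV. \<Sum>l\<in>UNIV. v $ b * (u $ a * (w $ l * pd b G x $ a $ l)))"
      by (rule sum.cong[OF refl], rule sum.swap)
    finally show ?thesis by (simp add: metric_deriv_expand)
  qed
  also have "(\<Sum>l\<in>UNIV. \<Sum>a\<in>UNIV. \<Sum>b\<in>UNIV. w $ l * (u $ a * (v $ b * pd l G x $ a $ b))) = metric_deriv G x w u v"
    by (simp add: metric_deriv_expand)
  finally show ?thesis .
qed

text \<open>The connection form applied to the \<open>i\<close>-th coordinate field, as an
  endomorphism.\<close>

definition conn_matrix :: "(real^'n::finite \<Rightarrow> real^'n^'n) \<Rightarrow> 'n \<Rightarrow> real^'n \<Rightarrow> real^'n^'n" where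
  "conn_matrix G i x = (\<chi> k j. christoffel G k i j x)"

lemma christoffel_vec_conn_matrix: "christoffel_vec G x u v = (\<Sum>i\<in>UNIV. u $ i *\<^sub>R (conn_matrix G i x *v v))"
  unfolding christoffel_vec_def conn_matrix_def matrix_vector_mult_def
  by (simp add: vec_eq_iff sum_distrib_left mult_ac)

lemma smooth_on_christoffel:
  assumes S: "open S" and sm: "smooth_on S G" and inv: "\<And>x. x \<in> S \<Longrightarrow> invertible (G x)"
  shows "smooth_on S (christoffel G k i j)"
proof -
  have 1: "smooth_on S (pd a (\<lambda>y. G y $ b $ l))" for a b l
    by (intro smooth_on_pd smooth_on_nth S sm)
  have 2: "smooth_on S (\<lambda>x. matrix_inv (G x) $ k $ l)" for l
    by (intro smooth_on_nth smooth_on_matrix_inv S sm inv)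
  have "smooth_on S (\<lambda>x. 1/2 * (\<Sum>l\<in>UNIV. matrix_inv (G x) $ k $ l *
        (pd i (\<lambda>y. G y $ j $ l) x + pd j (\<lambda>y. G y $ i $ l) x - pd l (\<lambda>y. G y $ i $ j) x)))"
    by (intro smooth_on_mult smooth_on_sum smooth_on_add smooth_on_diff smooth_on_const S 1 2)
  then show ?thesis by (simp add: christoffel_def[abs_def])
qed

lemma smooth_on_conn_matrix:
  assumes S: "open S" and sm: "smooth_on S G" and inv: "\<And>x. x \<in> S \<Longrightarrow> invertible (G x)"
  shows "smooth_on S (conn_matrix G i)"
  unfolding conn_matrix_def[abs_def] by (intro smooth_on_vec_lambda smooth_on_christoffel assms)

section \<open>Curvature operator and Ricci curvature as a trace\<close>

text \<open>The endomorphism \<open>R(\<partial>\<^sub>i,\<partial>\<^sub>j)\<close>, as the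
  curvature form of the connection form \<open>conn_matrix\<close>; \<open>riem_op\<close> extends
  it bilinearly.\<close>

definition curv_matrix :: "(real^'n::finite \<Rightarrow> real^'n^'n) \<Rightarrow> 'n \<Rightarrow> 'n \<Rightarrow> real^'n \<Rightarrow> real^'n^'n" where
  "curv_matrix G i j x = pd i (conn_matrix G j) x - pd j (conn_matrix G i) x + (conn_matrix G i x ** conn_matrix G j x - conn_matrix G j x ** conn_matrix G i x)"

lemma riemann_curv_matrix:
  assumes S: "open S" and sm: "smooth_on S G" and inv: "\<And>x. x \<in> S \<Longrightarrow> invertible (G x)" and x: "x \<in> S"
  shows "riemann G l k i j x = curv_matrix G i j x $ l $ k"
proof -
  have c: "pd i (conn_matrix G j) x $ l $ k = pd i (christoffel G l j k) x" for i j
  proof -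
    have d: "conn_matrix G j differentiable at x"
      by (rule smooth_on_at[OF smooth_on_conn_matrix[OF S sm inv] S x])
    have dl: "(\<lambda>y. conn_matrix G j y $ l) differentiable at x"
      by (rule smooth_on_at[OF smooth_on_nth[OF S smooth_on_conn_matrix[OF S sm inv]] S x])
    show ?thesis
      using pd_nth[OF dl, of i k] pd_nth[OF d, of i l] by (simp add: conn_matrix_def)
  qed
  show ?thesis
    unfolding riemann_def curv_matrix_def by (simp add: c matrix_matrix_mult_def conn_matrix_def sum_subtractf)
qed

definition riem_op :: "(real^'n::finite \<Rightarrow> real^'n^'n) \<Rightarrow> real^'n \<Rightarrow> real^'n \<Rightarrow> real^'n \<Rightarrow> real^'n^'n" where
  "riem_op G x u v = (\<Sum>i\<in>UNIV. \<Sum>j\<in>UNIV. (u $ i * v $ j) *\<^sub>R curv_matrix G i j x)"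

lemma sum_axis:
  fixes f :: "'n::finite \<Rightarrow> 'c::real_vector"
  shows "(\<Sum>i\<in>UNIV. (axis a 1 :: real^'n::finite) $ i *\<^sub>R f i) = f a"
proof -
  have "(\<Sum>i\<in>UNIV. (axis a 1 :: real^'n::finite) $ i *\<^sub>R f i) = (\<Sum>i\<in>UNIV. if i = a then f i else 0)"
    by (rule sum.cong) (auto simp: axis_def)
  then show ?thesis by simp
qed

lemma riem_op_left: "riem_op G x u v = (\<Sum>i\<in>UNIV. u $ i *\<^sub>R (\<Sum>j\<in>UNIV. v $ j *\<^sub>R curv_matrix G i j x))"
  by (simp add: riem_op_def scaleR_sum_right)

text \<open>Once Ricci curvature is the trace of an endomorphism, its invariance follows from that
  of the trace under conjugation by the Jacobian.\<close>

lemma ricci_trace: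
  assumes S: "open S" and sm: "smooth_on S G" and inv: "\<And>x. x \<in> S \<Longrightarrow> invertible (G x)" and x: "x \<in> S"
  shows "v \<bullet> (ricci_coord G x *v w) = trace (matrix (\<lambda>u. riem_op G x u v *v w))"
proof -
  have "trace (matrix (\<lambda>u. riem_op G x u v *v w)) = (\<Sum>i\<in>UNIV. ((\<Sum>j\<in>UNIV. v $ j *\<^sub>R curv_matrix G i j x) *v w) $ i)"
    by (simp add: trace_def matrix_def riem_op_left sum_axis)
  also have "\<dots> = (\<Sum>i\<in>UNIV. \<Sum>j\<in>UNIV. v $ j * (\<Sum>k\<in>UNIV. curv_matrix G i j x $ i $ k * w $ k))"
    by (simp add: mv_sum_left mv_scaleR_left) (simp add: matrix_vector_mult_def)
  also have "\<dots> = (\<Sum>j\<in>UNIV. \<Sum>i\<in>UNIV. v $ j * (\<Sum>k\<in>UNIV. curv_matrix G i j x $ i $ k * w $ k))"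
    by (rule sum.swap)
  also have "\<dots> = (\<Sum>j\<in>UNIV. v $ j * (\<Sum>k\<in>UNIV. (\<Sum>i\<in>UNIV. curv_matrix G i j x $ i $ k) * w $ k))"
    by (simp add: sum_distrib_left sum_distrib_right) (intro sum.cong refl sum.swap)
  also have "\<dots> = v \<bullet> (ricci_coord G x *v w)"
    by (simp add: inner_vec_def ricci_coord_def matrix_vector_mult_def riemann_curv_matrix[OF S sm inv x])
  finally show ?thesis by simp
qed

lemma linear_lincomb:
  fixes f :: "'n::finite \<Rightarrow> 'c::real_vector"
  shows "linear (\<lambda>u::real^'n. \<Sum>i\<in>UNIV. u $ i *\<^sub>R f i)"
  by (rule linearI) (simp_all add: scaleR_left_distrib sum.distrib scaleR_sum_right)

lemma linear_riem_op: "linear (\<lambda>u. riem_op G x u v *v w)"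
  unfolding riem_op_left mv_sum_left mv_scaleR_left by (rule linear_lincomb)

section \<open>The coordinate Hessian\<close>

definition dir_deriv :: "(real^'n::finite \<Rightarrow> real) \<Rightarrow> real^'n \<Rightarrow> real^'n \<Rightarrow> real" where
  "dir_deriv u x z = (\<Sum>k\<in>UNIV. z $ k * pd k u x)"

definition dir_deriv2 :: "(real^'n::finite \<Rightarrow> real) \<Rightarrow> real^'n \<Rightarrow> real^'n \<Rightarrow> real^'n \<Rightarrow> real" where
  "dir_deriv2 u x v w = (\<Sum>i\<in>UNIV. v $ i * (\<Sum>j\<in>UNIV. w $ j * pd i (pd j u) x))"

lemma dir_deriv_add: "dir_deriv u x (y + z) = dir_deriv u x y + dir_deriv u x z"
  by (simp add: dir_deriv_def sum.distrib algebra_simps)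

lemma dir_deriv_scaleR: "dir_deriv u x (a *\<^sub>R z) = a * dir_deriv u x z"
  by (simp add: dir_deriv_def sum_distrib_left algebra_simps)

lemma dir_deriv_sum: "dir_deriv u x (\<Sum>i\<in>I. f i) = (\<Sum>i\<in>I. dir_deriv u x (f i))"
  unfolding dir_deriv_def by (simp add: sum_distrib_right) (rule sum.swap)

lemma hess_bilinear:
  "v \<bullet> (hess_coord G u x *v w) = dir_deriv2 u x v w - dir_deriv u x (christoffel_vec G x v w)"
proof -
  have "v \<bullet> (hess_coord G u x *v w) = (\<Sum>i\<in>UNIV. v $ i * (\<Sum>j\<in>UNIV. w $ j * pd i (pd j u) x))
     - (\<Sum>i\<in>UNIV. \<Sum>j\<in>UNIV. \<Sum>k\<in>UNIV. v $ i * (w $ j * (christoffel G k i j x * pd k u x)))"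
    by (simp add: inner_vec_def matrix_vector_mult_def hess_coord_def algebra_simps sum_subtractf
        sum_distrib_left)
  also have "(\<Sum>i\<in>UNIV. \<Sum>j\<in>UNIV. \<Sum>k\<in>UNIV. v $ i * (w $ j * (christoffel G k i j x * pd k u x)))
     = (\<Sum>i\<in>UNIV. \<Sum>k\<in>UNIV. \<Sum>j\<in>UNIV. v $ i * (w $ j * (christoffel G k i j x * pd k u x)))"
    by (rule sum.cong[OF refl], rule sum.swap)
  also have "\<dots> = (\<Sum>k\<in>UNIV. \<Sum>i\<in>UNIV. \<Sum>j\<in>UNIV. v $ i * (w $ j * (christoffel G k i j x * pd k u x)))"
    by (rule sum.swap)
  also have "\<dots> = dir_deriv u x (christoffel_vec G x v w)"
    by (simp add: dir_deriv_def christoffel_vec_def sum_distrib_right sum_distrib_left mult_ac)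
  finally show ?thesis by (simp add: dir_deriv2_def)
qed

section \<open>Change of coordinates: connection and Hessian\<close>

lemma jacobian_nth: "matrix (frechet_derivative F (at x)) = (\<chi> k i. pd i F x $ k)"
  by (simp add: matrix_def pd_def)

lemma jacobian_mult:
  "matrix (frechet_derivative F (at x)) *v v = (\<Sum>j\<in>UNIV. v $ j *\<^sub>R pd j F x)"
  by (simp add: jacobian_nth vec_eq_iff matrix_vector_mult_def mult.commute)

lemma smooth_on_jacobian:
  fixes F :: "real^'m::finite \<Rightarrow> real^'n::finite"
  assumes "open S" "smooth_on S F"
  shows "smooth_on S (\<lambda>x. matrix (frechet_derivative F (at x)))"
  unfolding jacobian_nth
  by (intro smooth_on_vec_lambda smooth_on_nth smooth_on_pd assms)

text \<open>The overlap of two charts in Euclidean terms: \<open>\<Phi>\<close> is the transition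
  map and \<open>G\<close> the pullback of \<open>G'\<close>. Invertibility of \<open>J\<close>
  comes from \<open>posG\<close>: if \<open>J\<close> kills \<open>v\<close>, then the form of
  \<open>G\<close> vanishes on \<open>v\<close>, so \<open>v = 0\<close>.\<close>

locale coord_change =
  fixes U V :: "(real^'n::finite) set" and \<Phi> :: "real^'n \<Rightarrow> real^'n"
    and G G' :: "real^'n \<Rightarrow> real^'n^'n" and J :: "real^'n \<Rightarrow> real^'n^'n"
  assumes U: "open U" and V: "open V" and maps: "\<Phi> ` U \<subseteq> V"
    and sm: "smooth_on U \<Phi>" and smG': "smooth_on V G'"
    and symG': "\<And>y. y \<in> V \<Longrightarrow> transpose (G' y) = G' y"
    and posG': "\<And>y v. y \<in> V \<Longrightarrow> v \<noteq> 0 \<Longrightarrow> v \<bullet> (G' y *v v) > 0"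
    and posG: "\<And>x v. x \<in> U \<Longrightarrow> v \<noteq> 0 \<Longrightarrow> v \<bullet> (G x *v v) > 0"
    and J: "\<And>x. J x = matrix (frechet_derivative \<Phi> (at x))"
    and pull: "\<And>x. x \<in> U \<Longrightarrow> G x = transpose (J x) ** G' (\<Phi> x) ** J x"
begin

lemma map_in: "x \<in> U \<Longrightarrow> \<Phi> x \<in> V" using maps by blast

lemma smJ: "smooth_on U J"
  using smooth_on_jacobian[OF U sm] J by (simp add: fun_eq_iff[symmetric] J[abs_def])

lemma J_axis: "J x *v axis i 1 = pd i \<Phi> x"
  unfolding J jacobian_mult by (rule sum_axis)

lemma J_mult: "J x *v v = (\<Sum>j\<in>UNIV. v $ j *\<^sub>R pd j \<Phi> x)"
  unfolding J jacobian_mult ..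

lemma G_bil: "x \<in> U \<Longrightarrow> v \<bullet> (G x *v w) = (J x *v v) \<bullet> (G' (\<Phi> x) *v (J x *v w))"
  by (simp only: pull matrix_vector_mul_assoc[symmetric] inner_transpose_mult)

lemma G'_sym: "y \<in> V \<Longrightarrow> v \<bullet> (G' y *v w) = w \<bullet> (G' y *v v)"
  by (metis inner_transpose_mult symG' inner_commute)

lemma invG: "x \<in> U \<Longrightarrow> invertible (G x)" using posdef_invertible posG by blast
lemma invG': "y \<in> V \<Longrightarrow> invertible (G' y)" using posdef_invertible posG' by blast

lemma invJ: "x \<in> U \<Longrightarrow> invertible (J x)"
  unfolding invertible_left_inverse matrix_left_invertible_ker
  by (metis G_bil posG inner_zero_left less_irrefl)

lemma J_surj: "x \<in> U \<Longrightarrow> \<exists>w. J x *v w = z"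
  by (metis invJ matrix_inv_right matrix_vector_mul_assoc matrix_vector_mul_lid)

lemma smG'\<Phi>: "smooth_on U (\<lambda>x. G' (\<Phi> x))"
  by (rule smooth_on_compose[OF U V maps sm smG'])

lemma smG: "smooth_on U G"
proof -
  have "smooth_on U (\<lambda>x. transpose (J x) ** G' (\<Phi> x) ** J x)"
    by (intro smooth_on_matrix_mult smooth_on_transpose U smJ smG'\<Phi>)
  then show ?thesis using smooth_on_cong[OF U, of G "\<lambda>x. transpose (J x) ** G' (\<Phi> x) ** J x"] pull by simp
qed

lemma dJ: "x \<in> U \<Longrightarrow> J differentiable at x" by (rule smooth_on_at[OF smJ U])
lemma d\<Phi>: "x \<in> U \<Longrightarrow> \<Phi> differentiable at x" by (rule smooth_on_at[OF sm U])
lemma dG: "x \<in> U \<Longrightarrow> G differentiable at x" by (rule smooth_on_at[OF smG U])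
lemma dG': "y \<in> V \<Longrightarrow> G' differentiable at y" by (rule smooth_on_at[OF smG' V])
lemma dG'\<Phi>: "x \<in> U \<Longrightarrow> (\<lambda>x. G' (\<Phi> x)) differentiable at x" by (rule smooth_on_at[OF smG'\<Phi> U])

lemma dJv: "x \<in> U \<Longrightarrow> (\<lambda>x. J x *v v) differentiable at x"
  by (rule smooth_on_at[OF smooth_on_matrix_vector_mult[OF U smJ smooth_on_const] U])

lemma pd_Jv: "x \<in> U \<Longrightarrow> pd c (\<lambda>y. J y *v v) x = pd c J x *v v"
  by (rule pd_linear[OF bounded_linear_matrix_vector_mult_left dJ])

lemma pd_J: "x \<in> U \<Longrightarrow> pd c J x *v v = (\<Sum>j\<in>UNIV. v $ j *\<^sub>R pd c (pd j \<Phi>) x)"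
proof -
  assume x: "x \<in> U"
  have d: "pd j \<Phi> differentiable at x" for j
    by (rule smooth_on_at[OF smooth_on_pd[OF sm] U x])
  have ds: "(\<lambda>y. v $ j *\<^sub>R pd j \<Phi> y) differentiable at x" for j
    by (rule smooth_on_at[OF smooth_on_scaleR[OF U smooth_on_const smooth_on_pd[OF sm]] U x])
  have "pd c J x *v v = pd c (\<lambda>y. \<Sum>j\<in>UNIV. v $ j *\<^sub>R pd j \<Phi> y) x"
    unfolding pd_Jv[OF x, symmetric] J_mult ..
  also have "\<dots> = (\<Sum>j\<in>UNIV. v $ j *\<^sub>R pd c (pd j \<Phi>) x)"
    by (simp add: pd_sum ds pd_linear[OF bounded_linear_scaleR_right d])
  finally show ?thesis .
qed

text \<open>The second derivative of the transition map, applied to \<open>u\<close> and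
  \<open>v\<close>; it is the inhomogeneous term in the transformation law of \<Gamma>.\<close>

definition D2 :: "real^'n \<Rightarrow> real^'n \<Rightarrow> real^'n \<Rightarrow> real^'n" where
  "D2 x u v = (\<Sum>c\<in>UNIV. u $ c *\<^sub>R (pd c J x *v v))"

lemma D2_sym: "x \<in> U \<Longrightarrow> D2 x u v = D2 x v u"
proof -
  assume x: "x \<in> U"
  have "D2 x u v = (\<Sum>c\<in>UNIV. \<Sum>j\<in>UNIV. (u $ c * v $ j) *\<^sub>R pd c (pd j \<Phi>) x)" for u v
    by (simp add: D2_def pd_J x scaleR_sum_right)
  note e = this
  have "D2 x v u = (\<Sum>j\<in>UNIV. \<Sum>c\<in>UNIV. (v $ c * u $ j) *\<^sub>R pd c (pd j \<Phi>) x)"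
    unfolding e by (rule sum.swap)
  also have "\<dots> = D2 x u v"
  proof -
    have "(v $ c * u $ j) *\<^sub>R pd c (pd j \<Phi>) x = (u $ j * v $ c) *\<^sub>R pd j (pd c \<Phi>) x" for c j
      using pd_commute[OF sm U x, of c j] by (simp add: mult.commute)
    then show ?thesis by (simp add: e)
  qed
  finally show ?thesis ..
qed

lemma pd_G'\<Phi>: "x \<in> U \<Longrightarrow> pd c (\<lambda>y. G' (\<Phi> y)) x = (\<Sum>a\<in>UNIV. pd c \<Phi> x $ a *\<^sub>R pd a G' (\<Phi> x))"
  by (rule pd_chain[OF d\<Phi> dG'[OF map_in]])

text \<open>Product rule for the pulled-back metric: two terms from differentiating
  \<open>J\<close>, one from differentiating \<open>G'\<close> in the image direction.\<close>

lemma metric_deriv_pull: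
  assumes x: "x \<in> U"
  shows "metric_deriv G x u v w = D2 x u v \<bullet> (G' (\<Phi> x) *v (J x *v w)) + (J x *v v) \<bullet> (G' (\<Phi> x) *v D2 x u w)
     + metric_deriv G' (\<Phi> x) (J x *v u) (J x *v v) (J x *v w)"
proof -
  have dGw: "(\<lambda>y. G' (\<Phi> y) *v (J y *v w)) differentiable at x"
    by (rule smooth_on_at[OF smooth_on_matrix_vector_mult[OF U smG'\<Phi>
          smooth_on_matrix_vector_mult[OF U smJ smooth_on_const]] U x])
  have bl: "bounded_linear (\<lambda>A::real^'n^'n. v \<bullet> (A *v w))"
    by (rule bounded_linear_compose[OF bounded_linear_inner_right bounded_linear_matrix_vector_mult_left])
  have "v \<bullet> (pd c G x *v w) = (pd c J x *v v) \<bullet> (G' (\<Phi> x) *v (J x *v w))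
      + (J x *v v) \<bullet> (G' (\<Phi> x) *v (pd c J x *v w))
      + (J x *v v) \<bullet> ((\<Sum>a\<in>UNIV. pd c \<Phi> x $ a *\<^sub>R pd a G' (\<Phi> x)) *v (J x *v w))" for c
  proof -
    have "v \<bullet> (pd c G x *v w) = pd c (\<lambda>y. v \<bullet> (G y *v w)) x"
      by (rule pd_linear[OF bl dG[OF x], symmetric])
    also have "\<dots> = pd c (\<lambda>y. (J y *v v) \<bullet> (G' (\<Phi> y) *v (J y *v w))) x"
      by (rule pd_cong_open[OF U x G_bil])
    also have "\<dots> = (J x *v v) \<bullet> (pd c (\<lambda>y. G' (\<Phi> y) *v (J y *v w)) x) + (pd c J x *v v) \<bullet> (G' (\<Phi> x) *v (J x *v w))"
      by (simp add: pd_inner[OF dJv[OF x] dGw] pd_Jv x)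
    also have "pd c (\<lambda>y. G' (\<Phi> y) *v (J y *v w)) x = G' (\<Phi> x) *v (pd c J x *v w)
        + (\<Sum>a\<in>UNIV. pd c \<Phi> x $ a *\<^sub>R pd a G' (\<Phi> x)) *v (J x *v w)"
      by (simp add: pd_matrix_vector_mult[OF dG'\<Phi>[OF x] dJv[OF x]] pd_Jv pd_G'\<Phi> x)
    finally show ?thesis by (simp add: inner_add_right)
  qed
  then have "metric_deriv G x u v w = (\<Sum>c\<in>UNIV. u $ c * ((pd c J x *v v) \<bullet> (G' (\<Phi> x) *v (J x *v w))))
      + (\<Sum>c\<in>UNIV. u $ c * ((J x *v v) \<bullet> (G' (\<Phi> x) *v (pd c J x *v w))))
      + (\<Sum>c\<in>UNIV. u $ c * ((J x *v v) \<bullet> ((\<Sum>a\<in>UNIV. pd c \<Phi> x $ a *\<^sub>R pd a G' (\<Phi> x)) *v (J x *v w))))"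
    by (simp add: metric_deriv_def distrib_left sum.distrib)
  also have "(\<Sum>c\<in>UNIV. u $ c * ((pd c J x *v v) \<bullet> (G' (\<Phi> x) *v (J x *v w)))) = D2 x u v \<bullet> (G' (\<Phi> x) *v (J x *v w))"
    by (simp add: D2_def inner_sum_left)
  also have "(\<Sum>c\<in>UNIV. u $ c * ((J x *v v) \<bullet> (G' (\<Phi> x) *v (pd c J x *v w)))) = (J x *v v) \<bullet> (G' (\<Phi> x) *v D2 x u w)"
    by (simp only: D2_def mv_sum_right mv_scaleR_right inner_sum_right inner_scaleR_right)
  also have "(\<Sum>c\<in>UNIV. u $ c * ((J x *v v) \<bullet> ((\<Sum>a\<in>UNIV. pd c \<Phi> x $ a *\<^sub>R pd a G' (\<Phi> x)) *v (J x *v w))))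
     = metric_deriv G' (\<Phi> x) (J x *v u) (J x *v v) (J x *v w)"
  proof -
    have "(\<Sum>c\<in>UNIV. u $ c * ((J x *v v) \<bullet> ((\<Sum>a\<in>UNIV. pd c \<Phi> x $ a *\<^sub>R pd a G' (\<Phi> x)) *v (J x *v w))))
      = (\<Sum>c\<in>UNIV. \<Sum>a\<in>UNIV. u $ c * pd c \<Phi> x $ a * ((J x *v v) \<bullet> (pd a G' (\<Phi> x) *v (J x *v w))))"
      by (simp only: mv_sum_left mv_scaleR_left inner_sum_right inner_scaleR_right sum_distrib_left mult.assoc)
    also have "\<dots> = (\<Sum>a\<in>UNIV. \<Sum>c\<in>UNIV. u $ c * pd c \<Phi> x $ a * ((J x *v v) \<bullet> (pd a G' (\<Phi> x) *v (J x *v w))))"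
      by (rule sum.swap)
    also have "\<dots> = metric_deriv G' (\<Phi> x) (J x *v u) (J x *v v) (J x *v w)"
      unfolding metric_deriv_def by (simp only: J_mult[of x u] sum_component vector_scaleR_component real_scaleR_def sum_distrib_right)
    finally show ?thesis .
  qed
  finally show ?thesis .
qed

text \<open>Inserting \<open>metric_deriv_pull\<close> into the Koszul formula produces six terms
  with \<open>D2\<close>. As \<open>D2\<close> and \<open>G'\<close> are symmetric, four of them
  cancel and the other two combine to the single inhomogeneous term.\<close>

lemma christoffel_vec_transform:
  assumes x: "x \<in> U"
  shows "J x *v christoffel_vec G x u v = D2 x u v + christoffel_vec G' (\<Phi> x) (J x *v u) (J x *v v)"
proof -
  let ?J = "J x" and ?G' = "G' (\<Phi> x)"
  define z where "z = ?J *v christoffel_vec G x u v - (D2 x u v + christoffel_vec G' (\<Phi> x) (?J *v u) (?J *v v))"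
  \<comment> \<open>The defect \<open>z\<close> is tested against itself: \<open>w\<close> is its
    preimage under \<open>J\<close>, and positivity of \<open>G'\<close> then forces
    \<open>z = 0\<close>.\<close>
  obtain w where w: "?J *v w = z" using J_surj[OF x] by blast
  note s = G'_sym[OF map_in[OF x]]
  have "(?J *v w) \<bullet> (?G' *v (?J *v christoffel_vec G x u v)) = w \<bullet> (G x *v christoffel_vec G x u v)"
    by (simp add: G_bil x)
  also have "\<dots> = (metric_deriv G x u v w + metric_deriv G x v u w - metric_deriv G x w u v) / 2"
    by (rule koszul[OF invG[OF x] dG[OF x]])
  also have "\<dots> = D2 x u v \<bullet> (?G' *v (?J *v w)) + (metric_deriv G' (\<Phi> x) (?J *v u) (?J *v v) (?J *v w)
      + metric_deriv G' (\<Phi> x) (?J *v v) (?J *v u) (?J *v w) - metric_deriv G' (\<Phi> x) (?J *v w) (?J *v u) (?J *v v)) / 2"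
    unfolding metric_deriv_pull[OF x] D2_sym[OF x, of v u] D2_sym[OF x, of w u] D2_sym[OF x, of w v]
    using s[of "?J *v v" "D2 x u w"] s[of "?J *v u" "D2 x v w"] by simp
  also have "\<dots> = (?J *v w) \<bullet> (?G' *v D2 x u v) + (?J *v w) \<bullet> (?G' *v christoffel_vec G' (\<Phi> x) (?J *v u) (?J *v v))"
    unfolding koszul[OF invG'[OF map_in[OF x]] dG'[OF map_in[OF x]]] s[of "D2 x u v"] ..
  finally have "z \<bullet> (?G' *v z) = 0"
    unfolding w z_def by (simp only: mv_diff_right mv_add_right inner_diff_right inner_add_right)
  then have "z = 0" using posG'[OF map_in[OF x], of z] by (metis less_irrefl)
  then show ?thesis by (simp add: z_def)
qed

lemma dir_deriv_pull:
  assumes x: "x \<in> U" and d: "h differentiable at (\<Phi> x)"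
  shows "dir_deriv (\<lambda>y. h (\<Phi> y)) x z = dir_deriv h (\<Phi> x) (J x *v z)"
  unfolding J_mult dir_deriv_sum dir_deriv_scaleR
  by (simp add: dir_deriv_def pd_chain[OF d\<Phi>[OF x] d])

text \<open>The second differentiation also hits \<open>J\<close>. This contributes the derivative
  of \<open>h\<close> along \<open>D2\<close>, which in \<open>hess_transform\<close> cancels
  against the same term coming from \<Gamma>.\<close>

lemma dir_deriv2_pull:
  assumes x: "x \<in> U" and h: "smooth_on V h"
  shows "dir_deriv2 (\<lambda>y. h (\<Phi> y)) x v w = dir_deriv2 h (\<Phi> x) (J x *v v) (J x *v w) + dir_deriv h (\<Phi> x) (D2 x v w)"
proof -
  have hd: "h differentiable at (\<Phi> y)" if "y \<in> U" for y
    by (rule smooth_on_at[OF h V map_in[OF that]])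
  have dp: "(\<lambda>y. pd a h (\<Phi> y)) differentiable at x" for a
    by (rule smooth_on_at[OF smooth_on_compose[OF U V maps sm smooth_on_pd[OF h]] U x])
  have hp: "pd a h differentiable at (\<Phi> x)" for a
    by (rule smooth_on_at[OF smooth_on_pd[OF h] V map_in[OF x]])
  have dn: "(\<lambda>y. (J y *v w) $ a) differentiable at x" for a
    by (rule smooth_on_at[OF smooth_on_nth[OF U smooth_on_matrix_vector_mult[OF U smJ smooth_on_const]] U x])
  have pn: "pd i (\<lambda>y. (J y *v w) $ a) x = (pd i J x *v w) $ a" for i a
    by (simp add: pd_nth[OF dJv[OF x]] pd_Jv x)
  have "(\<Sum>j\<in>UNIV. w $ j * pd i (pd j (\<lambda>y. h (\<Phi> y))) x)
     = dir_deriv h (\<Phi> x) (pd i J x *v w) + (\<Sum>b\<in>UNIV. pd i \<Phi> x $ b * (\<Sum>a\<in>UNIV. (J x *v w) $ a * pd b (pd a h) (\<Phi> x)))" for i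
  proof -
    have sm_h\<Phi>: "smooth_on U (\<lambda>y. h (\<Phi> y))" by (rule smooth_on_compose[OF U V maps sm h])
    have "(\<Sum>j\<in>UNIV. w $ j * pd i (pd j (\<lambda>y. h (\<Phi> y))) x) = pd i (\<lambda>y. dir_deriv (\<lambda>y. h (\<Phi> y)) y w) x"
    proof -
      have 1: "pd j (\<lambda>y. h (\<Phi> y)) differentiable at x" for j
        by (rule smooth_on_at[OF smooth_on_pd[OF sm_h\<Phi>] U x])
      have 2: "(\<lambda>y. w $ j * pd j (\<lambda>y. h (\<Phi> y)) y) differentiable at x" for j
        by (rule smooth_on_at[OF smooth_on_mult[OF U smooth_on_const smooth_on_pd[OF sm_h\<Phi>]] U x])
      show ?thesis
        unfolding dir_deriv_def pd_sum[OF 2] by (intro sum.cong refl pd_linear[OF bounded_linear_mult_right 1, symmetric])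
    qed
    also have "\<dots> = pd i (\<lambda>y. \<Sum>a\<in>UNIV. (J y *v w) $ a * pd a h (\<Phi> y)) x"
      by (rule pd_cong_open[OF U x]) (simp add: dir_deriv_pull hd, simp add: dir_deriv_def)
    also have "\<dots> = (\<Sum>a\<in>UNIV. (J x *v w) $ a * (\<Sum>b\<in>UNIV. pd i \<Phi> x $ b * pd b (pd a h) (\<Phi> x)) + (pd i J x *v w) $ a * pd a h (\<Phi> x))"
    proof -
      have 1: "(\<lambda>y. (J y *v w) $ a * pd a h (\<Phi> y)) differentiable at x" for a
        by (rule bounded_bilinear.differentiable_bilinear[OF bounded_bilinear_mult dn dp])
      show ?thesis
        by (simp add: pd_sum 1 bounded_bilinear.pd_bilinear[OF bounded_bilinear_mult dn dp] pn
            pd_chain[OF d\<Phi>[OF x] hp])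
    qed
    also have "\<dots> = (\<Sum>a\<in>UNIV. \<Sum>b\<in>UNIV. pd i \<Phi> x $ b * ((J x *v w) $ a * pd b (pd a h) (\<Phi> x))) + dir_deriv h (\<Phi> x) (pd i J x *v w)"
      by (simp add: sum.distrib dir_deriv_def sum_distrib_left mult_ac)
    also have "(\<Sum>a\<in>UNIV. \<Sum>b\<in>UNIV. pd i \<Phi> x $ b * ((J x *v w) $ a * pd b (pd a h) (\<Phi> x)))
       = (\<Sum>b\<in>UNIV. \<Sum>a\<in>UNIV. pd i \<Phi> x $ b * ((J x *v w) $ a * pd b (pd a h) (\<Phi> x)))"
      by (rule sum.swap)
    finally show ?thesis by (simp add: sum_distrib_left)
  qed
  then have "dir_deriv2 (\<lambda>y. h (\<Phi> y)) x v w = (\<Sum>i\<in>UNIV. v $ i * dir_deriv h (\<Phi> x) (pd i J x *v w))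
     + (\<Sum>i\<in>UNIV. v $ i * (\<Sum>b\<in>UNIV. pd i \<Phi> x $ b * (\<Sum>a\<in>UNIV. (J x *v w) $ a * pd b (pd a h) (\<Phi> x))))"
    by (simp add: dir_deriv2_def distrib_left sum.distrib)
  also have "(\<Sum>i\<in>UNIV. v $ i * dir_deriv h (\<Phi> x) (pd i J x *v w)) = dir_deriv h (\<Phi> x) (D2 x v w)"
    by (simp add: D2_def dir_deriv_sum dir_deriv_scaleR)
  also have "(\<Sum>i\<in>UNIV. v $ i * (\<Sum>b\<in>UNIV. pd i \<Phi> x $ b * (\<Sum>a\<in>UNIV. (J x *v w) $ a * pd b (pd a h) (\<Phi> x))))
     = (\<Sum>b\<in>UNIV. \<Sum>i\<in>UNIV. v $ i * pd i \<Phi> x $ b * (\<Sum>a\<in>UNIV. (J x *v w) $ a * pd b (pd a h) (\<Phi> x)))"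
    unfolding sum_distrib_left[of "v $ _" ] mult.assoc by (rule sum.swap)
  also have "\<dots> = dir_deriv2 h (\<Phi> x) (J x *v v) (J x *v w)"
    unfolding dir_deriv2_def by (simp only: J_mult[of x v] sum_component vector_scaleR_component real_scaleR_def sum_distrib_right)
  finally show ?thesis by simp
qed

lemma hess_transform:
  assumes x: "x \<in> U" and h: "smooth_on V h"
  shows "v \<bullet> (hess_coord G (\<lambda>y. h (\<Phi> y)) x *v w)
     = (J x *v v) \<bullet> (hess_coord G' h (\<Phi> x) *v (J x *v w))"
  unfolding hess_bilinear dir_deriv2_pull[OF assms] dir_deriv_pull[OF x smooth_on_at[OF h V map_in[OF x]]]
    christoffel_vec_transform[OF x] dir_deriv_add by simp

end

section \<open>Change of coordinates: curvature\<close>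

lemma matrix_works_real:
  fixes f :: "real^'n::finite \<Rightarrow> real^'m::finite"
  assumes "linear f"
  shows "matrix f *v x = f x"
proof -
  have "f x = (\<Sum>i\<in>UNIV. x $ i *\<^sub>R f (axis i 1))"
    using basis_expansion[of x] linear_sum[OF assms, of "\<lambda>i. x $ i *\<^sub>R axis i 1" UNIV]
    by (simp add: scalar_mult_eq_scaleR linear_scale[OF assms])
  then show ?thesis
    by (simp add: vec_eq_iff matrix_def matrix_vector_mult_def mult.commute)
qed

lemma christoffel_vec_axis: "christoffel_vec G x (axis i 1) v = conn_matrix G i x *v v"
  unfolding christoffel_vec_conn_matrix by (rule sum_axis)

lemma christoffel_vec_conn_matrix': "christoffel_vec G x u v = (\<Sum>b\<in>UNIV. u $ b *\<^sub>R conn_matrix G b x) *v v"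
  by (simp only: christoffel_vec_conn_matrix mv_sum_left mv_scaleR_left)

lemma riem_op_sum_left: "riem_op G x (\<Sum>i\<in>I. f i *\<^sub>R p i) v = (\<Sum>i\<in>I. f i *\<^sub>R riem_op G x (p i) v)"
proof -
  have "linear (\<lambda>u. riem_op G x u v)"
    unfolding riem_op_left by (rule linear_lincomb)
  then show ?thesis
    using linear_sum[of "\<lambda>u. riem_op G x u v" "\<lambda>i. f i *\<^sub>R p i" I] linear_scale[of "\<lambda>u. riem_op G x u v"] by simp
qed

lemma riem_op_right: "riem_op G x u v = (\<Sum>j\<in>UNIV. v $ j *\<^sub>R (\<Sum>i\<in>UNIV. u $ i *\<^sub>R curv_matrix G i j x))"
proof -
  have "riem_op G x u v = (\<Sum>j\<in>UNIV. \<Sum>i\<in>UNIV. (u $ i * v $ j) *\<^sub>R curv_matrix G i j x)"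
    unfolding riem_op_def by (rule sum.swap)
  then show ?thesis by (simp add: scaleR_sum_right mult.commute)
qed

lemma riem_op_sum_right: "riem_op G x u (\<Sum>i\<in>I. f i *\<^sub>R p i) = (\<Sum>i\<in>I. f i *\<^sub>R riem_op G x u (p i))"
proof -
  have "linear (\<lambda>v. riem_op G x u v)"
    unfolding riem_op_right by (rule linear_lincomb)
  then show ?thesis
    using linear_sum[of "\<lambda>v. riem_op G x u v" "\<lambda>i. f i *\<^sub>R p i" I] linear_scale[of "\<lambda>v. riem_op G x u v"] by simp
qed

text \<open>In terms of the matrices \<open>(C\<^sub>i)\<^sup>k\<^sub>j = \<Gamma>\<^sup>k\<^sub>i\<^sub>j\<close> a change of coordinates is a gauge
  transformation, \<open>J C\<^sub>i = \<partial>\<^sub>i J + T\<^sub>i J\<close>; the curvature \<open>\<partial>\<^sub>i C\<^sub>j - \<partial>\<^sub>j C\<^sub>i + [C\<^sub>i, C\<^sub>j]\<close> is then conjugated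
  by \<open>J\<close>.\<close>

lemma gauge_curvature_algebra:
  fixes J :: "real^'n::finite^'n"
  assumes E1: "dJi ** Cj + J ** dCij = P + (Tj ** dJi + dTij ** J)"
    and E2: "dJj ** Ci + J ** dCji = P + (Ti ** dJj + dTji ** J)"
    and L1: "J ** Ci = dJi + Ti ** J" and L2: "J ** Cj = dJj + Tj ** J"
  shows "J ** (dCij - dCji + (Ci ** Cj - Cj ** Ci)) = (dTij - dTji + (Ti ** Tj - Tj ** Ti)) ** J"
proof -
  note bil = bounded_bilinear.add_left[OF bounded_bilinear_matrix_mult] bounded_bilinear.add_right[OF bounded_bilinear_matrix_mult]
    bounded_bilinear.diff_left[OF bounded_bilinear_matrix_mult] bounded_bilinear.diff_right[OF bounded_bilinear_matrix_mult]
  \<comment> \<open>\<open>E1\<close> and \<open>E2\<close> are the relations \<open>L2\<close> and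
    \<open>L1\<close> differentiated in the directions \<open>i\<close> and \<open>j\<close>.
    \<open>P\<close> is the mixed second derivative of \<open>J\<close>, common to both, and
    disappears in the difference.\<close>
  have 1: "J ** dCij = P + (Tj ** dJi + dTij ** J) - dJi ** Cj" using E1 by (simp add: algebra_simps)
  have 2: "J ** dCji = P + (Ti ** dJj + dTji ** J) - dJj ** Ci" using E2 by (simp add: algebra_simps)
  have 3: "J ** (Ci ** Cj) = dJi ** Cj + Ti ** dJj + Ti ** Tj ** J"
    by (simp only: matrix_mul_assoc L1 bil) (simp only: matrix_mul_assoc[symmetric] L2 bil add.assoc)
  have 4: "J ** (Cj ** Ci) = dJj ** Ci + Tj ** dJi + Tj ** Ti ** J"
    by (simp only: matrix_mul_assoc L2 bil) (simp only: matrix_mul_assoc[symmetric] L1 bil add.assoc)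
  show ?thesis by (simp add: bil 1 2 3 4)
qed

context coord_change
begin

text \<open>The connection form of \<open>G'\<close> pulled back along \<open>\<Phi>\<close>; it is
  the \<open>T\<^sub>i\<close> of the gauge transformation.\<close>

definition pullback_conn :: "'n \<Rightarrow> real^'n \<Rightarrow> real^'n^'n" where
  "pullback_conn i x = (\<Sum>b\<in>UNIV. pd i \<Phi> x $ b *\<^sub>R conn_matrix G' b (\<Phi> x))"

lemma sm_conn_matrix: "smooth_on U (conn_matrix G i)"
  by (rule smooth_on_conn_matrix[OF U smG invG])

lemma sm_conn_matrix': "smooth_on V (conn_matrix G' i)"
  by (rule smooth_on_conn_matrix[OF V smG' invG'])

lemma sm_conn_matrix'\<Phi>: "smooth_on U (\<lambda>x. conn_matrix G' i (\<Phi> x))"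
  by (rule smooth_on_compose[OF U V maps sm sm_conn_matrix'])

lemma sm_pullback_conn: "smooth_on U (pullback_conn i)"
  unfolding pullback_conn_def[abs_def]
  by (intro smooth_on_sum smooth_on_scaleR smooth_on_nth smooth_on_pd sm sm_conn_matrix'\<Phi> U)

lemma conn_matrix_transform: "x \<in> U \<Longrightarrow> J x ** conn_matrix G i x = pd i J x + pullback_conn i x ** J x"
proof -
  assume x: "x \<in> U"
  have "(J x ** conn_matrix G i x) *v v = (pd i J x + pullback_conn i x ** J x) *v v" for v
  proof -
    have "J x *v christoffel_vec G x (axis i 1) v = pd i J x *v v + pullback_conn i x *v (J x *v v)"
      unfolding christoffel_vec_transform[OF x] J_axis by (simp only: D2_def sum_axis christoffel_vec_conn_matrix' pullback_conn_def)
    then show ?thesis by (simp only: christoffel_vec_axis mv_add_left matrix_vector_mul_assoc)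
  qed
  then show ?thesis by (simp add: matrix_eq)
qed

lemma pd_pullback_conn:
  assumes x: "x \<in> U"
  shows "pd i (pullback_conn j) x = (\<Sum>b\<in>UNIV. pd j \<Phi> x $ b *\<^sub>R (\<Sum>c\<in>UNIV. pd i \<Phi> x $ c *\<^sub>R pd c (conn_matrix G' b) (\<Phi> x)))
     + (\<Sum>b\<in>UNIV. pd i (pd j \<Phi>) x $ b *\<^sub>R conn_matrix G' b (\<Phi> x))"
proof -
  have dp: "pd j \<Phi> differentiable at x" by (rule smooth_on_at[OF smooth_on_pd[OF sm] U x])
  have 1: "(\<lambda>y. pd j \<Phi> y $ b) differentiable at x" for b
    by (rule smooth_on_at[OF smooth_on_nth[OF U smooth_on_pd[OF sm]] U x])
  have 2: "(\<lambda>y. conn_matrix G' b (\<Phi> y)) differentiable at x" for b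
    by (rule smooth_on_at[OF sm_conn_matrix'\<Phi> U x])
  have 3: "(\<lambda>y. pd j \<Phi> y $ b *\<^sub>R conn_matrix G' b (\<Phi> y)) differentiable at x" for b
    by (rule bounded_bilinear.differentiable_bilinear[OF bounded_bilinear_scaleR 1 2])
  have 4: "pd i (\<lambda>y. conn_matrix G' b (\<Phi> y)) x = (\<Sum>c\<in>UNIV. pd i \<Phi> x $ c *\<^sub>R pd c (conn_matrix G' b) (\<Phi> x))" for b
    by (rule pd_chain[OF d\<Phi>[OF x] smooth_on_at[OF sm_conn_matrix' V map_in[OF x]]])
  show ?thesis
    unfolding pullback_conn_def[abs_def] pd_sum[OF 3] pd_scaleR[OF 1 2] 4 pd_nth[OF dp] by (rule sum.distrib)
qed

lemma pullback_conn_mult: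
  "pullback_conn i x ** pullback_conn j x = (\<Sum>c\<in>UNIV. \<Sum>b\<in>UNIV. (pd i \<Phi> x $ c * pd j \<Phi> x $ b) *\<^sub>R (conn_matrix G' c (\<Phi> x) ** conn_matrix G' b (\<Phi> x)))"
  unfolding pullback_conn_def mm_sum_left mm_scaleR_left
  by (simp only: mm_sum_right mm_scaleR_right scaleR_sum_right scaleR_scaleR)

text \<open>Pulling back commutes with forming the curvature: the second derivatives of
  \<open>\<Phi>\<close> in \<open>pd_pullback_conn\<close> are symmetric in \<open>i\<close> and
  \<open>j\<close> and drop out of the antisymmetrisation.\<close>

lemma curv_matrix_pullback_conn:
  assumes x: "x \<in> U"
  shows "pd i (pullback_conn j) x - pd j (pullback_conn i) x + (pullback_conn i x ** pullback_conn j x - pullback_conn j x ** pullback_conn i x)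
     = riem_op G' (\<Phi> x) (pd i \<Phi> x) (pd j \<Phi> x)"
proof -
  have a: "(\<Sum>b\<in>UNIV. pd j \<Phi> x $ b *\<^sub>R (\<Sum>c\<in>UNIV. pd i \<Phi> x $ c *\<^sub>R f c b)) =
      (\<Sum>c\<in>UNIV. \<Sum>b\<in>UNIV. (pd i \<Phi> x $ c * pd j \<Phi> x $ b) *\<^sub>R f c b)" for i j and f :: "'n \<Rightarrow> 'n \<Rightarrow> real^'n^'n"
  proof -
    have "(\<Sum>b\<in>UNIV. pd j \<Phi> x $ b *\<^sub>R (\<Sum>c\<in>UNIV. pd i \<Phi> x $ c *\<^sub>R f c b)) =
      (\<Sum>b\<in>UNIV. \<Sum>c\<in>UNIV. (pd i \<Phi> x $ c * pd j \<Phi> x $ b) *\<^sub>R f c b)"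
      by (simp add: scaleR_sum_right mult.commute)
    also have "\<dots> = (\<Sum>c\<in>UNIV. \<Sum>b\<in>UNIV. (pd i \<Phi> x $ c * pd j \<Phi> x $ b) *\<^sub>R f c b)"
      by (rule sum.swap)
    finally show ?thesis .
  qed
  have b: "(\<Sum>c\<in>UNIV. \<Sum>b\<in>UNIV. (pd j \<Phi> x $ c * pd i \<Phi> x $ b) *\<^sub>R f c b)
     = (\<Sum>c\<in>UNIV. \<Sum>b\<in>UNIV. (pd i \<Phi> x $ c * pd j \<Phi> x $ b) *\<^sub>R f b c)" for f :: "'n \<Rightarrow> 'n \<Rightarrow> real^'n^'n"
    by (subst sum.swap) (simp add: mult.commute)
  show ?thesis
    unfolding pd_pullback_conn[OF x] pullback_conn_mult a b riem_op_def curv_matrix_def pd_commute[OF sm U x, of j i]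
    by (simp add: sum_subtractf sum.distrib scaleR_add_right scaleR_diff_right)
qed

lemma curv_matrix_transform:
  assumes x: "x \<in> U"
  shows "J x ** curv_matrix G i j x = riem_op G' (\<Phi> x) (pd i \<Phi> x) (pd j \<Phi> x) ** J x"
proof -
  have E: "pd i J x ** conn_matrix G j x + J x ** pd i (conn_matrix G j) x
      = pd i (pd j J) x + (pullback_conn j x ** pd i J x + pd i (pullback_conn j) x ** J x)" for i j
  proof -
    have dc: "conn_matrix G j differentiable at x" by (rule smooth_on_at[OF sm_conn_matrix U x])
    have dt: "pullback_conn j differentiable at x" by (rule smooth_on_at[OF sm_pullback_conn U x])
    have dp: "pd j J differentiable at x" by (rule smooth_on_at[OF smooth_on_pd[OF smJ] U x])
    have dtJ: "(\<lambda>y. pullback_conn j y ** J y) differentiable at x"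
      by (rule bounded_bilinear.differentiable_bilinear[OF bounded_bilinear_matrix_mult dt dJ[OF x]])
    \<comment> \<open>The gauge relation holds on all of the open set \<open>U\<close>, so it may be
      differentiated.\<close>
    have "pd i (\<lambda>y. J y ** conn_matrix G j y) x = pd i (\<lambda>y. pd j J y + pullback_conn j y ** J y) x"
      by (rule pd_cong_open[OF U x conn_matrix_transform])
    then show ?thesis
      unfolding pd_matrix_mult[OF dJ[OF x] dc] pd_add[OF dp dtJ] pd_matrix_mult[OF dt dJ[OF x]]
      by (simp add: add.commute)
  qed
  have "J x ** curv_matrix G i j x = (pd i (pullback_conn j) x - pd j (pullback_conn i) x + (pullback_conn i x ** pullback_conn j x - pullback_conn j x ** pullback_conn i x)) ** J x"
    unfolding curv_matrix_def
    by (rule gauge_curvature_algebra[OF E[of i j] E[of j i, unfolded pd_commute[OF smJ U x, of j i]] conn_matrix_transform[OF x] conn_matrix_transform[OF x]])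
  then show ?thesis by (simp only: curv_matrix_pullback_conn[OF x])
qed

lemma riem_op_transform:
  assumes x: "x \<in> U"
  shows "J x ** riem_op G x u v = riem_op G' (\<Phi> x) (J x *v u) (J x *v v) ** J x"
proof -
  have "J x ** riem_op G x u v = (\<Sum>i\<in>UNIV. \<Sum>j\<in>UNIV. (u $ i * v $ j) *\<^sub>R (J x ** curv_matrix G i j x))"
    unfolding riem_op_def by (simp only: mm_sum_right mm_scaleR_right)
  also have "\<dots> = riem_op G' (\<Phi> x) (J x *v u) (J x *v v) ** J x"
    unfolding curv_matrix_transform[OF x] J_mult riem_op_sum_left
    unfolding riem_op_sum_right
    by (simp only: mm_sum_left mm_scaleR_left scaleR_sum_right scaleR_scaleR)
  finally show ?thesis .
qed

text \<open>The endomorphism whose trace is the Ricci curvature is conjugated by \<open>J\<close>,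
  and conjugate matrices have equal trace.\<close>

lemma ricci_transform:
  assumes x: "x \<in> U"
  shows "v \<bullet> (ricci_coord G x *v w) = (J x *v v) \<bullet> (ricci_coord G' (\<Phi> x) *v (J x *v w))"
proof -
  define M where "M = matrix (\<lambda>u. riem_op G x u v *v w)"
  define M' where "M' = matrix (\<lambda>u. riem_op G' (\<Phi> x) u (J x *v v) *v (J x *v w))"
  have "(J x ** M) *v u = (M' ** J x) *v u" for u
  proof -
    have "(J x ** M) *v u = J x *v (riem_op G x u v *v w)"
      by (simp add: M_def matrix_vector_mul_assoc[symmetric] matrix_works_real[OF linear_riem_op])
    also have "\<dots> = riem_op G' (\<Phi> x) (J x *v u) (J x *v v) *v (J x *v w)"
      by (simp only: matrix_vector_mul_assoc riem_op_transform[OF x])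
    also have "\<dots> = (M' ** J x) *v u"
      by (simp add: M'_def matrix_vector_mul_assoc[symmetric] matrix_works_real[OF linear_riem_op])
    finally show ?thesis .
  qed
  then have JM: "J x ** M = M' ** J x" by (simp add: matrix_eq)
  have "trace M = trace (matrix_inv (J x) ** (J x ** M))"
    by (simp add: matrix_mul_assoc matrix_inv_left invJ x)
  also have "\<dots> = trace (M' ** J x ** matrix_inv (J x))"
    unfolding JM by (rule trace_mul_sym)
  also have "\<dots> = trace M'"
    by (simp add: matrix_mul_assoc[symmetric] matrix_inv_right invJ x)
  finally show ?thesis
    using ricci_trace[OF U smG invG x, of v w]
      ricci_trace[OF V smG' invG' map_in[OF x], of "J x *v v" "J x *v w"]
    by (simp add: M_def M'_def)
qed

end

lemma smooth_on_ricci_coord: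
  assumes "open S" "smooth_on S G" "\<And>x. x \<in> S \<Longrightarrow> invertible (G x)"
  shows "smooth_on S (ricci_coord G)"
  unfolding ricci_coord_def[abs_def] riemann_def
  by (intro smooth_on_vec_lambda smooth_on_sum smooth_on_add smooth_on_diff smooth_on_mult
      smooth_on_pd smooth_on_christoffel assms)

lemma smooth_on_hess_coord:
  assumes "open S" "smooth_on S G" "\<And>x. x \<in> S \<Longrightarrow> invertible (G x)" "smooth_on S u"
  shows "smooth_on S (hess_coord G u)"
  unfolding hess_coord_def[abs_def]
  by (intro smooth_on_vec_lambda smooth_on_sum smooth_on_diff smooth_on_mult
      smooth_on_pd smooth_on_christoffel assms)

section \<open>Manifolds in charts\<close>

lemma dir_deriv_cong_open:
  assumes "open S" "x \<in> S" "\<And>y. y \<in> S \<Longrightarrow> u y = u' y"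
  shows "dir_deriv u x z = dir_deriv u' x z"
  unfolding dir_deriv_def using pd_cong_open[OF assms] by simp

lemma smooth_on_comp_cong:
  assumes "open S" "open T" "F ` S \<subseteq> T" "smooth_on S F" "smooth_on T k" "\<And>x. x \<in> S \<Longrightarrow> h x = k (F x)"
  shows "smooth_on S h"
  using smooth_on_cong[OF assms(1), of h "\<lambda>x. k (F x)"] smooth_on_compose[OF assms(1-5)] assms(6) by blast

locale atlas_manifold =
  fixes A :: "('a::{t2_space,second_countable_topology}, 'n::finite) chart set"
  assumes atlas: "smooth_atlas A"
begin

lemma open_dom: "c \<in> A \<Longrightarrow> open (chart_dom c)"
  and open_img: "c \<in> A \<Longrightarrow> open (chart_img c)"
  and homeo: "c \<in> A \<Longrightarrow> homeomorphism (chart_dom c) (chart_img c) (coord c) (chart_inv c)"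
  and smooth_transition: "c \<in> A \<Longrightarrow> d \<in> A \<Longrightarrow> smooth_on (coord c ` (chart_dom c \<inter> chart_dom d)) (coord d \<circ> chart_inv c)"
  using atlas unfolding smooth_atlas_def by blast+

lemma ex_chart: "\<exists>c\<in>A. p \<in> chart_dom c"
proof -
  have "p \<in> (\<Union>c\<in>A. chart_dom c)" using atlas unfolding smooth_atlas_def by blast
  then show ?thesis by blast
qed

lemma chart_at_in: "chart_at A p \<in> A" "p \<in> chart_dom (chart_at A p)"
proof -
  have "chart_at A p \<in> A \<and> p \<in> chart_dom (chart_at A p)"
    unfolding chart_at_def by (rule someI_ex) (use ex_chart in blast)
  then show "chart_at A p \<in> A" "p \<in> chart_dom (chart_at A p)" by auto
qed

lemma chart_inv_coord: "c \<in> A \<Longrightarrow> p \<in> chart_dom c \<Longrightarrow> chart_inv c (coord c p) = p"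
  using homeomorphism_apply1[OF homeo] .

lemma coord_chart_inv: "c \<in> A \<Longrightarrow> x \<in> chart_img c \<Longrightarrow> coord c (chart_inv c x) = x"
  using homeomorphism_apply2[OF homeo] .

lemma chart_inv_in: "c \<in> A \<Longrightarrow> x \<in> chart_img c \<Longrightarrow> chart_inv c x \<in> chart_dom c"
  using homeomorphism_image2[OF homeo] by blast

lemma cont_coord: "c \<in> A \<Longrightarrow> continuous_on (chart_dom c) (coord c)"
  using homeomorphism_cont1[OF homeo] .

lemma cont_chart_inv: "c \<in> A \<Longrightarrow> continuous_on (chart_img c) (chart_inv c)"
  using homeomorphism_cont2[OF homeo] .

lemma coord_image_iff:
  assumes "c \<in> A"
  shows "x \<in> coord c ` (chart_dom c \<inter> W) \<longleftrightarrow> x \<in> chart_img c \<and> chart_inv c x \<in> W"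
  using chart_inv_coord[OF assms] coord_chart_inv[OF assms] chart_inv_in[OF assms]
  by (auto intro!: image_eqI)

lemma open_coord_image:
  assumes "c \<in> A" "open W"
  shows "open (coord c ` (chart_dom c \<inter> W))"
proof -
  have "coord c ` (chart_dom c \<inter> W) = chart_inv c -` W \<inter> chart_img c"
    using coord_image_iff[OF assms(1)] by blast
  then show ?thesis
    using continuous_on_open_vimage[OF open_img[OF assms(1)], of "chart_inv c"] cont_chart_inv[OF assms(1)] assms(2)
    by metis
qed

lemma open_chart_preimage:
  assumes "c \<in> A" "open X"
  shows "open {p \<in> chart_dom c. coord c p \<in> X}"
proof -
  have "{p \<in> chart_dom c. coord c p \<in> X} = coord c -` X \<inter> chart_dom c" by blast
  then show ?thesis
    using continuous_on_open_vimage[OF open_dom[OF assms(1)], of "coord c"] cont_coord[OF assms(1)] assms(2)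
    by metis
qed

lemma jac_id: "jac c d id p = matrix (frechet_derivative (coord d \<circ> chart_inv c) (at (coord c p)))"
  by (simp add: jac_def o_def)

lemma transition_differentiable:
  assumes "c \<in> A" "d \<in> A" "p \<in> chart_dom c" "p \<in> chart_dom d"
  shows "(coord d \<circ> chart_inv c) differentiable at (coord c p)"
  by (rule smooth_on_at[OF smooth_transition open_coord_image]) (use assms open_dom in auto)

lemma transition_maps: "d \<in> A \<Longrightarrow> c \<in> A \<Longrightarrow> (coord d \<circ> chart_inv c) ` (coord c ` (chart_dom c \<inter> chart_dom d)) \<subseteq> chart_img d"
  by (auto simp: chart_inv_coord)

lemma smooth_fun_comp: "smooth_fun A u \<Longrightarrow> c \<in> A \<Longrightarrow> smooth_on (chart_img c) (\<lambda>x. u (chart_inv c x))"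
  unfolding smooth_fun_def by (auto simp: o_def)

lemma dir_deriv_transform:
  assumes c: "c \<in> A" "d \<in> A" "p \<in> chart_dom c" "p \<in> chart_dom d" and u: "smooth_fun A u"
  shows "dir_deriv (\<lambda>x. u (chart_inv c x)) (coord c p) v = dir_deriv (\<lambda>x. u (chart_inv d x)) (coord d p) (jac c d id p *v v)"
proof -
  let ?U = "coord c ` (chart_dom c \<inter> chart_dom d)" and ?\<Phi> = "coord d \<circ> chart_inv c"
  have U: "open ?U" "coord c p \<in> ?U" using open_coord_image[OF c(1) open_dom[OF c(2)]] c by auto
  have d: "(\<lambda>x. u (chart_inv d x)) differentiable at (?\<Phi> (coord c p))"
    by (rule smooth_on_at[OF smooth_fun_comp[OF u c(2)] open_img[OF c(2)]]) (use c in \<open>auto simp: chart_inv_coord\<close>)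
  have "dir_deriv (\<lambda>x. u (chart_inv c x)) (coord c p) v = dir_deriv (\<lambda>x. u (chart_inv d (?\<Phi> x))) (coord c p) v"
    by (rule dir_deriv_cong_open[OF U]) (auto simp: chart_inv_coord c)
  also have "\<dots> = dir_deriv (\<lambda>x. u (chart_inv d x)) (?\<Phi> (coord c p)) (matrix (frechet_derivative ?\<Phi> (at (coord c p))) *v v)"
    unfolding jacobian_mult dir_deriv_sum dir_deriv_scaleR
    unfolding dir_deriv_def pd_chain[OF transition_differentiable[OF c] d] by simp
  finally show ?thesis by (simp add: jac_id chart_inv_coord c)
qed

text \<open>Smoothness is local, and smoothness near a point in one chart passes to every other
  chart through the transition map.\<close>

lemma smooth_funI_chart:
  assumes "\<And>p. \<exists>W d. open W \<and> p \<in> W \<and> d \<in> A \<and> W \<subseteq> chart_dom d \<and>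
     smooth_on (coord d ` W) (\<lambda>x. u (chart_inv d x))"
  shows "smooth_fun A u"
  unfolding smooth_fun_def
proof
  fix c assume c: "c \<in> A"
  show "smooth_on (chart_img c) (u \<circ> chart_inv c)"
  proof (rule smooth_on_local)
    fix x assume x: "x \<in> chart_img c"
    obtain W d where W: "open W" "chart_inv c x \<in> W" "d \<in> A" "W \<subseteq> chart_dom d"
      "smooth_on (coord d ` W) (\<lambda>x. u (chart_inv d x))"
      using assms by blast
    let ?T = "coord c ` (chart_dom c \<inter> W)"
    have T: "open ?T" "x \<in> ?T" using open_coord_image[OF c W(1)] coord_image_iff[OF c] x W(2) by auto
    have oW: "open (coord d ` W)"
      using open_coord_image[OF W(3,1)] W(4) by (simp add: inf.absorb2)
    have "smooth_on ?T (u \<circ> chart_inv c)"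
    proof (rule smooth_on_comp_cong[OF T(1) oW _ _ W(5)])
      show "(coord d \<circ> chart_inv c) ` ?T \<subseteq> coord d ` W" by (auto simp: chart_inv_coord c)
      show "smooth_on ?T (coord d \<circ> chart_inv c)"
        by (rule smooth_on_subset[OF smooth_transition[OF c W(3)]]) (use W(4) in auto)
    qed (use W(4) in \<open>auto simp: chart_inv_coord c W(3)\<close>)
    with T show "\<exists>T. open T \<and> x \<in> T \<and> smooth_on T (u \<circ> chart_inv c)" by blast
  qed
qed

lemma smooth_fun_continuous: "smooth_fun A u \<Longrightarrow> continuous_on UNIV u"
proof -
  assume u: "smooth_fun A u"
  have "isCont u p" for p
  proof -
    obtain c where c: "c \<in> A" "p \<in> chart_dom c" using ex_chart by blast
    have "continuous_on (chart_dom c) (\<lambda>q. u (chart_inv c (coord c q)))"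
      by (rule continuous_on_compose2[OF smooth_on_imp_continuous_on[OF smooth_fun_comp[OF u c(1)]] cont_coord[OF c(1)]]) auto
    then have "continuous_on (chart_dom c) u"
      by (rule continuous_on_eq) (simp add: chart_inv_coord c)
    then show ?thesis using open_dom[OF c(1)] c(2) by (simp add: continuous_on_eq_continuous_at)
  qed
  then show ?thesis by (simp add: continuous_on_eq_continuous_at)
qed

lemma smooth_fun_const: "smooth_fun A (\<lambda>p. k)"
  unfolding smooth_fun_def o_def by (auto intro: smooth_on_const)

end

section \<open>Metric, curvature and gradient bounds on a Riemannian manifold\<close>

locale riemannian_manifold = atlas_manifold A
  for A :: "('a::{t2_space,second_countable_topology}, 'n::finite) chart set" +
  fixes g :: "('a, 'n) metric"
  assumes metric: "riemannian_metric A g"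
begin

lemma g_smooth: "c \<in> A \<Longrightarrow> smooth_on (chart_img c) (\<lambda>x. g c (chart_inv c x))"
  using metric unfolding riemannian_metric_def by (auto simp: o_def)

lemma g_transpose: "c \<in> A \<Longrightarrow> p \<in> chart_dom c \<Longrightarrow> transpose (g c p) = g c p"
  and g_pos: "c \<in> A \<Longrightarrow> p \<in> chart_dom c \<Longrightarrow> v \<noteq> 0 \<Longrightarrow> v \<bullet> (g c p *v v) > 0"
  and g_change: "c \<in> A \<Longrightarrow> d \<in> A \<Longrightarrow> p \<in> chart_dom c \<Longrightarrow> p \<in> chart_dom d \<Longrightarrow>
    g c p = transpose (jac c d id p) ** g d p ** jac c d id p"
  using metric unfolding riemannian_metric_def by blast+

lemma g_nonneg: "c \<in> A \<Longrightarrow> p \<in> chart_dom c \<Longrightarrow> v \<bullet> (g c p *v v) \<ge> 0"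
  using g_pos[of c p v] by (cases "v = 0") auto

lemma g_sym: "c \<in> A \<Longrightarrow> p \<in> chart_dom c \<Longrightarrow> v \<bullet> (g c p *v w) = w \<bullet> (g c p *v v)"
  by (metis inner_transpose_mult g_transpose inner_commute)

lemma g_inv: "c \<in> A \<Longrightarrow> p \<in> chart_dom c \<Longrightarrow> invertible (g c p)"
  using posdef_invertible g_pos by blast

lemma g_transform:
  assumes "c \<in> A" "d \<in> A" "p \<in> chart_dom c" "p \<in> chart_dom d"
  shows "v \<bullet> (g c p *v w) = (jac c d id p *v v) \<bullet> (g d p *v (jac c d id p *v w))"
  by (simp only: g_change[OF assms] matrix_vector_mul_assoc[symmetric] inner_transpose_mult)

lemma coord_change:
  assumes c: "c \<in> A" "d \<in> A"
  shows "coord_change (coord c ` (chart_dom c \<inter> chart_dom d)) (chart_img d) (coord d \<circ> chart_inv c)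
    (g c \<circ> chart_inv c) (g d \<circ> chart_inv d) (\<lambda>x. matrix (frechet_derivative (coord d \<circ> chart_inv c) (at x)))"
proof
  show "open (coord c ` (chart_dom c \<inter> chart_dom d))" using open_coord_image[OF c(1) open_dom[OF c(2)]] .
  show "open (chart_img d)" using open_img[OF c(2)] .
  show "(coord d \<circ> chart_inv c) ` coord c ` (chart_dom c \<inter> chart_dom d) \<subseteq> chart_img d"
    using transition_maps c by blast
  show "smooth_on (coord c ` (chart_dom c \<inter> chart_dom d)) (coord d \<circ> chart_inv c)"
    using smooth_transition[OF c] .
  show "smooth_on (chart_img d) (g d \<circ> chart_inv d)" using g_smooth[OF c(2)] by (simp add: o_def)
  show "transpose ((g d \<circ> chart_inv d) y) = (g d \<circ> chart_inv d) y" if "y \<in> chart_img d" for y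
    using g_transpose[OF c(2) chart_inv_in[OF c(2) that]] by simp
  show "0 < v \<bullet> ((g d \<circ> chart_inv d) y *v v)" if "y \<in> chart_img d" "v \<noteq> 0" for y v
    using g_pos[OF c(2) chart_inv_in[OF c(2) that(1)] that(2)] by simp
  show "0 < v \<bullet> ((g c \<circ> chart_inv c) x *v v)" if "x \<in> coord c ` (chart_dom c \<inter> chart_dom d)" "v \<noteq> 0" for x v
    using that c by (auto simp: chart_inv_coord g_pos)
  show "(g c \<circ> chart_inv c) x = transpose (matrix (frechet_derivative (coord d \<circ> chart_inv c) (at x))) **
      (g d \<circ> chart_inv d) ((coord d \<circ> chart_inv c) x) ** matrix (frechet_derivative (coord d \<circ> chart_inv c) (at x))"
    if "x \<in> coord c ` (chart_dom c \<inter> chart_dom d)" for x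
    using that g_change[OF c] by (auto simp: chart_inv_coord c jac_id)
qed simp

lemma christoffel_vec_change:
  assumes c: "c \<in> A" "d \<in> A" "p \<in> chart_dom c" "p \<in> chart_dom d"
  shows "jac c d id p *v christoffel_vec (g c \<circ> chart_inv c) (coord c p) u v
    = (\<Sum>a\<in>UNIV. u $ a *\<^sub>R (pd a (\<lambda>x. matrix (frechet_derivative (coord d \<circ> chart_inv c) (at x))) (coord c p) *v v))
     + christoffel_vec (g d \<circ> chart_inv d) (coord d p) (jac c d id p *v u) (jac c d id p *v v)"
proof -
  interpret cc: coord_change "coord c ` (chart_dom c \<inter> chart_dom d)" "chart_img d" "coord d \<circ> chart_inv c"
    "g c \<circ> chart_inv c" "g d \<circ> chart_inv d" "\<lambda>x. matrix (frechet_derivative (coord d \<circ> chart_inv c) (at x))"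
    by (rule coord_change[OF c(1,2)])
  have "coord c p \<in> coord c ` (chart_dom c \<inter> chart_dom d)" using c by blast
  from cc.christoffel_vec_transform[OF this] show ?thesis
    by (simp add: cc.D2_def jac_id chart_inv_coord c)
qed

lemma ric_inf_change:
  assumes c: "c \<in> A" "d \<in> A" "p \<in> chart_dom c" "p \<in> chart_dom d" and u: "smooth_fun A u"
  shows "v \<bullet> (ric_inf g u c p *v v) = (jac c d id p *v v) \<bullet> (ric_inf g u d p *v (jac c d id p *v v))"
proof -
  let ?U = "coord c ` (chart_dom c \<inter> chart_dom d)" and ?\<Phi> = "coord d \<circ> chart_inv c"
  interpret cc: coord_change ?U "chart_img d" ?\<Phi>
    "g c \<circ> chart_inv c" "g d \<circ> chart_inv d" "\<lambda>x. matrix (frechet_derivative ?\<Phi> (at x))"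
    by (rule coord_change[OF c(1,2)])
  have x: "coord c p \<in> ?U" using c by blast
  have su: "smooth_on (chart_img d) (u \<circ> chart_inv d)" using u c unfolding smooth_fun_def by blast
  \<comment> \<open>Agreement of the first derivatives on the whole overlap, not only at
    \<open>p\<close>, is what permits the second differentiation.\<close>
  have "pd j (u \<circ> chart_inv c) y = pd j (\<lambda>y. (u \<circ> chart_inv d) (?\<Phi> y)) y" if "y \<in> ?U" for y j
    by (rule pd_cong_open[OF cc.U that]) (auto simp: chart_inv_coord c)
  moreover from this have "pd i (pd j (u \<circ> chart_inv c)) (coord c p) = pd i (pd j (\<lambda>y. (u \<circ> chart_inv d) (?\<Phi> y))) (coord c p)" for i j
    by (rule pd_cong_open[OF cc.U x])
  ultimately have h: "hess_coord (g c \<circ> chart_inv c) (u \<circ> chart_inv c) (coord c p)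
    = hess_coord (g c \<circ> chart_inv c) (\<lambda>y. (u \<circ> chart_inv d) (?\<Phi> y)) (coord c p)"
    using x by (simp add: hess_coord_def)
  have e: "?\<Phi> (coord c p) = coord d p" by (simp add: chart_inv_coord c)
  show ?thesis
    unfolding ric_inf_def ricci_def hess_def h mv_add_left inner_add_right
    unfolding cc.ricci_transform[OF x] cc.hess_transform[OF x su] e jac_id ..
qed

text \<open>The dual form of \<open>|grad u| <= C\<close>. Stated for the differential, it involves
  no inverse metric and passes at once to convex combinations and to derivatives along
  curves.\<close>

definition grad_bound :: "('a \<Rightarrow> real) \<Rightarrow> real \<Rightarrow> bool" where
  "grad_bound u C \<longleftrightarrow> (\<forall>c\<in>A. \<forall>p\<in>chart_dom c. \<forall>v.
     \<bar>dir_deriv (\<lambda>x. u (chart_inv c x)) (coord c p) v\<bar> \<le> C * sqrt (v \<bullet> (g c p *v v)))"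

lemma grad_boundI:
  assumes u: "smooth_fun A u"
    and b: "\<And>p. \<exists>d\<in>A. p \<in> chart_dom d \<and> (\<forall>v. \<bar>dir_deriv (\<lambda>x. u (chart_inv d x)) (coord d p) v\<bar> \<le> C * sqrt (v \<bullet> (g d p *v v)))"
  shows "grad_bound u C"
  unfolding grad_bound_def
proof (intro ballI allI)
  fix c p v assume c: "c \<in> A" "p \<in> chart_dom c"
  obtain d where d: "d \<in> A" "p \<in> chart_dom d"
    "\<And>v. \<bar>dir_deriv (\<lambda>x. u (chart_inv d x)) (coord d p) v\<bar> \<le> C * sqrt (v \<bullet> (g d p *v v))" using b by blast
  show "\<bar>dir_deriv (\<lambda>x. u (chart_inv c x)) (coord c p) v\<bar> \<le> C * sqrt (v \<bullet> (g c p *v v))"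
    unfolding dir_deriv_transform[OF c(1) d(1) c(2) d(2) u] g_transform[OF c(1) d(1) c(2) d(2)] by (rule d(3))
qed

lemma grad_boundD: "\<lbrakk>grad_bound u C; c \<in> A; p \<in> chart_dom c\<rbrakk> \<Longrightarrow>
    \<bar>dir_deriv (\<lambda>x. u (chart_inv c x)) (coord c p) v\<bar> \<le> C * sqrt (v \<bullet> (g c p *v v))"
  unfolding grad_bound_def by blast

text \<open>Testing the bound with the gradient itself as \<open>v\<close> gives
  \<open>|grad u|^2 <= C * |grad u|\<close>.\<close>

lemma grad_bound_grad_norm2:
  assumes "grad_bound u C" "C \<ge> 0"
  shows "grad_norm2 A g u p \<le> C\<^sup>2"
proof -
  let ?c = "chart_at A p"
  have c: "?c \<in> A" "p \<in> chart_dom ?c" using chart_at_in by auto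
  define w where "w = grad g u ?c p"
  define D where "D = (\<chi> i. pd i (u \<circ> chart_inv ?c) (coord ?c p))"
  have "g ?c p *v w = D"
    by (simp add: w_def D_def grad_def matrix_vector_mul_assoc matrix_inv_right g_inv c)
  then have e: "w \<bullet> (g ?c p *v w) = dir_deriv (\<lambda>x. u (chart_inv ?c x)) (coord ?c p) w"
    by (simp add: D_def dir_deriv_def inner_vec_def o_def)
  define r where "r = sqrt (w \<bullet> (g ?c p *v w))"
  have r: "r \<ge> 0" "r\<^sup>2 = w \<bullet> (g ?c p *v w)" using g_nonneg[OF c] by (auto simp: r_def)
  have "r * r \<le> C * r"
    using grad_boundD[OF assms(1) c, of w] unfolding e[symmetric] r_def[symmetric] r(2)[symmetric]
    using r(1) by (simp add: power2_eq_square)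
  then have "r \<le> C" using r(1) assms(2) by (cases "r = 0") auto
  then have "r\<^sup>2 \<le> C\<^sup>2" using r(1) by (simp add: power_mono)
  then show ?thesis using r(2) by (simp add: grad_norm2_def Let_def w_def)
qed

end

section \<open>Curves and the Riemannian distance\<close>

text \<open>\<open>C1_differentiable_on\<close> asks for two-sided derivatives, while the equality
  says nothing outside \<open>{a..b}\<close>; hence the endpoints join the exceptional set.\<close>

lemma piecewise_C1_cong:
  fixes f :: "real \<Rightarrow> 'e::real_normed_vector"
  assumes f: "f piecewise_C1_differentiable_on {a..b}" and eq: "\<And>t. t \<in> {a..b} \<Longrightarrow> f t = h t"
  shows "h piecewise_C1_differentiable_on {a..b}"
proof -
  obtain S where S: "finite S" "f C1_differentiable_on ({a..b} - S)" and c: "continuous_on {a..b} f"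
    using f unfolding piecewise_C1_differentiable_on_def by blast
  obtain D where D: "\<And>x. x \<in> {a..b} - S \<Longrightarrow> (f has_vector_derivative D x) (at x)" "continuous_on ({a..b} - S) D"
    using S(2) unfolding C1_differentiable_on_def by blast
  have "(h has_vector_derivative D x) (at x)" if "x \<in> {a..b} - (S \<union> {a, b})" for x
    by (rule has_vector_derivative_transform_within_open[OF D(1), of x "{a<..<b}"]) (use that eq in auto)
  moreover have "continuous_on ({a..b} - (S \<union> {a, b})) D"
    by (rule continuous_on_subset[OF D(2)]) auto
  ultimately have "h C1_differentiable_on ({a..b} - (S \<union> {a, b}))"
    unfolding C1_differentiable_on_def by blast
  moreover have "continuous_on {a..b} h"
    using continuous_on_cong[of "{a..b}" "{a..b}" f h] eq c by simp
  ultimately show ?thesis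
    unfolding piecewise_C1_differentiable_on_def using S(1) by (intro conjI exI[of _ "S \<union> {a, b}"]) auto
qed

lemma has_vector_derivative_affine:
  assumes "(f has_vector_derivative v) (at (m * t + k))"
  shows "((\<lambda>t. f (m * t + k)) has_vector_derivative m *\<^sub>R v) (at (t::real))"
proof -
  have "((\<lambda>t. m * t + k) has_vector_derivative m) (at t)"
    by (auto intro!: derivative_eq_intros simp: has_real_derivative_iff_has_vector_derivative[symmetric])
  from vector_diff_chain_at[OF this assms] show ?thesis by (simp add: o_def)
qed

section \<open>Curves of speed at most 1\<close>

context riemannian_manifold
begin

text \<open>Curves of speed at most \<open>1\<close> on \<open>{0..L}\<close>: concatenation and reversal then need no rescaling.\<close>

definition unit_curve :: "real \<Rightarrow> (real \<Rightarrow> 'a) \<Rightarrow> bool" where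
  "unit_curve L \<gamma> \<longleftrightarrow> continuous_on {0..L} \<gamma> \<and>
     (\<forall>c\<in>A. \<forall>a b. 0 \<le> a \<and> a \<le> b \<and> b \<le> L \<and> \<gamma> ` {a..b} \<subseteq> chart_dom c \<longrightarrow>
        (coord c \<circ> \<gamma>) piecewise_C1_differentiable_on {a..b}) \<and>
     (\<exists>S. finite S \<and> (\<forall>t\<in>{0<..<L} - S. \<exists>c\<in>A. \<gamma> t \<in> chart_dom c \<and>
        (\<exists>v. ((coord c \<circ> \<gamma>) has_vector_derivative v) (at t) \<and> v \<bullet> (g c (\<gamma> t) *v v) \<le> 1)))"

text \<open>Existence of a curve instead of a bound on the infimum \<open>riem_dist\<close>:
  symmetry and triangle inequality become constructions with curves, and
  \<open>reach_riem_dist\<close> leads back to the distance.\<close>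

definition reach :: "real \<Rightarrow> 'a \<Rightarrow> 'a \<Rightarrow> bool" where
  "reach L p q \<longleftrightarrow> 0 \<le> L \<and> (\<exists>\<gamma>. unit_curve L \<gamma> \<and> \<gamma> 0 = p \<and> \<gamma> L = q)"

lemma reach_refl: "0 \<le> L \<Longrightarrow> reach L p p"
proof -
  assume L: "0 \<le> L"
  have "unit_curve L (\<lambda>t. p)"
    unfolding unit_curve_def
  proof (intro conjI ballI allI impI)
    show "continuous_on {0..L} (\<lambda>t. p)" by simp
    show "(coord c \<circ> (\<lambda>t. p)) piecewise_C1_differentiable_on {a..b}" for c :: "('a, 'n) chart" and a b
      unfolding o_def by (intro C1_differentiable_imp_piecewise C1_differentiable_on_const)
    obtain c where c: "c \<in> A" "p \<in> chart_dom c" using ex_chart by blast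
    have "((coord c \<circ> (\<lambda>t. p)) has_vector_derivative 0) (at t)" for t :: real
      by (simp add: o_def)
    then show "\<exists>S. finite S \<and> (\<forall>t\<in>{0<..<L} - S. \<exists>c\<in>A. p \<in> chart_dom c \<and>
        (\<exists>v. ((coord c \<circ> (\<lambda>t. p)) has_vector_derivative v) (at t) \<and> v \<bullet> (g c p *v v) \<le> 1))"
      using c by (intro exI[of _ "{}"]) (auto intro!: bexI[of _ c] exI[of _ 0])
  qed
  then show ?thesis using L unfolding reach_def by blast
qed

lemma piecewise_C1_reparam:
  assumes P: "(coord c \<circ> \<gamma>) piecewise_C1_differentiable_on ((\<lambda>t. m * t + k) ` {a..b})"
  shows "(coord c \<circ> (\<lambda>t. \<gamma> (m * t + k))) piecewise_C1_differentiable_on {a..b}"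
  using piecewise_C1_differentiable_affine[OF P] by (simp add: o_def)

lemma reach_sym:
  assumes "reach L p q"
  shows "reach L q p"
proof -
  obtain \<gamma> where L: "0 \<le> L" and \<gamma>: "unit_curve L \<gamma>" "\<gamma> 0 = p" "\<gamma> L = q"
    using assms unfolding reach_def by blast
  \<comment> \<open>Kept in the shape \<open>m * t + k\<close>, which is the form of
    \<open>piecewise_C1_reparam\<close> and \<open>has_vector_derivative_affine\<close>.\<close>
  let ?\<delta> = "\<lambda>t. \<gamma> ((-1) * t + L)"
  obtain S where S: "finite S" "\<And>t. t \<in> {0<..<L} - S \<Longrightarrow> \<exists>c\<in>A. \<gamma> t \<in> chart_dom c \<and>
        (\<exists>v. ((coord c \<circ> \<gamma>) has_vector_derivative v) (at t) \<and> v \<bullet> (g c (\<gamma> t) *v v) \<le> 1)"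
    using \<gamma>(1) unfolding unit_curve_def by blast
  have "unit_curve L ?\<delta>"
    unfolding unit_curve_def
  proof (intro conjI ballI allI impI)
    show "continuous_on {0..L} ?\<delta>"
      by (rule continuous_on_compose2[of "{0..L}" \<gamma>]) (use \<gamma>(1) in \<open>auto simp: unit_curve_def intro!: continuous_intros\<close>)
    fix c a b assume c: "c \<in> A" and ab: "0 \<le> a \<and> a \<le> b \<and> b \<le> L \<and> ?\<delta> ` {a..b} \<subseteq> chart_dom c"
    have im: "(\<lambda>t. (-1) * t + L) ` {a..b} = {L - b..L - a}"
      using ab image_affinity_atLeastAtMost[of "-1" L a b] by simp
    have "\<gamma> ` {L - b..L - a} \<subseteq> chart_dom c"
      using ab unfolding im[symmetric] image_image by blast
    then have "(coord c \<circ> \<gamma>) piecewise_C1_differentiable_on {L - b..L - a}"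
      using \<gamma>(1) c ab unfolding unit_curve_def by auto
    then show "(coord c \<circ> ?\<delta>) piecewise_C1_differentiable_on {a..b}"
      by (intro piecewise_C1_reparam) (simp only: im)
  next
    show "\<exists>S. finite S \<and> (\<forall>t\<in>{0<..<L} - S. \<exists>c\<in>A. ?\<delta> t \<in> chart_dom c \<and>
        (\<exists>v. ((coord c \<circ> ?\<delta>) has_vector_derivative v) (at t) \<and> v \<bullet> (g c (?\<delta> t) *v v) \<le> 1))"
    proof (intro exI[of _ "(\<lambda>t. L - t) ` S"] conjI ballI)
      fix t assume t: "t \<in> {0<..<L} - (\<lambda>t. L - t) ` S"
      have "L - t \<notin> S" using t by (auto simp: image_iff)
      then have "(-1) * t + L \<in> {0<..<L} - S" using t by auto
      from S(2)[OF this] obtain c v where c: "c \<in> A" "?\<delta> t \<in> chart_dom c"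
        "((coord c \<circ> \<gamma>) has_vector_derivative v) (at ((-1) * t + L))" "v \<bullet> (g c (?\<delta> t) *v v) \<le> 1" by blast
      have "((coord c \<circ> ?\<delta>) has_vector_derivative (-1) *\<^sub>R v) (at t)"
        using has_vector_derivative_affine[OF c(3)] by (simp add: o_def)
      moreover have "((-1) *\<^sub>R v) \<bullet> (g c (?\<delta> t) *v ((-1) *\<^sub>R v)) \<le> 1"
        using c(4) unfolding mv_scaleR_right by simp
      ultimately show "\<exists>c\<in>A. ?\<delta> t \<in> chart_dom c \<and>
        (\<exists>v. ((coord c \<circ> ?\<delta>) has_vector_derivative v) (at t) \<and> v \<bullet> (g c (?\<delta> t) *v v) \<le> 1)"
        using c(1,2) by blast
    qed (use S(1) in auto)
  qed
  then show ?thesis using L \<gamma> unfolding reach_def by (intro conjI exI[of _ ?\<delta>]) auto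
qed

lemma reach_trans:
  assumes "reach L p q" "reach K q r"
  shows "reach (L + K) p r"
proof -
  obtain \<gamma> where L: "0 \<le> L" and \<gamma>: "unit_curve L \<gamma>" "\<gamma> 0 = p" "\<gamma> L = q"
    using assms(1) unfolding reach_def by blast
  obtain \<delta> where K: "0 \<le> K" and \<delta>: "unit_curve K \<delta>" "\<delta> 0 = q" "\<delta> K = r"
    using assms(2) unfolding reach_def by blast
  let ?\<delta> = "\<lambda>t. \<delta> (1 * t + (- L))"
  define \<eta> where "\<eta> = (\<lambda>t. if t \<le> L then \<gamma> t else ?\<delta> t)"
  have \<eta>1: "\<eta> t = \<gamma> t" if "t \<le> L" for t using that by (simp add: \<eta>_def)
  have \<eta>2: "\<eta> t = ?\<delta> t" if "L \<le> t" for t using that \<gamma>(3) \<delta>(2) by (auto simp: \<eta>_def)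
  obtain S where S: "finite S" "\<And>t. t \<in> {0<..<L} - S \<Longrightarrow> \<exists>c\<in>A. \<gamma> t \<in> chart_dom c \<and>
        (\<exists>v. ((coord c \<circ> \<gamma>) has_vector_derivative v) (at t) \<and> v \<bullet> (g c (\<gamma> t) *v v) \<le> 1)"
    using \<gamma>(1) unfolding unit_curve_def by blast
  obtain T where T: "finite T" "\<And>t. t \<in> {0<..<K} - T \<Longrightarrow> \<exists>c\<in>A. \<delta> t \<in> chart_dom c \<and>
        (\<exists>v. ((coord c \<circ> \<delta>) has_vector_derivative v) (at t) \<and> v \<bullet> (g c (\<delta> t) *v v) \<le> 1)"
    using \<delta>(1) unfolding unit_curve_def by blast
  have "unit_curve (L + K) \<eta>"
    unfolding unit_curve_def
  proof (intro conjI ballI allI impI)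
    have 1: "continuous_on {0..L} \<eta>"
      using \<gamma>(1) \<eta>1 continuous_on_cong[of "{0..L}" "{0..L}" \<eta> \<gamma>] by (auto simp: unit_curve_def)
    have "continuous_on {L..L + K} ?\<delta>"
      by (rule continuous_on_compose2[of "{0..K}" \<delta>]) (use \<delta>(1) in \<open>auto simp: unit_curve_def intro!: continuous_intros\<close>)
    then have 2: "continuous_on {L..L + K} \<eta>"
      using \<eta>2 continuous_on_cong[of "{L..L + K}" "{L..L + K}" \<eta> ?\<delta>] by auto
    have "{0..L} \<union> {L..L + K} = {0..L + K}" using L K by auto
    then show "continuous_on {0..L + K} \<eta>"
      using continuous_on_closed_Un[OF closed_atLeastAtMost closed_atLeastAtMost 1 2] by simp
  next
    fix c a b assume c: "c \<in> A" and ab: "0 \<le> a \<and> a \<le> b \<and> b \<le> L + K \<and> \<eta> ` {a..b} \<subseteq> chart_dom c"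
    have 1: "(coord c \<circ> \<gamma>) piecewise_C1_differentiable_on {a..b'}" if "a \<le> b'" "b' \<le> L" "b' \<le> b" for b'
    proof -
      have "\<gamma> ` {a..b'} \<subseteq> chart_dom c"
      proof
        fix y assume "y \<in> \<gamma> ` {a..b'}"
        then obtain t where "t \<in> {a..b'}" "y = \<gamma> t" by blast
        then have "y = \<eta> t" "t \<in> {a..b}" using \<eta>1[of t] that by auto
        then show "y \<in> chart_dom c" using ab by blast
      qed
      then show ?thesis using \<gamma>(1) c ab that unfolding unit_curve_def by auto
    qed
    have 2: "(coord c \<circ> ?\<delta>) piecewise_C1_differentiable_on {a'..b}" if "a \<le> a'" "L \<le> a'" "a' \<le> b" for a'
    proof (rule piecewise_C1_reparam)
      have im: "(\<lambda>t. 1 * t + (- L)) ` {a'..b} = {a' - L..b - L}"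
        using that image_affinity_atLeastAtMost[of 1 "-L" a' b] by simp
      have "\<delta> ` {a' - L..b - L} \<subseteq> chart_dom c"
      proof
        fix y assume "y \<in> \<delta> ` {a' - L..b - L}"
        then obtain t where "t \<in> {a' - L..b - L}" "y = \<delta> t" by blast
        then have "y = \<eta> (t + L)" "t + L \<in> {a..b}" using \<eta>2[of "t + L"] that by auto
        then show "y \<in> chart_dom c" using ab by blast
      qed
      then show "(coord c \<circ> \<delta>) piecewise_C1_differentiable_on ((\<lambda>t. 1 * t + (- L)) ` {a'..b})"
        unfolding im using \<delta>(1) c ab that unfolding unit_curve_def by auto
    qed
    show "(coord c \<circ> \<eta>) piecewise_C1_differentiable_on {a..b}"
    proof (cases "b \<le> L")
      case True
      show ?thesis by (rule piecewise_C1_cong[OF 1[of b]]) (use True ab \<eta>1 in auto)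
    next
      case bL: False
      show ?thesis
      proof (cases "L \<le> a")
        case True
        show ?thesis by (rule piecewise_C1_cong[OF 2[of a]]) (use True ab \<eta>2 in auto)
      next
        case False
        have "(\<lambda>t. if t \<le> L then (coord c \<circ> \<gamma>) t else (coord c \<circ> ?\<delta>) t) piecewise_C1_differentiable_on {a..b}"
          by (rule piecewise_C1_differentiable_cases[OF 1[of L] 2[of L]]) (use bL False \<gamma>(3) \<delta>(2) in auto)
        then show ?thesis by (rule piecewise_C1_cong) (auto simp: \<eta>_def)
      qed
    qed
  next
    show "\<exists>S. finite S \<and> (\<forall>t\<in>{0<..<L + K} - S. \<exists>c\<in>A. \<eta> t \<in> chart_dom c \<and>
        (\<exists>v. ((coord c \<circ> \<eta>) has_vector_derivative v) (at t) \<and> v \<bullet> (g c (\<eta> t) *v v) \<le> 1))"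
    \<comment> \<open>The junction \<open>L\<close> may be a corner of the concatenated curve, so it
      joins the exceptional set.\<close>
    proof (intro exI[of _ "S \<union> (\<lambda>t. t + L) ` T \<union> {L}"] conjI ballI)
      fix t assume t: "t \<in> {0<..<L + K} - (S \<union> (\<lambda>t. t + L) ` T \<union> {L})"
      show "\<exists>c\<in>A. \<eta> t \<in> chart_dom c \<and>
        (\<exists>v. ((coord c \<circ> \<eta>) has_vector_derivative v) (at t) \<and> v \<bullet> (g c (\<eta> t) *v v) \<le> 1)"
      proof (cases "t < L")
        case True
        then obtain c v where c: "c \<in> A" "\<gamma> t \<in> chart_dom c"
          "((coord c \<circ> \<gamma>) has_vector_derivative v) (at t)" "v \<bullet> (g c (\<gamma> t) *v v) \<le> 1" using S(2)[of t] t by auto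
        have "((coord c \<circ> \<eta>) has_vector_derivative v) (at t)"
          by (rule has_vector_derivative_transform_within_open[OF c(3), of "{..<L}"]) (use True \<eta>1 in auto)
        then show ?thesis using c \<eta>1[of t] True by auto
      next
        case False
        then have tL: "L < t" using t by auto
        have "1 * t + (- L) \<notin> T" using t by (auto simp: image_iff)
        then have "1 * t + (- L) \<in> {0<..<K} - T" using t tL by auto
        from T(2)[OF this] obtain c v where c: "c \<in> A" "?\<delta> t \<in> chart_dom c"
          "((coord c \<circ> \<delta>) has_vector_derivative v) (at (1 * t + (- L)))" "v \<bullet> (g c (?\<delta> t) *v v) \<le> 1" by blast
        have "((coord c \<circ> ?\<delta>) has_vector_derivative v) (at t)"
          using has_vector_derivative_affine[OF c(3)] by (simp add: o_def)
        then have "((coord c \<circ> \<eta>) has_vector_derivative v) (at t)"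
          by (rule has_vector_derivative_transform_within_open[of _ _ _ "{L<..}"]) (use tL \<eta>2 in auto)
        then show ?thesis using c \<eta>2[of t] tL by auto
      qed
    qed (use S(1) T(1) in auto)
  qed
  then show ?thesis using L K \<gamma> \<delta> \<eta>1[of 0] \<eta>2[of "L + K"] unfolding reach_def
    by (intro conjI exI[of _ \<eta>]) auto
qed

lemma reach_mono: "reach L p q \<Longrightarrow> L \<le> K \<Longrightarrow> reach K p q"
  using reach_trans[of L p q "K - L" q] reach_refl[of "K - L" q] by simp

text \<open>The coordinate segment is traversed with constant velocity \<open>(y - x) / L\<close>,
  whose length in the metric is at most 1 by the bound on \<open>y - x\<close>.\<close>

lemma reach_segment:
  assumes c: "c \<in> A" and seg: "closed_segment x y \<subseteq> chart_img c" and L: "0 < L"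
    and b: "\<And>z. z \<in> closed_segment x y \<Longrightarrow> (y - x) \<bullet> (g c (chart_inv c z) *v (y - x)) \<le> L\<^sup>2"
  shows "reach L (chart_inv c x) (chart_inv c y)"
proof -
  define w where "w = (1/L) *\<^sub>R (y - x)"
  define l where "l = (\<lambda>t. x + t *\<^sub>R w)"
  define \<gamma> where "\<gamma> = (\<lambda>t. chart_inv c (l t))"
  have l_seg: "l t \<in> closed_segment x y" if "t \<in> {0..L}" for t
    unfolding in_segment
    by (rule exI[of _ "t / L"]) (use that L in \<open>simp add: l_def w_def scaleR_diff_left scaleR_diff_right\<close>)
  have l_img: "l t \<in> chart_img c" if "t \<in> {0..L}" for t using l_seg[OF that] seg by blast
  have l_der: "(l has_vector_derivative w) (at t)" for t
    unfolding l_def by (auto intro!: derivative_eq_intros)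
  have l_cont: "continuous_on X l" for X unfolding l_def by (intro continuous_intros)
  have "unit_curve L \<gamma>"
    unfolding unit_curve_def
  proof (intro conjI ballI allI impI)
    show "continuous_on {0..L} \<gamma>"
      unfolding \<gamma>_def by (rule continuous_on_compose2[OF cont_chart_inv[OF c] l_cont]) (use l_img in blast)
  next
    fix d a b assume d: "d \<in> A" and ab: "0 \<le> a \<and> a \<le> b \<and> b \<le> L \<and> \<gamma> ` {a..b} \<subseteq> chart_dom d"
    \<comment> \<open>\<open>unit_curve\<close> demands regularity in every chart, so the segment
      must also be seen through the transition map to an arbitrary \<open>d\<close>.\<close>
    let ?U = "coord c ` (chart_dom c \<inter> chart_dom d)" and ?\<Phi> = "coord d \<circ> chart_inv c"
    have lU: "l t \<in> ?U" if "t \<in> {a..b}" for t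
    proof -
      have "\<gamma> t \<in> chart_dom d" using that ab by blast
      then show ?thesis unfolding coord_image_iff[OF c] using l_img[of t] that ab by (simp add: \<gamma>_def)
    qed
    have oU: "open ?U" by (rule open_coord_image[OF c open_dom[OF d]])
    have sm: "smooth_on ?U ?\<Phi>" by (rule smooth_transition[OF c d])
    have "((coord d \<circ> \<gamma>) has_vector_derivative (\<Sum>j\<in>UNIV. w $ j *\<^sub>R pd j ?\<Phi> (l t))) (at t)" if "t \<in> {a..b}" for t
    proof -
      have "((?\<Phi> \<circ> l) has_vector_derivative (\<Sum>j\<in>UNIV. w $ j *\<^sub>R pd j ?\<Phi> (l t))) (at t)"
        by (rule vector_derivative_diff_chain_within[OF l_der has_derivative_at_withinI[OF
              has_derivative_pd[OF smooth_on_at[OF sm oU lU[OF that]]]]])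
      then show ?thesis by (simp add: \<gamma>_def o_def)
    qed
    moreover have "continuous_on {a..b} (\<lambda>t. \<Sum>j\<in>UNIV. w $ j *\<^sub>R pd j ?\<Phi> (l t))"
    proof (intro continuous_on_sum continuous_on_scaleR continuous_on_const)
      show "continuous_on {a..b} (\<lambda>t. pd j ?\<Phi> (l t))" for j
        using continuous_on_compose2[of ?U "pd j ?\<Phi>" "{a..b}" l]
          smooth_on_imp_continuous_on[OF smooth_on_pd[OF sm]] l_cont lU by blast
    qed
    ultimately have "(coord d \<circ> \<gamma>) C1_differentiable_on {a..b}"
      unfolding C1_differentiable_on_def
      by (intro exI[of _ "\<lambda>t. \<Sum>j\<in>UNIV. w $ j *\<^sub>R pd j ?\<Phi> (l t)"] conjI ballI)
    then show "(coord d \<circ> \<gamma>) piecewise_C1_differentiable_on {a..b}"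
      by (rule C1_differentiable_imp_piecewise)
  next
    have "\<exists>c\<in>A. \<gamma> t \<in> chart_dom c \<and>
        (\<exists>v. ((coord c \<circ> \<gamma>) has_vector_derivative v) (at t) \<and> v \<bullet> (g c (\<gamma> t) *v v) \<le> 1)" if t: "t \<in> {0<..<L}" for t
    proof -
      have "((coord c \<circ> \<gamma>) has_vector_derivative w) (at t)"
        by (rule has_vector_derivative_transform_within_open[OF l_der, of "{0<..<L}"])
          (use t l_img in \<open>auto simp: \<gamma>_def coord_chart_inv c\<close>)
      moreover have "w \<bullet> (g c (\<gamma> t) *v w) \<le> 1"
      proof -
        have "w \<bullet> (g c (\<gamma> t) *v w) = ((y - x) \<bullet> (g c (\<gamma> t) *v (y - x))) / L\<^sup>2"
          unfolding w_def mv_scaleR_right by (simp add: power2_eq_square)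
        also have "\<dots> \<le> L\<^sup>2 / L\<^sup>2"
          unfolding \<gamma>_def by (rule divide_right_mono[OF b[OF l_seg]]) (use t in auto)
        finally show ?thesis using L by simp
      qed
      moreover have "\<gamma> t \<in> chart_dom c" using chart_inv_in[OF c l_img[of t]] t by (simp add: \<gamma>_def)
      ultimately show ?thesis using c by blast
    qed
    then show "\<exists>S. finite S \<and> (\<forall>t\<in>{0<..<L} - S. \<exists>c\<in>A. \<gamma> t \<in> chart_dom c \<and>
        (\<exists>v. ((coord c \<circ> \<gamma>) has_vector_derivative v) (at t) \<and> v \<bullet> (g c (\<gamma> t) *v v) \<le> 1))"
      by (intro exI[of _ "{}"]) auto
  qed
  moreover have "\<gamma> 0 = chart_inv c x" "\<gamma> L = chart_inv c y" using L by (auto simp: \<gamma>_def l_def w_def)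
  ultimately show ?thesis using L unfolding reach_def by auto
qed

lemma velocity_change:
  assumes c: "c \<in> A" "d \<in> A" and t: "\<gamma> t \<in> chart_dom c" "\<gamma> t \<in> chart_dom d"
    and co: "continuous_on T \<gamma>" "open T" "t \<in> T"
    and v: "((coord c \<circ> \<gamma>) has_vector_derivative v) (at t)"
  shows "((coord d \<circ> \<gamma>) has_vector_derivative (jac c d id (\<gamma> t) *v v)) (at t)"
proof -
  let ?\<Phi> = "coord d \<circ> chart_inv c"
  have D: "(?\<Phi> has_derivative (\<lambda>w. jac c d id (\<gamma> t) *v w)) (at ((coord c \<circ> \<gamma>) t))"
    using has_derivative_pd[OF transition_differentiable[OF c t]]
    by (simp only: jac_id jacobian_mult o_apply)
  have "((?\<Phi> \<circ> (coord c \<circ> \<gamma>)) has_vector_derivative (jac c d id (\<gamma> t) *v v)) (at t)"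
    by (rule vector_derivative_diff_chain_within[OF v has_derivative_at_withinI[OF D]])
  moreover have "open (\<gamma> -` chart_dom c \<inter> T)"
    using co open_dom[OF c(1)] continuous_on_open_vimage by blast
  ultimately show ?thesis
    by (rule has_vector_derivative_transform_within_open[of _ _ _ "\<gamma> -` chart_dom c \<inter> T"])
      (use t co in \<open>auto simp: chart_inv_coord c\<close>)
qed

text \<open>\<open>speed\<close> uses a chart picked separately at each time; invariance of the
  metric allows any chart in its place.\<close>

lemma speed_eq:
  assumes c: "c \<in> A" and t: "\<gamma> t \<in> chart_dom c"
    and co: "continuous_on T \<gamma>" "open T" "t \<in> T"
    and v: "((coord c \<circ> \<gamma>) has_vector_derivative v) (at t)"
  shows "speed A g \<gamma> t = sqrt (v \<bullet> (g c (\<gamma> t) *v v))"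
proof -
  let ?d = "chart_at A (\<gamma> t)"
  have d: "?d \<in> A" "\<gamma> t \<in> chart_dom ?d" using chart_at_in by auto
  show ?thesis
    unfolding speed_def Let_def vector_derivative_at[OF velocity_change[OF c d(1) t d(2) co v]]
      g_transform[OF c d(1) t d(2)] ..
qed

lemma reach_riem_dist:
  assumes "reach L p q" and L: "0 < L"
  shows "riem_dist A g p q \<le> ennreal L"
proof -
  obtain \<gamma> where \<gamma>: "unit_curve L \<gamma>" "\<gamma> 0 = p" "\<gamma> L = q"
    using assms unfolding reach_def by blast
  obtain S where S: "finite S" "\<And>t. t \<in> {0<..<L} - S \<Longrightarrow> \<exists>c\<in>A. \<gamma> t \<in> chart_dom c \<and>
        (\<exists>v. ((coord c \<circ> \<gamma>) has_vector_derivative v) (at t) \<and> v \<bullet> (g c (\<gamma> t) *v v) \<le> 1)"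
    using \<gamma>(1) unfolding unit_curve_def by blast
  define \<delta> where "\<delta> = (\<lambda>t. \<gamma> (L * t + 0))"
  have im: "(\<lambda>t. L * t + 0) ` {a..b} = {L * a..L * b}" if "a \<le> b" for a b
    using that L image_affinity_atLeastAtMost[of L 0 a b] by simp
  have cont: "continuous_on {0..1} \<delta>"
    unfolding \<delta>_def
    by (rule continuous_on_compose2[of "{0..L}" \<gamma>]) (use \<gamma>(1) L in \<open>auto simp: unit_curve_def mult_le_cancel_left1 intro!: continuous_intros\<close>)
  have "piecewise_C1_curve A \<delta>"
    unfolding piecewise_C1_curve_def
  proof (intro conjI ballI allI impI cont)
    fix c a b assume c: "c \<in> A" and ab: "0 \<le> a \<and> a \<le> b \<and> b \<le> 1 \<and> \<delta> ` {a..b} \<subseteq> chart_dom c"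
    have "\<gamma> ` {L * a..L * b} \<subseteq> chart_dom c"
      using ab unfolding im[symmetric, OF ab[THEN conjunct2, THEN conjunct1]] image_image \<delta>_def by blast
    moreover have "0 \<le> L * a" "L * a \<le> L * b" "L * b \<le> L" using ab L by (auto simp: mult_le_cancel_left1)
    ultimately have "(coord c \<circ> \<gamma>) piecewise_C1_differentiable_on {L * a..L * b}"
      using \<gamma>(1) c unfolding unit_curve_def by blast
    then show "(coord c \<circ> \<delta>) piecewise_C1_differentiable_on {a..b}"
      unfolding \<delta>_def using ab by (intro piecewise_C1_reparam) (simp only: im)
  qed
  moreover have "curve_length A g \<delta> \<le> ennreal L"
  proof -
    let ?S = "(\<lambda>s. s / L) ` S \<union> {0, 1}"
    have "speed A g \<delta> t \<le> L" if t: "t \<in> {0..1} - ?S" for t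
    proof -
      have "L * t \<notin> S"
      proof
        assume "L * t \<in> S"
        then have "(L * t) / L \<in> (\<lambda>s. s / L) ` S" by blast
        then show False using t L by auto
      qed
      then have "L * t + 0 \<in> {0<..<L} - S" using t L by (auto simp: order.strict_iff_order)
      from S(2)[OF this] obtain c v where c: "c \<in> A" "\<delta> t \<in> chart_dom c"
        "((coord c \<circ> \<gamma>) has_vector_derivative v) (at (L * t + 0))" "v \<bullet> (g c (\<delta> t) *v v) \<le> 1"
        unfolding \<delta>_def by blast
      have "((coord c \<circ> \<delta>) has_vector_derivative L *\<^sub>R v) (at t)"
        using has_vector_derivative_affine[OF c(3)] by (simp add: o_def \<delta>_def)
      moreover have "continuous_on {0<..<1} \<delta>" by (rule continuous_on_subset[OF cont]) auto
      ultimately have "speed A g \<delta> t = sqrt ((L *\<^sub>R v) \<bullet> (g c (\<delta> t) *v (L *\<^sub>R v)))"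
        using speed_eq[where \<gamma> = \<delta> and t = t and T = "{0<..<1}", OF c(1,2)] t by auto
      also have "\<dots> = L * sqrt (v \<bullet> (g c (\<delta> t) *v v))"
        unfolding mv_scaleR_right using L by (simp add: real_sqrt_mult)
      also have "\<dots> \<le> L * 1"
        using L c(4) by (intro mult_left_mono) (auto simp: real_sqrt_le_1_iff)
      finally show ?thesis by simp
    qed
    moreover have "AE t in lborel. t \<notin> ?S"
      using S(1) by (intro AE_not_in finite_imp_null_set_lborel) auto
    ultimately have "AE t in lborel. ennreal (speed A g \<delta> t) * indicator {0..1} t \<le> ennreal L * indicator {0..1} t"
      by (elim AE_mp, intro AE_I2) (auto simp: indicator_def ennreal_leI)
    then have "curve_length A g \<delta> \<le> (\<integral>\<^sup>+t. ennreal L * indicator {0..1::real} t \<partial>lborel)"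
      unfolding curve_length_def by (intro nn_integral_mono_AE)
    then show ?thesis by (simp add: nn_integral_cmult_indicator)
  qed
  moreover have "\<delta> 0 = p" "\<delta> 1 = q" using \<gamma> by (auto simp: \<delta>_def)
  ultimately show ?thesis
    unfolding riem_dist_def by (intro INF_lower2[of \<delta>]) auto
qed

end

text \<open>The function \<open>s\<close>, below the speed of a curve, is not assumed measurable.\<close>

lemma nn_integral_derivative_bound:
  fixes h :: "real \<Rightarrow> real"
  assumes S: "finite S" and co: "continuous_on {0..1} h"
    and d: "\<And>t. t \<in> {0<..<1} - S \<Longrightarrow> (h has_real_derivative D t) (at t)"
    and b: "\<And>t. t \<in> {0<..<1} - S \<Longrightarrow> \<bar>D t\<bar> \<le> C * s t" and C: "C > 0"
  shows "ennreal \<bar>h 1 - h 0\<bar> \<le> ennreal C * (\<integral>\<^sup>+ t\<in>{0..1}. ennreal (s t) \<partial>lborel)"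
proof (cases "(\<integral>\<^sup>+ t\<in>{0..1}. ennreal (s t) \<partial>lborel) = \<infinity>")
  case True
  then show ?thesis using C by (simp add: ennreal_mult_top)
next
  case False
  let ?I = "\<integral>\<^sup>+ t\<in>{0..1}. ennreal (s t) \<partial>lborel"
  note C0 = C
  have fin: "?I < \<infinity>" using False by (auto simp: top.not_eq_extremum)
  \<comment> \<open>The fundamental theorem yields a gauge integral only. Absolute integrability of
    \<open>D\<close> follows below from the bound by \<open>s\<close>, and then the Lebesgue
    integral has the same value.\<close>
  have hi: "(D has_integral (h 1 - h 0)) {0..1}"
    by (rule fundamental_theorem_of_calculus_interior_strong[OF S _ _ co])
      (use d in \<open>auto simp: has_real_derivative_iff_has_vector_derivative\<close>)
  define E where "E = (\<lambda>t. indicator {0..1} t *\<^sub>R D t)"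
  have meas: "E \<in> borel_measurable lebesgue"
    unfolding E_def by (rule has_integral_implies_lebesgue_measurable[OF hi])
  have AE: "AE t in lborel. ennreal (norm (E t)) \<le> ennreal C * (ennreal (s t) * indicator {0..1} t)"
  proof -
    have "AE t in lborel. t \<notin> S \<union> {0, 1}"
      using S by (intro AE_not_in finite_imp_null_set_lborel) auto
    moreover have "ennreal (norm (E t)) \<le> ennreal C * (ennreal (s t) * indicator {0..1} t)" if "t \<notin> S \<union> {0, 1}" for t
    proof (cases "t \<in> {0..1}")
      case True
      then have "t \<in> {0<..<1} - S" using that by auto
      from b[OF this] have "\<bar>D t\<bar> \<le> C * s t" .
      then have "ennreal \<bar>D t\<bar> \<le> ennreal C * ennreal (s t)"
        using C0 by (metis ennreal_leI ennreal_mult' less_imp_le)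
      then show ?thesis using True by (simp add: E_def)
    qed (simp add: E_def)
    ultimately show ?thesis by (elim AE_mp) (auto intro!: AE_I2)
  qed
  have le: "(\<integral>\<^sup>+t. ennreal (norm (E t)) \<partial>lebesgue) \<le> ennreal C * ?I"
  proof -
    have "(\<integral>\<^sup>+t. ennreal (norm (E t)) \<partial>lebesgue) = (\<integral>\<^sup>+t. ennreal (norm (E t)) \<partial>lborel)"
      by (rule nn_integral_completion)
    also have "\<dots> \<le> (\<integral>\<^sup>+t. ennreal C * (ennreal (s t) * indicator {0..1} t) \<partial>lborel)"
      by (rule nn_integral_mono_AE[OF AE])
    also have "\<dots> \<le> ennreal C * ?I"
    proof -
      \<comment> \<open>As \<open>s\<close> may fail to be measurable, \<open>C\<close> is moved out
        of the integral at the level of simple functions: a simple minorant divided by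
        \<open>C\<close> is a minorant of the unscaled integrand.\<close>
      have "(\<integral>\<^sup>+t. ennreal C * (ennreal (s t) * indicator {0..1} t) \<partial>lborel) \<le> ennreal C * ?I"
        unfolding nn_integral_def[of _ "\<lambda>t. ennreal C * (ennreal (s t) * indicator {0..1} t)"]
      proof (rule SUP_least, clarify)
        fix f :: "real \<Rightarrow> ennreal"
        assume f: "simple_function lborel f" "f \<le> (\<lambda>t. ennreal C * (ennreal (s t) * indicator {0..1} t))"
        have m[measurable]: "f \<in> borel_measurable lborel" using f(1) by (rule borel_measurable_simple_function)
        have e: "ennreal C * (ennreal (1 / C) * z) = z" for z
          using C0 by (simp add: mult.assoc[symmetric] ennreal_mult[symmetric])
        have e': "ennreal (1 / C) * (ennreal C * z) = z" for z
          using C0 by (simp add: mult.assoc[symmetric] ennreal_mult[symmetric])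
        have "ennreal (1 / C) * f t \<le> ennreal (s t) * indicator {0..1} t" for t
          using mult_left_mono[OF le_funD[OF f(2), of t], of "ennreal (1 / C)"] unfolding e' by simp
        then have "(\<integral>\<^sup>+t. ennreal (1 / C) * f t \<partial>lborel) \<le> ?I" by (intro nn_integral_mono)
        then have "ennreal (1 / C) * (\<integral>\<^sup>+t. f t \<partial>lborel) \<le> ?I" by (simp add: nn_integral_cmult)
        from mult_left_mono[OF this, of "ennreal C"] have "(\<integral>\<^sup>+t. f t \<partial>lborel) \<le> ennreal C * ?I"
          unfolding e by simp
        then show "integral\<^sup>S lborel f \<le> ennreal C * ?I"
          using nn_integral_eq_simple_integral[OF f(1)] by simp
      qed
      then show ?thesis .
    qed
    finally show ?thesis .
  qed
  have "ennreal C * ?I < \<infinity>" using fin by (simp add: ennreal_mult_less_top)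
  then have int: "integrable lebesgue E"
    using le meas by (intro integrableI_bounded) (auto simp: less_le_trans le_less_trans)
  then have "set_integrable lebesgue {0..1} D" by (simp add: set_integrable_def E_def)
  then have "integral\<^sup>L lebesgue E = h 1 - h 0"
    using has_integral_unique[OF has_integral_set_lebesgue hi] by (simp add: set_lebesgue_integral_def E_def)
  moreover have "ennreal (norm (integral\<^sup>L lebesgue E)) \<le> ennreal C * ?I"
    by (rule order_trans[OF integral_norm_bound_ennreal[OF int] le])
  ultimately show ?thesis by simp
qed

section \<open>Lipschitz estimates from gradient bounds\<close>

context riemannian_manifold
begin

lemma smooth_fun_along_curve:
  assumes u: "smooth_fun A u" "grad_bound u C" and c: "c \<in> A" "\<gamma> t \<in> chart_dom c"
    and co: "continuous_on T \<gamma>" "open T" "t \<in> T"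
    and v: "((coord c \<circ> \<gamma>) has_vector_derivative v) (at t)"
  shows "\<exists>D. ((u \<circ> \<gamma>) has_real_derivative D) (at t) \<and> \<bar>D\<bar> \<le> C * speed A g \<gamma> t"
proof -
  let ?u = "\<lambda>x. u (chart_inv c x)"
  have du: "?u differentiable at ((coord c \<circ> \<gamma>) t)"
    by (rule smooth_on_at[OF smooth_fun_comp[OF u(1) c(1)] open_img[OF c(1)]]) (use c in auto)
  have "((?u \<circ> (coord c \<circ> \<gamma>)) has_vector_derivative (\<Sum>i\<in>UNIV. v $ i *\<^sub>R pd i ?u ((coord c \<circ> \<gamma>) t))) (at t)"
    by (rule vector_derivative_diff_chain_within[OF v has_derivative_at_withinI[OF has_derivative_pd[OF du]]])
  moreover have "open (\<gamma> -` chart_dom c \<inter> T)"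
    using co open_dom[OF c(1)] continuous_on_open_vimage by blast
  ultimately have "((u \<circ> \<gamma>) has_vector_derivative (\<Sum>i\<in>UNIV. v $ i *\<^sub>R pd i ?u ((coord c \<circ> \<gamma>) t))) (at t)"
    by (rule has_vector_derivative_transform_within_open[of _ _ _ "\<gamma> -` chart_dom c \<inter> T"])
      (use c co in \<open>auto simp: chart_inv_coord\<close>)
  then have "((u \<circ> \<gamma>) has_real_derivative dir_deriv ?u (coord c (\<gamma> t)) v) (at t)"
    by (simp add: has_real_derivative_iff_has_vector_derivative dir_deriv_def)
  moreover have "\<bar>dir_deriv ?u (coord c (\<gamma> t)) v\<bar> \<le> C * speed A g \<gamma> t"
    using grad_boundD[OF u(2) c] speed_eq[OF c co v] by simp
  ultimately show ?thesis by blast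
qed

text \<open>\<open>piecewise_C1_curve\<close> speaks only of time intervals mapped into a single
  chart. Such intervals exist around every time, and the bisection principle \<open>Bolzano\<close>
  joins them to one finite exceptional set on \<open>{0..1}\<close>.\<close>

lemma lipschitz_curve:
  assumes u: "smooth_fun A u" "grad_bound u C" "C > 0" and \<gamma>: "piecewise_C1_curve A \<gamma>"
  shows "ennreal \<bar>u (\<gamma> 1) - u (\<gamma> 0)\<bar> \<le> ennreal C * curve_length A g \<gamma>"
proof -
  have cont: "continuous_on {0..1} \<gamma>" using \<gamma> unfolding piecewise_C1_curve_def by blast
  define good where "good t \<longleftrightarrow> (\<exists>D. ((u \<circ> \<gamma>) has_real_derivative D) (at t) \<and> \<bar>D\<bar> \<le> C * speed A g \<gamma> t)" for t
  define P where "P a b \<longleftrightarrow> (0 \<le> a \<and> b \<le> 1 \<longrightarrow> (\<exists>S. finite S \<and> (\<forall>t\<in>{a<..<b} - S. good t)))" for a b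
  have "P 0 1"
  proof (rule Bolzano)
    show "(0::real) \<le> 1" by simp
    show "P a c" if "P a b" "P b c" "a \<le> b" "b \<le> c" for a b c
      unfolding P_def
    proof (intro impI)
      assume "0 \<le> a \<and> c \<le> 1"
      with that obtain S T where ST: "finite S" "finite T" "\<forall>t\<in>{a<..<b} - S. good t" "\<forall>t\<in>{b<..<c} - T. good t"
        unfolding P_def by (metis order_trans)
      then have "\<forall>t\<in>{a<..<c} - (S \<union> T \<union> {b}). good t"
        by (auto simp: not_less_iff_gr_or_eq) (metis DiffI greaterThanLessThan_iff linorder_neqE_linordered_idom)
      then show "\<exists>S. finite S \<and> (\<forall>t\<in>{a<..<c} - S. good t)" using ST(1,2) by (metis finite.emptyI finite.insertI finite_UnI)
    qed
  next
    fix x :: real assume x: "0 \<le> x" "x \<le> 1"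
    obtain c where c: "c \<in> A" "\<gamma> x \<in> chart_dom c" using ex_chart by blast
    obtain W where W: "open W" "W \<inter> {0..1} = \<gamma> -` chart_dom c \<inter> {0..1}"
      using cont[unfolded continuous_on_open_invariant, rule_format, OF open_dom[OF c(1)]] by (elim exE conjE)
    have "x \<in> \<gamma> -` chart_dom c \<inter> {0..1}" using c(2) x by simp
    then have "x \<in> W" unfolding W(2)[symmetric] by simp
    then obtain d where d: "d > 0" "ball x d \<subseteq> W" using openE[OF W(1)] by metis
    have "P a b" if "a \<le> x" "x \<le> b" "b - a < d" for a b
      unfolding P_def
    proof (intro impI)
      assume ab: "0 \<le> a \<and> b \<le> 1"
      have "\<gamma> ` {a..b} \<subseteq> chart_dom c"
      proof (clarify)
        fix t assume t: "t \<in> {a..b}"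
        then have "t \<in> ball x d" using that by (auto simp: dist_real_def)
        then have "t \<in> W \<inter> {0..1}" using d t ab by auto
        then show "\<gamma> t \<in> chart_dom c" unfolding W(2) by simp
      qed
      note im = this
      then have "(coord c \<circ> \<gamma>) piecewise_C1_differentiable_on {a..b}"
        using \<gamma> c ab that unfolding piecewise_C1_curve_def by auto
      then obtain S where S: "finite S" "(coord c \<circ> \<gamma>) C1_differentiable_on ({a..b} - S)"
        unfolding piecewise_C1_differentiable_on_def by blast
      have "good t" if t: "t \<in> {a<..<b} - S" for t
      proof -
        have "t \<in> {a..b} - S" using t by auto
        then obtain v where v: "((coord c \<circ> \<gamma>) has_vector_derivative v) (at t)"
          using S(2) unfolding C1_differentiable_on_def by blast
        have "continuous_on {a<..<b} \<gamma>" by (rule continuous_on_subset[OF cont]) (use ab in auto)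
        moreover have "\<gamma> t \<in> chart_dom c" using im t by auto
        ultimately show ?thesis unfolding good_def
          using smooth_fun_along_curve[OF u(1,2) c(1) _ _ open_greaterThanLessThan _ v] t by auto
      qed
      then show "\<exists>S. finite S \<and> (\<forall>t\<in>{a<..<b} - S. good t)" using S(1) by blast
    qed
    then show "\<exists>d>0. \<forall>a b. a \<le> x \<and> x \<le> b \<and> b - a < d \<longrightarrow> P a b" using d(1) by blast
  qed
  then obtain S where S: "finite S" "\<And>t. t \<in> {0<..<1} - S \<Longrightarrow> good t" unfolding P_def by auto
  have "\<exists>D. \<forall>t\<in>{0<..<1} - S. ((u \<circ> \<gamma>) has_real_derivative D t) (at t) \<and> \<bar>D t\<bar> \<le> C * speed A g \<gamma> t"
    using S(2) unfolding good_def by (intro bchoice) blast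
  then obtain D where D: "\<And>t. t \<in> {0<..<1} - S \<Longrightarrow> ((u \<circ> \<gamma>) has_real_derivative D t) (at t)"
    "\<And>t. t \<in> {0<..<1} - S \<Longrightarrow> \<bar>D t\<bar> \<le> C * speed A g \<gamma> t" by blast
  have "continuous_on {0..1} (u \<circ> \<gamma>)"
    by (rule continuous_on_compose[OF cont continuous_on_subset[OF smooth_fun_continuous[OF u(1)]]]) simp
  from nn_integral_derivative_bound[OF S(1) this D u(3)] show ?thesis
    by (simp add: curve_length_def)
qed

lemma lipschitz_riem_dist:
  assumes u: "smooth_fun A u" "grad_bound u C" "C > 0" and L: "riem_dist A g p q \<le> ennreal L" "L \<ge> 0"
  shows "\<bar>u q - u p\<bar> \<le> C * L"
proof (rule field_le_epsilon)
  fix e :: real assume e: "e > 0"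
  \<comment> \<open>The infimum need not be attained; a slack of \<open>e / C\<close> in length
    costs \<open>e\<close> in the estimate.\<close>
  have "riem_dist A g p q < ennreal (L + e / C)"
    using L e u(3) by (intro le_less_trans[OF L(1)]) (simp add: ennreal_less_iff)
  then obtain \<gamma> where \<gamma>: "piecewise_C1_curve A \<gamma>" "\<gamma> 0 = p" "\<gamma> 1 = q" "curve_length A g \<gamma> < ennreal (L + e / C)"
    unfolding riem_dist_def INF_less_iff by blast
  have "ennreal \<bar>u q - u p\<bar> \<le> ennreal C * curve_length A g \<gamma>"
    using lipschitz_curve[OF u \<gamma>(1)] \<gamma>(2,3) by simp
  also have "\<dots> \<le> ennreal C * ennreal (L + e / C)"
    using \<gamma>(4) by (intro mult_left_mono) auto
  also have "\<dots> = ennreal (C * L + e)"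
    using u(3) L(2) e by (simp add: ennreal_mult[symmetric] distrib_left)
  finally have "ennreal \<bar>u q - u p\<bar> \<le> ennreal (C * L + e)" .
  then show "\<bar>u q - u p\<bar> \<le> C * L + e"
    by (rule ennreal_le_iff[THEN iffD1, rotated]) (use u(3) L(2) e in simp)
qed

lemma lipschitz_reach:
  assumes u: "smooth_fun A u" "grad_bound u C" "C > 0" and r: "reach L p q"
  shows "\<bar>u q - u p\<bar> \<le> C * L"
proof (rule field_le_epsilon)
  fix e :: real assume e: "e > 0"
  have L: "L \<ge> 0" using r by (simp add: reach_def)
  \<comment> \<open>\<open>L\<close> may be 0, while \<open>reach_riem_dist\<close> asks for a
    positive length.\<close>
  have "reach (L + e / C) p q" by (rule reach_mono[OF r]) (use e u(3) in simp)
  then have "riem_dist A g p q \<le> ennreal (L + e / C)"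
    by (rule reach_riem_dist) (use L e u(3) in \<open>simp add: add_nonneg_pos\<close>)
  then have "\<bar>u q - u p\<bar> \<le> C * (L + e / C)"
    by (rule lipschitz_riem_dist[OF u]) (use L e u(3) in simp)
  then show "\<bar>u q - u p\<bar> \<le> C * L + e" using u(3) by (simp add: distrib_left)
qed

end

section \<open>Cutoff functions on complete manifolds\<close>

text \<open>The functions \<open>p(1/t) exp(-1/t)\<close>, extended by 0, form a family closed under
  differentiation, as \<open>Ck_on_real_compose\<close> requires.\<close>

definition flat :: "real poly \<Rightarrow> real \<Rightarrow> real" where
  "flat p t = (if t \<le> 0 then 0 else poly p (inverse t) * exp (- inverse t))"

lemma poly_exp_tendsto_0: "((\<lambda>s::real. poly p s * exp (- s)) \<longlongrightarrow> 0) at_top"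
proof -
  have "((\<lambda>s::real. \<Sum>i\<le>degree p. coeff p i * (s ^ i / exp s)) \<longlongrightarrow> (\<Sum>i\<le>degree p. coeff p i * 0)) at_top"
    by (intro tendsto_sum tendsto_mult tendsto_const tendsto_power_div_exp_0)
  moreover have "(\<Sum>i\<le>degree p. coeff p i * (s ^ i / exp s)) = poly p s * exp (- s)" for s :: real
    by (simp add: poly_altdef sum_distrib_right exp_minus divide_inverse mult.assoc)
  ultimately show ?thesis by simp
qed

lemma flat_tendsto_0: "((\<lambda>t. flat p t) \<longlongrightarrow> 0) (at 0)"
proof (rule filterlim_split_at)
  have "\<forall>\<^sub>F t in at_left 0. flat p t = 0"
    by (auto simp: eventually_at_filter flat_def)
  then show "((\<lambda>t. flat p t) \<longlongrightarrow> 0) (at_left 0)" by (rule tendsto_eventually)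
  have "((\<lambda>t. poly p (inverse t) * exp (- inverse t)) \<longlongrightarrow> 0) (at_right 0)"
    by (rule filterlim_compose[OF poly_exp_tendsto_0 filterlim_inverse_at_top_right])
  moreover have "\<forall>\<^sub>F t in at_right 0. poly p (inverse t) * exp (- inverse t) = flat p t"
    by (auto simp: eventually_at_filter flat_def)
  ultimately show "((\<lambda>t. flat p t) \<longlongrightarrow> 0) (at_right 0)" by (rule Lim_transform_eventually)
qed

text \<open>In the variable \<open>s = 1/t\<close> one has \<open>d/dt = - s^2 d/ds\<close>, which
  sends \<open>p(s) exp(-s)\<close> to \<open>s^2 (p - p')(s) exp(-s)\<close>.\<close>

lemma flat_deriv: "(flat p has_real_derivative flat ([:0, 0, 1:] * (p - pderiv p)) t) (at t)"
proof (cases t "0 :: real" rule: linorder_cases)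
  case less
  have "((\<lambda>t. 0) has_real_derivative 0) (at t)" by simp
  then have "(flat p has_real_derivative 0) (at t)"
    by (rule has_field_derivative_transform_within_open[of _ _ _ "{..<0}"]) (use less in \<open>auto simp: flat_def\<close>)
  then show ?thesis using less by (simp add: flat_def)
next
  case equal
  \<comment> \<open>At 0 the difference quotient is itself a member of the family, with
    \<open>p\<close> multiplied by the variable, and therefore tends to 0.\<close>
  have "(\<lambda>y. (flat p y - flat p 0) / (y - 0)) = flat (pCons 0 p)"
    by (auto simp: flat_def fun_eq_iff field_simps)
  then have "(flat p has_real_derivative 0) (at 0)"
    using flat_tendsto_0[of "pCons 0 p"] unfolding has_field_derivative_iff by simp
  then show ?thesis using equal by (simp add: flat_def)
next
  case greater
  have "((\<lambda>t. poly p (inverse t) * exp (- inverse t)) has_real_derivative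
      poly p (inverse t) * (exp (- inverse t) * (inverse t * inverse t)) +
      poly (pderiv p) (inverse t) * (- (inverse t * inverse t)) * exp (- inverse t)) (at t)"
    using greater by (auto intro!: derivative_eq_intros DERIV_chain2[OF poly_DERIV] simp: power2_eq_square)
  also have "poly p (inverse t) * (exp (- inverse t) * (inverse t * inverse t)) +
      poly (pderiv p) (inverse t) * (- (inverse t * inverse t)) * exp (- inverse t)
     = flat ([:0, 0, 1:] * (p - pderiv p)) t"
    using greater by (simp add: flat_def algebra_simps)
  finally show ?thesis
    by (rule has_field_derivative_transform_within_open[of _ _ _ "{0<..}"]) (use greater in \<open>auto simp: flat_def\<close>)
qed

text \<open>A smooth substitute for \<open>max 0 t\<close> that vanishes exactly for
  \<open>t \<le> 0\<close>. Its derivative \<open>(1 + 1/t) exp(-1/t)\<close> lies between 0 and 1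
  because \<open>1 + s \<le> exp s\<close>.\<close>

definition softplus :: "real \<Rightarrow> real" where
  "softplus t = (if t \<le> 0 then 0 else t * exp (- inverse t))"

lemma softplus_deriv: "(softplus has_real_derivative flat [:1, 1:] t) (at t)"
proof (cases t "0 :: real" rule: linorder_cases)
  case less
  have "((\<lambda>t. 0) has_real_derivative 0) (at t)" by simp
  then have "(softplus has_real_derivative 0) (at t)"
    by (rule has_field_derivative_transform_within_open[of _ _ _ "{..<0}"]) (use less in \<open>auto simp: softplus_def\<close>)
  then show ?thesis using less by (simp add: flat_def)
next
  case equal
  have "(\<lambda>y. (softplus y - softplus 0) / (y - 0)) = flat [:1:]"
    by (auto simp: flat_def softplus_def fun_eq_iff field_simps)
  then have "(softplus has_real_derivative 0) (at 0)"
    using flat_tendsto_0[of "[:1:]"] unfolding has_field_derivative_iff by simp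
  then show ?thesis using equal by (simp add: flat_def)
next
  case greater
  have "((\<lambda>t. t * exp (- inverse t)) has_real_derivative
      t * (exp (- inverse t) * (inverse t * inverse t)) + 1 * exp (- inverse t)) (at t)"
    using greater by (auto intro!: derivative_eq_intros simp: power2_eq_square)
  also have "t * (exp (- inverse t) * (inverse t * inverse t)) + 1 * exp (- inverse t) = flat [:1, 1:] t"
    using greater by (simp add: flat_def algebra_simps)
  finally show ?thesis
    by (rule has_field_derivative_transform_within_open[of _ _ _ "{0<..}"]) (use greater in \<open>auto simp: softplus_def\<close>)
qed

lemma softplus_deriv_bounds: "0 \<le> flat [:1, 1:] t" "flat [:1, 1:] t \<le> 1"
proof -
  show "0 \<le> flat [:1, 1:] t" by (simp add: flat_def)
  show "flat [:1, 1:] t \<le> 1"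
  proof (cases "t \<le> 0")
    case False
    have "(1 + inverse t) * exp (- inverse t) \<le> exp (inverse t) * exp (- inverse t)"
      by (intro mult_right_mono exp_ge_add_one_self) simp
    also have "\<dots> = 1" by (simp add: exp_minus)
    finally show ?thesis using False by (simp add: flat_def algebra_simps)
  qed (simp add: flat_def)
qed

lemma softplus_bounds: "0 \<le> softplus t" "t - 1 \<le> softplus t" "softplus t \<le> max 0 t" "t \<le> 0 \<Longrightarrow> softplus t = 0"
proof -
  show "0 \<le> softplus t" by (simp add: softplus_def)
  show "t - 1 \<le> softplus t"
  proof (cases "t \<le> 0")
    case False
    have "t * (1 + - inverse t) \<le> t * exp (- inverse t)"
      by (intro mult_left_mono exp_ge_add_one_self) (use False in simp)
    then show ?thesis using False by (simp add: softplus_def algebra_simps)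
  qed (simp add: softplus_def)
  show "softplus t \<le> max 0 t"
    using mult_left_mono[of "exp (- inverse t)" 1 t] by (simp add: softplus_def)
  show "t \<le> 0 \<Longrightarrow> softplus t = 0" by (simp add: softplus_def)
qed

lemma smooth_on_flat_softplus:
  assumes S: "open S" and u: "smooth_on S u"
  shows "smooth_on S (\<lambda>x. flat p (u x))" "smooth_on S (\<lambda>x. softplus (u x))"
proof -
  define P where "P = insert softplus (range flat)"
  have P: "\<exists>\<theta>'\<in>P. \<forall>t. (\<theta> has_real_derivative \<theta>' t) (at t)" if "\<theta> \<in> P" for \<theta>
    using that softplus_deriv flat_deriv unfolding P_def by (elim insertE imageE) (metis insertCI rangeI)+
  have "\<theta> \<in> P \<Longrightarrow> Ck_on n S (\<lambda>x. \<theta> (u x))" for \<theta> n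
    using Ck_on_real_compose[where P = P and \<theta> = \<theta> and u = u and S = S and n = n] S P u smooth_on_Ck_on by blast
  then show "smooth_on S (\<lambda>x. flat p (u x))" "smooth_on S (\<lambda>x. softplus (u x))"
    unfolding smooth_on_Ck_on P_def by blast+
qed

text \<open>A smooth maximum that agrees with \<open>u\<close> exactly where \<open>v \<le> u\<close>, so that a locally defined \<open>v\<close>
  can be glued in, and whose gradient is a convex combination of those of \<open>u\<close> and \<open>v\<close>.\<close>

definition smax :: "real \<Rightarrow> real \<Rightarrow> real \<Rightarrow> real" where
  "smax d u v = u + d * softplus ((v - u) / d)"

lemma smax_bounds:
  assumes "d > 0"
  shows "u \<le> smax d u v" "v - d \<le> smax d u v" "smax d u v \<le> max u v" "v \<le> u \<Longrightarrow> smax d u v = u"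
proof -
  show "u \<le> smax d u v" using softplus_bounds(1) assms by (simp add: smax_def)
  have "d * ((v - u) / d - 1) \<le> d * softplus ((v - u) / d)"
    by (intro mult_left_mono softplus_bounds(2)) (use assms in simp)
  moreover have "d * ((v - u) / d - 1) = v - u - d" using assms by (simp add: field_simps)
  ultimately show "v - d \<le> smax d u v" by (simp add: smax_def)
  have "d * softplus ((v - u) / d) \<le> d * max 0 ((v - u) / d)"
    by (intro mult_left_mono softplus_bounds(3)) (use assms in simp)
  also have "\<dots> = max 0 (v - u)" using assms by (simp add: max_def field_simps)
  finally show "smax d u v \<le> max u v" by (simp add: smax_def)
  show "v \<le> u \<Longrightarrow> smax d u v = u"
    using softplus_bounds(4)[of "(v - u) / d"] assms by (simp add: smax_def divide_le_0_iff)
qed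

lemma smooth_on_smax:
  assumes S: "open S" and u: "smooth_on S u" "smooth_on S v"
  shows "smooth_on S (\<lambda>x. smax d (u x) (v x))"
proof -
  have "smooth_on S (\<lambda>x. (v x - u x) * inverse d)"
    by (rule smooth_on_mult[OF S smooth_on_diff[OF S u(2,1)] smooth_on_const])
  then have "smooth_on S (\<lambda>x. softplus ((v x - u x) * inverse d))"
    by (rule smooth_on_flat_softplus(2)[OF S])
  then have "smooth_on S (\<lambda>x. u x + d * softplus ((v x - u x) * inverse d))"
    by (intro smooth_on_add[OF S u(1)] smooth_on_mult[OF S smooth_on_const])
  then show ?thesis by (simp add: smax_def divide_inverse)
qed

lemma dir_deriv_derivative:
  assumes "(h has_derivative h') (at x)"
  shows "dir_deriv h x z = h' z"
proof -
  have "h differentiable at x" using assms by (rule differentiableI)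
  then have "(h has_derivative (\<lambda>v. \<Sum>i\<in>UNIV. v $ i *\<^sub>R pd i h x)) (at x)" by (rule has_derivative_pd)
  then have "(\<lambda>v. \<Sum>i\<in>UNIV. v $ i *\<^sub>R pd i h x) = h'" using has_derivative_unique assms by blast
  then show ?thesis by (auto simp: dir_deriv_def)
qed

lemma has_derivative_dir_deriv: "h differentiable at x \<Longrightarrow> (h has_derivative dir_deriv h x) (at x)"
  using has_derivative_pd[of h x] by (simp add: dir_deriv_def[abs_def])

lemma dir_deriv_smax:
  assumes d: "d > 0" and u: "u differentiable at x" and v: "v differentiable at x"
  shows "\<exists>\<theta>\<in>{0..1}. \<forall>z. dir_deriv (\<lambda>y. smax d (u y) (v y)) x z = (1 - \<theta>) * dir_deriv u x z + \<theta> * dir_deriv v x z"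
proof (intro bexI allI)
  let ?\<theta> = "flat [:1, 1:] ((v x - u x) / d)"
  show "?\<theta> \<in> {0..1}" using softplus_deriv_bounds by simp
  fix z
  have 1: "((\<lambda>y. (v y - u y) / d) has_derivative (\<lambda>z. (dir_deriv v x z - dir_deriv u x z) / d)) (at x)"
    by (rule bounded_linear.has_derivative[OF bounded_linear_divide
          has_derivative_diff[OF has_derivative_dir_deriv[OF v] has_derivative_dir_deriv[OF u]]])
  have 2: "((\<lambda>y. softplus ((v y - u y) / d)) has_derivative (\<lambda>z. ?\<theta> * ((dir_deriv v x z - dir_deriv u x z) / d))) (at x)"
    by (rule has_derivative_compose[OF 1 softplus_deriv[unfolded has_field_derivative_def]])
  have "((\<lambda>y. u y + d * softplus ((v y - u y) / d)) has_derivative (\<lambda>z. dir_deriv u x z + d * (?\<theta> * ((dir_deriv v x z - dir_deriv u x z) / d)))) (at x)"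
    by (rule has_derivative_add[OF has_derivative_dir_deriv[OF u] has_derivative_mult_right[OF 2]])
  from dir_deriv_derivative[OF this, of z]
  have "dir_deriv (\<lambda>y. smax d (u y) (v y)) x z = dir_deriv u x z + d * (?\<theta> * ((dir_deriv v x z - dir_deriv u x z) / d))"
    by (simp only: smax_def)
  also have "d * (?\<theta> * ((dir_deriv v x z - dir_deriv u x z) / d)) = ?\<theta> * (dir_deriv v x z - dir_deriv u x z)"
    using d by simp
  finally show "dir_deriv (\<lambda>y. smax d (u y) (v y)) x z = (1 - ?\<theta>) * dir_deriv u x z + ?\<theta> * dir_deriv v x z"
    by (simp add: algebra_simps)
qed

lemma dir_deriv_const: "dir_deriv (\<lambda>x. k) x z = 0"
  by (simp add: dir_deriv_def)

lemma abs_convex_bound: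
  fixes a b C \<theta> :: real
  assumes "\<bar>a\<bar> \<le> C" "\<bar>b\<bar> \<le> C" "\<theta> \<in> {0..1}"
  shows "\<bar>(1 - \<theta>) * a + \<theta> * b\<bar> \<le> C"
proof -
  have "\<bar>(1 - \<theta>) * a + \<theta> * b\<bar> \<le> (1 - \<theta>) * \<bar>a\<bar> + \<theta> * \<bar>b\<bar>"
    using assms(3) abs_triangle_ineq[of "(1 - \<theta>) * a" "\<theta> * b"] by (simp add: abs_mult)
  also have "\<dots> \<le> (1 - \<theta>) * C + \<theta> * C"
    using assms by (intro add_mono mult_left_mono) auto
  finally show ?thesis by (simp add: algebra_simps)
qed

section \<open>Admissible functions and gluing\<close>

context riemannian_manifold
begin

lemma smooth_fun_smax:
  assumes "smooth_fun A u" "smooth_fun A v"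
  shows "smooth_fun A (\<lambda>p. smax d (u p) (v p))"
  unfolding smooth_fun_def o_def
  using smooth_on_smax[OF open_img smooth_fun_comp[OF assms(1)] smooth_fun_comp[OF assms(2)]] by blast

lemma chart_comp_differentiable:
  assumes "smooth_fun A u" "c \<in> A" "p \<in> chart_dom c"
  shows "(\<lambda>x. u (chart_inv c x)) differentiable at (coord c p)"
  by (rule smooth_on_at[OF smooth_fun_comp[OF assms(1,2)] open_img[OF assms(2)]]) (use assms in auto)

lemma grad_bound_smax:
  assumes "smooth_fun A u" "smooth_fun A v" "grad_bound u C" "grad_bound v C" "d > 0"
  shows "grad_bound (\<lambda>p. smax d (u p) (v p)) C"
  unfolding grad_bound_def
proof (intro ballI allI)
  fix c p z assume c: "c \<in> A" "p \<in> chart_dom c"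
  obtain \<theta> where \<theta>: "\<theta> \<in> {0..1}" "\<And>z. dir_deriv (\<lambda>y. smax d (u (chart_inv c y)) (v (chart_inv c y))) (coord c p) z
     = (1 - \<theta>) * dir_deriv (\<lambda>y. u (chart_inv c y)) (coord c p) z + \<theta> * dir_deriv (\<lambda>y. v (chart_inv c y)) (coord c p) z"
    using dir_deriv_smax[OF assms(5) chart_comp_differentiable[OF assms(1) c] chart_comp_differentiable[OF assms(2) c]] by blast
  show "\<bar>dir_deriv (\<lambda>y. smax d (u (chart_inv c y)) (v (chart_inv c y))) (coord c p) z\<bar> \<le> C * sqrt (z \<bullet> (g c p *v z))"
    unfolding \<theta>(2) by (rule abs_convex_bound[OF grad_boundD[OF assms(3) c] grad_boundD[OF assms(4) c] \<theta>(1)])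
qed

text \<open>The pointwise supremum of these functions plays the role of the distance to infinity.\<close>

definition subsolutions :: "('a \<Rightarrow> real) set" where
  "subsolutions = {u. smooth_fun A u \<and> grad_bound u 1 \<and> compact (closure {p. u p > 0})}"

lemma subsolutions_smax:
  assumes "u \<in> subsolutions" "v \<in> subsolutions" "d > 0"
  shows "(\<lambda>p. smax d (u p) (v p)) \<in> subsolutions"
proof -
  have "{p. smax d (u p) (v p) > 0} \<subseteq> {p. u p > 0} \<union> {p. v p > 0}"
  proof
    fix p assume "p \<in> {p. smax d (u p) (v p) > 0}"
    then have "max (u p) (v p) > 0" using smax_bounds(3)[OF assms(3), of "u p" "v p"] by simp
    then show "p \<in> {p. u p > 0} \<union> {p. v p > 0}" by (auto simp: less_max_iff_disj)
  qed
  then have "closure {p. smax d (u p) (v p) > 0} \<subseteq> closure {p. u p > 0} \<union> closure {p. v p > 0}"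
    by (metis closure_Un closure_mono)
  moreover have "compact (closure {p. u p > 0} \<union> closure {p. v p > 0})"
    using assms unfolding subsolutions_def by (intro compact_Un) auto
  ultimately have "compact (closure {p. smax d (u p) (v p) > 0})"
    by (metis closed_closure closed_Int_compact inf.absorb1)
  then show ?thesis
    using assms smooth_fun_smax grad_bound_smax unfolding subsolutions_def by blast
qed

lemma zero_subsolution: "(\<lambda>p. 0) \<in> subsolutions"
  unfolding subsolutions_def grad_bound_def using smooth_fun_const[of 0]
  by (auto simp: dir_deriv_const g_nonneg)

text \<open>\<open>smax d\<close> never falls below its first argument and loses \<open>d\<close>
  only on the second, so the loss does not accumulate along the induction.\<close>

lemma subsolutions_finite:
  assumes "finite I" "I \<subseteq> subsolutions" "d > 0"
  shows "\<exists>u\<in>subsolutions. \<forall>v\<in>I. \<forall>p. v p - d \<le> u p"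
  using assms
proof (induction I rule: finite_induct)
  case empty
  then show ?case using zero_subsolution by blast
next
  case (insert v I)
  then obtain u where u: "u \<in> subsolutions" "\<forall>v\<in>I. \<forall>p. v p - d \<le> u p" by blast
  have "(\<lambda>p. smax d (u p) (v p)) \<in> subsolutions"
    using subsolutions_smax u(1) insert.prems by blast
  moreover have "w p - d \<le> smax d (u p) (v p)" if "w \<in> insert v I" for w p
    using that u(2) smax_bounds(1,2)[OF insert.prems(2)] by (metis insertE order_trans)
  ultimately show ?case by (intro bexI[of _ "\<lambda>p. smax d (u p) (v p)"] ballI allI)
qed

text \<open>The points over \<open>X\<close> and the complement of the image of \<open>K\<close>
  form an open cover, the latter being open because compact sets in a Hausdorff space are closed. On
  the first set the glued function is \<open>w\<close> in coordinates, on the second it is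
  \<open>u\<close>.\<close>

lemma smooth_fun_patch:
  assumes c: "c \<in> A" and X: "open X" "X \<subseteq> chart_img c" and K: "compact K" "K \<subseteq> X"
    and u: "smooth_fun A u" and w: "smooth_on X w" and eq: "\<And>x. x \<in> X - K \<Longrightarrow> w x = u (chart_inv c x)"
  defines "h \<equiv> \<lambda>q. if q \<in> chart_dom c \<and> coord c q \<in> X then w (coord c q) else u q"
  shows "smooth_fun A h"
    and "grad_bound u C \<Longrightarrow> (\<And>x z. x \<in> X \<Longrightarrow> \<bar>dir_deriv w x z\<bar> \<le> C * sqrt (z \<bullet> (g c (chart_inv c x) *v z))) \<Longrightarrow> grad_bound h C"
proof -
  define V where "V = {q \<in> chart_dom c. coord c q \<in> X}"
  have V: "open V" unfolding V_def by (rule open_chart_preimage[OF c X(1)])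
  have cV: "coord c ` V = X"
    using X(2) coord_chart_inv[OF c] chart_inv_in[OF c] by (force simp: V_def)
  define V' where "V' = - chart_inv c ` K"
  have "compact (chart_inv c ` K)"
    by (rule compact_continuous_image[OF continuous_on_subset[OF cont_chart_inv[OF c]] K(1)]) (use K X in blast)
  then have V': "open V'" unfolding V'_def by (simp add: compact_imp_closed open_Compl)
  have hV': "h q = u q" if "q \<in> V'" for q
  proof (cases "q \<in> V")
    case True
    then have "coord c q \<notin> K" using that chart_inv_coord[OF c] by (force simp: V_def V'_def)
    then show ?thesis using True eq[of "coord c q"] by (simp add: h_def V_def chart_inv_coord[OF c])
  qed (auto simp: h_def V_def)
  have hV: "h (chart_inv c x) = w x" if "x \<in> X" for x
    using that X(2) coord_chart_inv[OF c] chart_inv_in[OF c] by (auto simp: h_def)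
  have cover: "q \<in> V \<or> q \<in> V'" for q
    using K X coord_chart_inv[OF c] chart_inv_in[OF c] by (force simp: V_def V'_def)
  show sm: "smooth_fun A h"
  proof (rule smooth_funI_chart)
    fix q
    consider "q \<in> V" | "q \<in> V'" using cover by blast
    then show "\<exists>W d. open W \<and> q \<in> W \<and> d \<in> A \<and> W \<subseteq> chart_dom d \<and> smooth_on (coord d ` W) (\<lambda>x. h (chart_inv d x))"
    proof cases
      case 1
      have "smooth_on X (\<lambda>x. h (chart_inv c x))"
        using smooth_on_cong[OF X(1), of "\<lambda>x. h (chart_inv c x)" w] hV w by blast
      then show ?thesis using 1 V c cV by (intro exI[of _ V] exI[of _ c]) (auto simp: V_def)
    next
      case 2
      obtain d where d: "d \<in> A" "q \<in> chart_dom d" using ex_chart by blast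
      let ?W = "chart_dom d \<inter> V'"
      have oW: "open (coord d ` ?W)" by (rule open_coord_image[OF d(1) V'])
      have "smooth_on (coord d ` ?W) (\<lambda>x. u (chart_inv d x))"
        by (rule smooth_on_subset[OF smooth_fun_comp[OF u d(1)]]) blast
      then have "smooth_on (coord d ` ?W) (\<lambda>x. h (chart_inv d x))"
      proof (rule smooth_on_cong[THEN iffD2, OF oW, rotated])
        show "h (chart_inv d x) = u (chart_inv d x)" if "x \<in> coord d ` ?W" for x
          using that hV' by (auto simp: chart_inv_coord[OF d(1)])
      qed
      then show ?thesis using d 2 V' open_dom[OF d(1)] by (intro exI[of _ ?W] exI[of _ d]) auto
    qed
  qed
  assume gb: "grad_bound u C" and wb: "\<And>x z. x \<in> X \<Longrightarrow> \<bar>dir_deriv w x z\<bar> \<le> C * sqrt (z \<bullet> (g c (chart_inv c x) *v z))"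
  show "grad_bound h C"
  proof (rule grad_boundI[OF sm])
    fix q
    consider "q \<in> V" | "q \<in> V'" using cover by blast
    then show "\<exists>d\<in>A. q \<in> chart_dom d \<and> (\<forall>v. \<bar>dir_deriv (\<lambda>x. h (chart_inv d x)) (coord d q) v\<bar> \<le> C * sqrt (v \<bullet> (g d q *v v)))"
    proof cases
      case 1
      then have q: "q \<in> chart_dom c" "coord c q \<in> X" by (auto simp: V_def)
      have "dir_deriv (\<lambda>x. h (chart_inv c x)) (coord c q) v = dir_deriv w (coord c q) v" for v
        by (rule dir_deriv_cong_open[OF X(1) q(2) hV])
      then show ?thesis using wb[OF q(2)] q c by (intro bexI[of _ c]) (auto simp: chart_inv_coord)
    next
      case 2
      obtain d where d: "d \<in> A" "q \<in> chart_dom d" using ex_chart by blast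
      let ?W = "chart_dom d \<inter> V'"
      have oW: "open (coord d ` ?W)" by (rule open_coord_image[OF d(1) V'])
      have "dir_deriv (\<lambda>x. h (chart_inv d x)) (coord d q) v = dir_deriv (\<lambda>x. u (chart_inv d x)) (coord d q) v" for v
        by (rule dir_deriv_cong_open[OF oW]) (use 2 d hV' in \<open>auto simp: chart_inv_coord[OF d(1)]\<close>)
      then show ?thesis using grad_boundD[OF gb d] d by (intro bexI[of _ d]) auto
    qed
  qed
qed

end

section \<open>Comparison with a frozen metric; bump functions\<close>

lemma posdef_cauchy_schwarz:
  fixes M :: "real^'n::finite^'n"
  assumes sym: "\<And>v w. v \<bullet> (M *v w) = w \<bullet> (M *v v)" and pos: "\<And>v. v \<noteq> 0 \<Longrightarrow> v \<bullet> (M *v v) > 0"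
  shows "(u \<bullet> (M *v v))\<^sup>2 \<le> (u \<bullet> (M *v u)) * (v \<bullet> (M *v v))"
proof (cases "v = 0")
  case False
  define b where "b = v \<bullet> (M *v v)"
  define t where "t = (u \<bullet> (M *v v)) / b"
  have b: "b > 0" using pos[OF False] by (simp add: b_def)
  have "0 \<le> (u - t *\<^sub>R v) \<bullet> (M *v (u - t *\<^sub>R v))"
    using pos[of "u - t *\<^sub>R v"] by (cases "u - t *\<^sub>R v = 0") auto
  also have "\<dots> = u \<bullet> (M *v u) - 2 * t * (u \<bullet> (M *v v)) + t * t * b"
    unfolding mv_diff_right mv_scaleR_right b_def
    by (simp add: inner_diff_left inner_diff_right sym[of v u] algebra_simps)
  also have "\<dots> = u \<bullet> (M *v u) - (u \<bullet> (M *v v))\<^sup>2 / b"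
    using b by (simp add: t_def power2_eq_square field_simps)
  finally have "(u \<bullet> (M *v v))\<^sup>2 / b \<le> u \<bullet> (M *v u)" by simp
  then show ?thesis using b unfolding b_def[symmetric] by (simp add: pos_divide_le_eq)
qed simp

lemma posdef_parallelogram:
  fixes M :: "real^'n::finite^'n"
  assumes pos: "\<And>v. v \<noteq> 0 \<Longrightarrow> v \<bullet> (M *v v) > 0"
  shows "(u - v) \<bullet> (M *v (u - v)) \<le> 2 * (u \<bullet> (M *v u)) + 2 * (v \<bullet> (M *v v))"
proof -
  have "0 \<le> (u + v) \<bullet> (M *v (u + v))"
    using pos[of "u + v"] by (cases "u + v = 0") auto
  then show ?thesis
    unfolding mv_diff_right mv_add_right by (simp add: inner_diff_left inner_diff_right inner_add_left inner_add_right)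
qed

context riemannian_manifold
begin

text \<open>On the unit sphere the form at \<open>x0\<close> has a positive minimum
  \<open>a\<close>, so closeness of the matrices becomes comparability of the forms. The argument
  gives factors 1/2 and 3/2; they are rounded to 1/4 and 4, so that lengths change by a factor of at
  most 2.\<close>

lemma metric_near:
  assumes c: "c \<in> A" and x0: "x0 \<in> chart_img c" and W: "open W" "x0 \<in> W"
  shows "\<exists>a>0. \<exists>\<rho>>0. cball x0 \<rho> \<subseteq> chart_img c \<inter> W \<and>
    (\<forall>v. a * (norm v)\<^sup>2 \<le> v \<bullet> (g c (chart_inv c x0) *v v)) \<and>
    (\<forall>x\<in>cball x0 \<rho>. \<forall>v. v \<bullet> (g c (chart_inv c x0) *v v) / 4 \<le> v \<bullet> (g c (chart_inv c x) *v v) \<and>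
       v \<bullet> (g c (chart_inv c x) *v v) \<le> 4 * (v \<bullet> (g c (chart_inv c x0) *v v)))"
proof -
  let ?G = "\<lambda>x. g c (chart_inv c x)" and ?Q = "g c (chart_inv c x0)"
  have pos: "v \<noteq> 0 \<Longrightarrow> v \<bullet> (?Q *v v) > 0" for v using g_pos[OF c chart_inv_in[OF c x0]] .
  have co: "continuous_on UNIV (\<lambda>v. v \<bullet> (?Q *v v))"
    by (intro continuous_intros matrix_vector_mult_linear_continuous_on)
  have "sphere (0::real^'n) 1 \<noteq> {}" by simp
  then obtain v0 where v0: "v0 \<in> sphere (0::real^'n) 1" "\<And>v. v \<in> sphere 0 1 \<Longrightarrow> v0 \<bullet> (?Q *v v0) \<le> v \<bullet> (?Q *v v)"
    using continuous_attains_inf[OF compact_sphere _ continuous_on_subset[OF co]] by (metis subset_UNIV)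
  define a where "a = v0 \<bullet> (?Q *v v0)"
  have a: "a > 0" using v0(1) pos[of v0] unfolding a_def by (metis mem_sphere_0 norm_zero zero_neq_one)
  have low: "a * (norm v)\<^sup>2 \<le> v \<bullet> (?Q *v v)" for v
  proof (cases "v = 0")
    case False
    define u where "u = (1 / norm v) *\<^sub>R v"
    have v: "v = norm v *\<^sub>R u" "u \<in> sphere 0 1" using False by (auto simp: u_def)
    have "v \<bullet> (?Q *v v) = (norm v *\<^sub>R u) \<bullet> (?Q *v (norm v *\<^sub>R u))" using v(1) by metis
    also have "\<dots> = (norm v)\<^sup>2 * (u \<bullet> (?Q *v u))"
      unfolding mv_scaleR_right by (simp add: power2_eq_square)
    finally show ?thesis using v0(2)[OF v(2)] by (simp add: a_def mult.commute mult_left_mono)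
  qed simp
  obtain K where K: "K > 0" "\<And>(M::real^'n^'n) v. norm (M *v v) \<le> norm M * norm v * K"
    using bounded_bilinear.pos_bounded[OF bounded_bilinear_matrix_vector_mult[where 'n = 'n and 'm = 'n]] by blast
  have "isCont ?G x0"
    using smooth_on_imp_continuous_on[OF g_smooth[OF c]] x0
    unfolding continuous_on_eq_continuous_at[OF open_img[OF c]] by blast
  \<comment> \<open>This threshold makes the error at most \<open>a * (norm v)^2 / 2\<close>, hence
    at most half of the form at \<open>x0\<close>.\<close>
  then obtain d where d: "d > 0" "\<And>x. dist x x0 < d \<Longrightarrow> dist (?G x) ?Q < a / (2 * K)"
    using a K(1) unfolding continuous_at_eps_delta by (metis divide_pos_pos mult_pos_pos zero_less_numeral)
  have "open (chart_img c \<inter> W)" using open_img[OF c] W by auto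
  then obtain e where e: "e > 0" "cball x0 e \<subseteq> chart_img c \<inter> W"
    using x0 W open_contains_cball by blast
  define \<rho> where "\<rho> = min (d / 2) e"
  have \<rho>: "\<rho> > 0" using d e by (simp add: \<rho>_def)
  have near: "\<bar>v \<bullet> (?G x *v v) - v \<bullet> (?Q *v v)\<bar> \<le> (v \<bullet> (?Q *v v)) / 2" if x: "x \<in> cball x0 \<rho>" for x v
  proof -
    have "dist x x0 < d" using x d by (auto simp: \<rho>_def dist_commute)
    then have n: "norm (?G x - ?Q) \<le> a / (2 * K)" using d(2) by (simp add: dist_norm less_imp_le)
    have "\<bar>v \<bullet> (?G x *v v) - v \<bullet> (?Q *v v)\<bar> = \<bar>v \<bullet> ((?G x - ?Q) *v v)\<bar>"
      by (simp only: mv_diff_left inner_diff_right)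
    also have "\<dots> \<le> norm v * (norm (?G x - ?Q) * norm v * K)"
      by (rule order_trans[OF Cauchy_Schwarz_ineq2]) (intro mult_left_mono K(2) norm_ge_zero)
    also have "\<dots> \<le> norm v * (a / (2 * K) * norm v * K)"
      using n K(1) by (intro mult_left_mono mult_right_mono) auto
    also have "\<dots> = (a * (norm v)\<^sup>2) / 2" using K(1) by (simp add: power2_eq_square)
    also have "\<dots> \<le> (v \<bullet> (?Q *v v)) / 2" using low[of v] by simp
    finally show ?thesis .
  qed
  have nn: "0 \<le> v \<bullet> (?Q *v v)" for v using pos[of v] by (cases "v = 0") auto
  have "v \<bullet> (?Q *v v) / 4 \<le> v \<bullet> (?G x *v v) \<and> v \<bullet> (?G x *v v) \<le> 4 * (v \<bullet> (?Q *v v))"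
    if "x \<in> cball x0 \<rho>" for x v
    using abs_le_D1[OF near[OF that, of v]] abs_le_D2[OF near[OF that, of v]] nn[of v]
    by (intro conjI) linarith+
  moreover have "cball x0 \<rho> \<subseteq> chart_img c \<inter> W" using e(2) subset_cball[of \<rho> e x0] by (auto simp: \<rho>_def)
  ultimately show ?thesis using a \<rho> low by blast
qed

text \<open>Its purpose is topological: a Lipschitz function that is positive at \<open>p\<close>
  and zero off \<open>W\<close> shows that points close to \<open>p\<close> in
  \<open>riem_dist\<close> lie in \<open>W\<close>.\<close>

lemma bump_function:
  assumes W: "open W" "p \<in> W"
  shows "\<exists>u C. smooth_fun A u \<and> C > 0 \<and> grad_bound u C \<and> u p > 0 \<and> (\<forall>q. q \<notin> W \<longrightarrow> u q = 0)"
proof -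
  obtain c where c: "c \<in> A" "p \<in> chart_dom c" using ex_chart by blast
  define x0 where "x0 = coord c p"
  let ?W = "coord c ` (chart_dom c \<inter> W)"
  have x0: "x0 \<in> chart_img c" "x0 \<in> ?W" using c W by (auto simp: x0_def)
  obtain a \<rho> where a: "a > 0" and \<rho>: "\<rho> > 0" and cb: "cball x0 \<rho> \<subseteq> chart_img c \<inter> ?W"
    and low: "\<And>v. a * (norm v)\<^sup>2 \<le> v \<bullet> (g c (chart_inv c x0) *v v)"
    and near: "\<And>x v. x \<in> cball x0 \<rho> \<Longrightarrow> v \<bullet> (g c (chart_inv c x0) *v v) / 4 \<le> v \<bullet> (g c (chart_inv c x) *v v)"
    using metric_near[OF c(1) x0(1) open_coord_image[OF c(1) W(1)] x0(2)] by blast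
  \<comment> \<open>Positive exactly on the open ball of radius \<open>\<rho> / 2\<close>, which
    leaves a margin inside the ball of radius \<open>\<rho>\<close> for the gluing.\<close>
  define w where "w = (\<lambda>x. flat 1 (\<rho>\<^sup>2 / 4 - (x - x0) \<bullet> (x - x0)))"
  have smw: "smooth_on UNIV w"
    unfolding w_def
    by (intro smooth_on_flat_softplus(1) smooth_on_diff smooth_on_inner smooth_on_const smooth_on_ident open_UNIV)
  have sq: "(x - x0) \<bullet> (x - x0) = (dist x0 x)\<^sup>2" for x
    by (metis dist_norm dist_commute power2_norm_eq_inner)
  have w0: "w x = 0" if "x \<notin> cball x0 (\<rho> / 2)" for x
  proof -
    have "\<rho> / 2 \<le> dist x0 x" using that by simp
    then have "(\<rho> / 2)\<^sup>2 \<le> (dist x0 x)\<^sup>2" using \<rho> by (intro power_mono) auto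
    then show ?thesis by (simp add: w_def flat_def sq power_divide)
  qed
  have "continuous_on (cball x0 \<rho>) (\<lambda>x. \<Sum>k\<in>UNIV. \<bar>pd k w x\<bar>)"
    by (intro continuous_on_sum continuous_on_rabs continuous_on_subset[OF smooth_on_imp_continuous_on[OF smooth_on_pd[OF smw]]]) simp
  then obtain xm where xm: "\<And>x. x \<in> cball x0 \<rho> \<Longrightarrow> (\<Sum>k\<in>UNIV. \<bar>pd k w x\<bar>) \<le> (\<Sum>k\<in>UNIV. \<bar>pd k w xm\<bar>)"
    using continuous_attains_sup[of "cball x0 \<rho>"] \<rho> by (metis cball_eq_empty compact_cball less_le_not_le)
  define M where "M = (\<Sum>k\<in>UNIV. \<bar>pd k w xm\<bar>)"
  \<comment> \<open>\<open>M\<close> bounds the coordinate derivatives, and \<open>a / 4\<close> is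
    the lower bound of the metric on the ball; adding 1 keeps \<open>C\<close> positive.\<close>
  define C where "C = (M + 1) / sqrt (a / 4)"
  have M: "M \<ge> 0" unfolding M_def by (intro sum_nonneg) auto
  have C: "C > 0" using M a by (simp add: C_def)
  have wb: "\<bar>dir_deriv w x z\<bar> \<le> C * sqrt (z \<bullet> (g c (chart_inv c x) *v z))" if x: "x \<in> ball x0 \<rho>" for x z
  proof -
    have x': "x \<in> cball x0 \<rho>" using x by simp
    have "\<bar>dir_deriv w x z\<bar> \<le> (\<Sum>k\<in>UNIV. \<bar>z $ k * pd k w x\<bar>)" unfolding dir_deriv_def by (rule sum_abs)
    also have "\<dots> \<le> (\<Sum>k\<in>UNIV. norm z * \<bar>pd k w x\<bar>)"
      by (intro sum_mono) (simp add: abs_mult component_le_norm_cart mult_right_mono)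
    also have "\<dots> = norm z * (\<Sum>k\<in>UNIV. \<bar>pd k w x\<bar>)" by (simp add: sum_distrib_left)
    also have "\<dots> \<le> norm z * (M + 1)" using xm[OF x'] by (intro mult_left_mono) (auto simp: M_def)
    also have "\<dots> = C * (sqrt (a / 4) * norm z)" using a by (simp add: C_def)
    also have "\<dots> \<le> C * sqrt (z \<bullet> (g c (chart_inv c x) *v z))"
    proof (rule mult_left_mono)
      have "(a / 4) * (norm z)\<^sup>2 \<le> z \<bullet> (g c (chart_inv c x) *v z)"
        using near[OF x', of z] low[of z] by simp
      then have "sqrt ((a / 4) * (norm z)\<^sup>2) \<le> sqrt (z \<bullet> (g c (chart_inv c x) *v z))" by (rule real_sqrt_le_mono)
      then show "sqrt (a / 4) * norm z \<le> sqrt (z \<bullet> (g c (chart_inv c x) *v z))"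
        unfolding real_sqrt_mult real_sqrt_abs abs_norm_cancel .
    qed (use C in simp)
    finally show ?thesis .
  qed
  let ?h = "\<lambda>q. if q \<in> chart_dom c \<and> coord c q \<in> ball x0 \<rho> then w (coord c q) else 0"
  have bX: "ball x0 \<rho> \<subseteq> chart_img c" using cb ball_subset_cball by blast
  have cK: "cball x0 (\<rho> / 2) \<subseteq> ball x0 \<rho>" using \<rho> by auto
  have ws: "smooth_on (ball x0 \<rho>) w" by (rule smooth_on_subset[OF smw]) simp
  have w0': "w x = 0" if "x \<in> ball x0 \<rho> - cball x0 (\<rho> / 2)" for x using w0 that by blast
  have g0: "grad_bound (\<lambda>p. 0) C" using C unfolding grad_bound_def by (auto simp: dir_deriv_const g_nonneg)
  have sm: "smooth_fun A ?h"
    by (rule smooth_fun_patch(1)[OF c(1) open_ball bX compact_cball cK smooth_fun_const ws w0'])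
  have gb: "grad_bound ?h C"
    by (rule smooth_fun_patch(2)[OF c(1) open_ball bX compact_cball cK smooth_fun_const ws w0' g0 wb])
  have "?h p > 0"
    using c \<rho> by (simp add: x0_def[symmetric] w_def flat_def)
  moreover have "?h q = 0" if "q \<notin> W" for q
  proof -
    have "coord c q \<notin> ball x0 \<rho>" if q: "q \<in> chart_dom c"
    proof
      assume "coord c q \<in> ball x0 \<rho>"
      then have "coord c q \<in> ?W" using cb ball_subset_cball by blast
      then have "q \<in> W" unfolding coord_image_iff[OF c(1)] using chart_inv_coord[OF c(1) q] by simp
      then show False using \<open>q \<notin> W\<close> by blast
    qed
    then show ?thesis by auto
  qed
  ultimately show ?thesis using sm gb C by blast
qed

lemma riem_dist_tendsto_eventually:
  assumes lim: "(\<lambda>k. riem_dist A g (x k) p) \<longlonglongrightarrow> 0" and W: "open W" "p \<in> W"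
  shows "\<forall>\<^sub>F k in sequentially. x k \<in> W"
proof -
  obtain u C where u: "smooth_fun A u" "C > 0" "grad_bound u C" "u p > 0" "\<And>q. q \<notin> W \<Longrightarrow> u q = 0"
    using bump_function[OF W] by blast
  \<comment> \<open>Within this distance \<open>u\<close> loses at most half of its value at
    \<open>p\<close>.\<close>
  define e where "e = u p / (2 * C)"
  have e: "e > 0" using u by (simp add: e_def)
  have "\<forall>\<^sub>F k in sequentially. riem_dist A g (x k) p < ennreal e"
    using order_tendstoD(2)[OF lim, of "ennreal e"] e by simp
  then show ?thesis
  proof (rule eventually_mono)
    fix k assume "riem_dist A g (x k) p < ennreal e"
    then have "\<bar>u p - u (x k)\<bar> \<le> C * e"
      using lipschitz_riem_dist[OF u(1,3,2)] e by (simp add: less_imp_le)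
    also have "C * e = u p / 2" using u(2) by (simp add: e_def)
    finally have "u (x k) \<noteq> 0" using u(4) by auto
    then show "x k \<in> W" using u(5) by blast
  qed
qed

section \<open>The supremum \<open>D\<close> and Ekeland's principle\<close>

definition sup_subsolution :: "'a \<Rightarrow> real" where
  "sup_subsolution q = (SUP u\<in>subsolutions. u q)"

text \<open>A real-valued \<open>SUP\<close> carries information only for bounded families, so
  finiteness of \<open>D\<close> at a point is a separate predicate.\<close>

definition finite_at :: "'a \<Rightarrow> bool" where
  "finite_at q \<longleftrightarrow> bdd_above ((\<lambda>u. u q) ` subsolutions)"

lemma sup_subsolution_upper: "finite_at q \<Longrightarrow> u \<in> subsolutions \<Longrightarrow> u q \<le> sup_subsolution q"
  unfolding finite_at_def sup_subsolution_def by (rule cSUP_upper)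

lemma sup_subsolution_nonneg: "finite_at q \<Longrightarrow> 0 \<le> sup_subsolution q"
  using sup_subsolution_upper[OF _ zero_subsolution] by simp

lemma sup_subsolution_approx: "finite_at q \<Longrightarrow> y < sup_subsolution q \<Longrightarrow> \<exists>u\<in>subsolutions. y < u q"
  unfolding finite_at_def sup_subsolution_def using less_cSUP_iff zero_subsolution by (metis empty_iff)

text \<open>\<open>L\<close> is uniform over the whole family, so adding it to an upper bound at one
  point gives an upper bound at the other.\<close>

lemma finite_at_close:
  assumes q: "finite_at q" and L: "\<And>u. u \<in> subsolutions \<Longrightarrow> \<bar>u r - u q\<bar> \<le> L"
  shows "finite_at r" "\<bar>sup_subsolution r - sup_subsolution q\<bar> \<le> L"
proof -
  have ne: "subsolutions \<noteq> {}" using zero_subsolution by blast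
  have 1: "u r \<le> sup_subsolution q + L" if "u \<in> subsolutions" for u
    using L[OF that] sup_subsolution_upper[OF q that] by linarith
  show r: "finite_at r" unfolding finite_at_def by (rule bdd_aboveI2[of _ _ "sup_subsolution q + L"]) (rule 1)
  have "sup_subsolution r \<le> sup_subsolution q + L"
    unfolding sup_subsolution_def[of r] by (rule cSUP_least[OF ne 1])
  moreover have "sup_subsolution q \<le> sup_subsolution r + L"
    unfolding sup_subsolution_def[of q]
  proof (rule cSUP_least[OF ne])
    fix u assume "u \<in> subsolutions"
    then show "u q \<le> sup_subsolution r + L" using L[of u] sup_subsolution_upper[OF r, of u] by linarith
  qed
  ultimately show "\<bar>sup_subsolution r - sup_subsolution q\<bar> \<le> L" by linarith
qed

lemma finite_at_reach:
  assumes "finite_at q" "reach L q r"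
  shows "finite_at r" "\<bar>sup_subsolution r - sup_subsolution q\<bar> \<le> L"
proof -
  have L: "\<bar>u r - u q\<bar> \<le> L" if "u \<in> subsolutions" for u
    using lipschitz_reach[of u 1 L q r] that assms(2) unfolding subsolutions_def by simp
  show "finite_at r" "\<bar>sup_subsolution r - sup_subsolution q\<bar> \<le> L"
    using finite_at_close[where q = q and r = r and L = L, OF assms(1) L] by auto
qed

text \<open>Each step of the sequence realises at least half of the possible decrease of \<open>D\<close> among the points
  that are reachable at a rate of decrease of at least \<open>1/100\<close>.\<close>

lemma ekeland_sequence:
  assumes complete: "riem_complete A g" and fin: "finite_at p0"
  shows "\<exists>x p. (\<forall>k. finite_at (x k)) \<and> (\<lambda>k. riem_dist A g (x k) p) \<longlonglongrightarrow> 0 \<and>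
    (\<forall>k s. reach (100 * (sup_subsolution (x k) - sup_subsolution s)) (x k) s \<longrightarrow> (sup_subsolution (x k) - sup_subsolution s) / 2 \<le> sup_subsolution (x k) - sup_subsolution (x (Suc k))) \<and>
    (\<lambda>k. sup_subsolution (x k) - sup_subsolution (x (Suc k))) \<longlonglongrightarrow> 0"
proof -
  let ?R = "\<lambda>q s. reach (100 * (sup_subsolution q - sup_subsolution s)) q s"
  have step: "\<exists>y. ?R q y \<and> (\<forall>s. ?R q s \<longrightarrow> (sup_subsolution q - sup_subsolution s) / 2 \<le> sup_subsolution q - sup_subsolution y)" if q: "finite_at q" for q
  proof -
    let ?T = "sup_subsolution ` {s. ?R q s}"
    have bb: "bdd_below ?T"
      by (rule bdd_belowI2[of _ 0]) (use sup_subsolution_nonneg finite_at_reach(1)[OF q] in blast)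
    have qT: "?R q q" by (rule reach_refl) simp
    define m where "m = Inf ?T"
    have m: "m \<le> sup_subsolution s" if "?R q s" for s unfolding m_def by (rule cInf_lower[OF _ bb]) (use that in blast)
    show ?thesis
    \<comment> \<open>If the infimum \<open>m\<close> equals \<open>D q\<close>, staying at
      \<open>q\<close> is optimal. Otherwise a candidate below the midpoint of \<open>m\<close> and
      \<open>D q\<close> realises half of the possible decrease.\<close>
    proof (cases "m = sup_subsolution q")
      case True
      have "(sup_subsolution q - sup_subsolution s) / 2 \<le> sup_subsolution q - sup_subsolution q" if "?R q s" for s using m[OF that] True by simp
      then show ?thesis using qT by blast
    next
      case False
      then have "m < (sup_subsolution q + m) / 2" using m[OF qT] by simp
      then obtain y where y: "?R q y" "sup_subsolution y < (sup_subsolution q + m) / 2"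
        using cInf_less_iff[of ?T "(sup_subsolution q + m) / 2"] bb qT unfolding m_def by blast
      have "(sup_subsolution q - sup_subsolution s) / 2 \<le> sup_subsolution q - sup_subsolution y" if "?R q s" for s using m[OF that] y(2) by (simp add: field_simps)
      then show ?thesis using y(1) by blast
    qed
  qed
  obtain x where x0: "x 0 = p0" and xf: "\<And>k. finite_at (x k)"
    and xs: "\<And>k. ?R (x k) (x (Suc k)) \<and> (\<forall>s. ?R (x k) s \<longrightarrow> (sup_subsolution (x k) - sup_subsolution s) / 2 \<le> sup_subsolution (x k) - sup_subsolution (x (Suc k)))"
  proof -
    have "\<exists>x. \<forall>k. finite_at (x k) \<and> (k = 0 \<longrightarrow> x k = p0) \<and> (?R (x k) (x (Suc k)) \<and> (\<forall>s. ?R (x k) s \<longrightarrow> (sup_subsolution (x k) - sup_subsolution s) / 2 \<le> sup_subsolution (x k) - sup_subsolution (x (Suc k))))"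
    proof -
      have "\<exists>x. \<forall>k. (finite_at (x k) \<and> (k = 0 \<longrightarrow> x k = p0)) \<and> (?R (x k) (x (Suc k)) \<and> (\<forall>s. ?R (x k) s \<longrightarrow> (sup_subsolution (x k) - sup_subsolution s) / 2 \<le> sup_subsolution (x k) - sup_subsolution (x (Suc k))))"
      proof (rule dependent_nat_choice[where P = "\<lambda>(k::nat) q. finite_at q \<and> (k = 0 \<longrightarrow> q = p0)"
            and Q = "\<lambda>_ q y. ?R q y \<and> (\<forall>s. ?R q s \<longrightarrow> (sup_subsolution q - sup_subsolution s) / 2 \<le> sup_subsolution q - sup_subsolution y)"])
        show "\<exists>q. finite_at q \<and> ((0::nat) = 0 \<longrightarrow> q = p0)" using fin by blast
        fix q and k :: nat assume q: "finite_at q \<and> (k = 0 \<longrightarrow> q = p0)"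
        then obtain y where y: "?R q y" "\<forall>s. ?R q s \<longrightarrow> (sup_subsolution q - sup_subsolution s) / 2 \<le> sup_subsolution q - sup_subsolution y" using step by blast
        have "finite_at y" using finite_at_reach(1)[of q] q y(1) by blast
        then show "\<exists>y. (finite_at y \<and> (Suc k = 0 \<longrightarrow> y = p0)) \<and> ?R q y \<and> (\<forall>s. ?R q s \<longrightarrow> (sup_subsolution q - sup_subsolution s) / 2 \<le> sup_subsolution q - sup_subsolution y)"
          using y by (intro exI[of _ y]) simp
      qed
      then show ?thesis by (simp add: conj_assoc)
    qed
    then show ?thesis using that by metis
  qed
  have dec: "decseq (\<lambda>k. sup_subsolution (x k))"
    by (rule decseq_SucI) (use xs in \<open>auto simp: reach_def\<close>)
  obtain l where l: "(\<lambda>k. sup_subsolution (x k)) \<longlonglongrightarrow> l"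
    using decseq_convergent[OF dec, of 0] sup_subsolution_nonneg xf by blast
  \<comment> \<open>Lengths add up under concatenation while the decreases of \<open>D\<close>
    telescope, so the relation between neighbours extends to all later terms.\<close>
  have chain: "reach (100 * (sup_subsolution (x i) - sup_subsolution (x (i + j)))) (x i) (x (i + j))" for i j
  proof (induction j)
    case 0
    then show ?case by (simp add: reach_refl)
  next
    case (Suc j)
    have "reach (100 * (sup_subsolution (x i) - sup_subsolution (x (i + j))) + 100 * (sup_subsolution (x (i + j)) - sup_subsolution (x (Suc (i + j))))) (x i) (x (Suc (i + j)))"
      using reach_trans[OF Suc] xs by blast
    then show ?case by (simp add: algebra_simps)
  qed
  have "\<exists>p. (\<lambda>k. riem_dist A g (x k) p) \<longlonglongrightarrow> 0"
  proof (rule complete[unfolded riem_complete_def, rule_format])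
    fix e :: real assume e: "e > 0"
    have "Cauchy (\<lambda>k. sup_subsolution (x k))" using l by (intro convergent_Cauchy convergentI)
    \<comment> \<open>The factor 100 in \<open>?R\<close> turns a variation \<open>e / 200\<close>
      of \<open>D\<close> into a length \<open>e / 2\<close>.\<close>
    then obtain N where N: "\<And>i j. i \<ge> N \<Longrightarrow> j \<ge> N \<Longrightarrow> \<bar>sup_subsolution (x i) - sup_subsolution (x j)\<bar> < e / 200"
      using e unfolding Cauchy_def dist_real_def by (metis divide_pos_pos zero_less_numeral)
    have le: "reach (e / 2) (x i) (x j)" if "i \<ge> N" "i \<le> j" for i j
    proof (rule reach_mono)
      show "reach (100 * (sup_subsolution (x i) - sup_subsolution (x j))) (x i) (x j)" using chain[of i "j - i"] that by simp
      show "100 * (sup_subsolution (x i) - sup_subsolution (x j)) \<le> e / 2"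
        using abs_le_D1[OF less_imp_le[OF N[of i j]]] that by (simp add: field_simps)
    qed
    have "riem_dist A g (x i) (x j) < ennreal e" if "i \<ge> N" "j \<ge> N" for i j
    proof -
      have "reach (e / 2) (x i) (x j)" using le[of i j] le[of j i] reach_sym that by (metis nat_le_linear)
      then have "riem_dist A g (x i) (x j) \<le> ennreal (e / 2)" using reach_riem_dist e by simp
      also have "\<dots> < ennreal e" using e by (simp add: ennreal_less_iff)
      finally show ?thesis .
    qed
    then show "\<exists>N. \<forall>i\<ge>N. \<forall>j\<ge>N. riem_dist A g (x i) (x j) < ennreal e" by blast
  qed
  then obtain p where p: "(\<lambda>k. riem_dist A g (x k) p) \<longlonglongrightarrow> 0" by blast
  have "(\<lambda>k. sup_subsolution (x k) - sup_subsolution (x (Suc k))) \<longlonglongrightarrow> l - l"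
    by (intro tendsto_diff l LIMSEQ_Suc[OF l])
  then show ?thesis using xf p xs by (intro exI[of _ x] exI[of _ p]) simp
qed

end

lemma compact_closure_subset:
  fixes K :: "'a::t2_space set"
  assumes "compact K" "S \<subseteq> K"
  shows "compact (closure S)"
proof -
  have "closure S \<subseteq> K" by (rule closure_minimal[OF assms(2) compact_imp_closed[OF assms(1)]])
  then show ?thesis using closed_Int_compact[OF closed_closure assms(1), of S] by (simp add: inf.absorb1)
qed

section \<open>Unboundedness of \<open>D\<close> and cutoff functions\<close>

context riemannian_manifold
begin

text \<open>On the ellipsoid \<open>E\<close> of radius \<open>r\<close> around \<open>p\<close> we have \<open>D \<ge> D p - r/16\<close>, since otherwise the
  Ekeland sequence would have jumped to a lower point of \<open>E\<close>. The paraboloid \<open>\<eta>\<close> starts \<open>r/100\<close> above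
  \<open>D p\<close> and has dropped by more than \<open>r/5\<close> where it is glued to \<open>u\<close>.\<close>

lemma unbounded_subsolution:
  assumes complete: "riem_complete A g"
  shows "\<exists>u\<in>subsolutions. R \<le> u p0"
proof (rule ccontr)
  assume "\<not> (\<exists>u\<in>subsolutions. R \<le> u p0)"
  then have "finite_at p0" unfolding finite_at_def by (intro bdd_aboveI2[of _ _ R]) force
  from ekeland_sequence[OF complete this] obtain x p where xf: "\<And>k. finite_at (x k)"
    and lim: "(\<lambda>k. riem_dist A g (x k) p) \<longlonglongrightarrow> 0"
    and ek: "\<And>k s. reach (100 * (sup_subsolution (x k) - sup_subsolution s)) (x k) s \<Longrightarrow> (sup_subsolution (x k) - sup_subsolution s) / 2 \<le> sup_subsolution (x k) - sup_subsolution (x (Suc k))"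
    and dd: "(\<lambda>k. sup_subsolution (x k) - sup_subsolution (x (Suc k))) \<longlonglongrightarrow> 0" by blast
  have near_eq: "\<bar>u p - u (x k)\<bar> \<le> e" if "u \<in> subsolutions" "riem_dist A g (x k) p < ennreal e" "e > 0" for u k e
    using lipschitz_riem_dist[of u 1 "x k" p e] that unfolding subsolutions_def by (simp add: less_imp_le)
  have ev: "\<forall>\<^sub>F k in sequentially. riem_dist A g (x k) p < ennreal e" if "e > 0" for e
    using order_tendstoD(2)[OF lim, of "ennreal e"] that by simp
  \<comment> \<open>One term within distance 1 is enough to carry finiteness of \<open>D\<close>
    over to the limit \<open>p\<close>.\<close>
  obtain k1 where "riem_dist A g (x k1) p < ennreal 1"
    using ev[of 1] eventually_happens'[OF sequentially_bot] by auto
  then have fp: "finite_at p"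
    using finite_at_close(1)[where q = "x k1" and r = p and L = 1, OF xf] near_eq[of _ k1 1] by auto
  have Dclose: "\<bar>sup_subsolution p - sup_subsolution (x k)\<bar> \<le> e" if "riem_dist A g (x k) p < ennreal e" "e > 0" for k e
    using finite_at_close(2)[where q = "x k" and r = p and L = e, OF xf] near_eq[of _ k e] that by auto
  obtain c where c: "c \<in> A" "p \<in> chart_dom c" using ex_chart by blast
  define x0 where "x0 = coord c p"
  have x0: "x0 \<in> chart_img c" "chart_inv c x0 = p" using c by (auto simp: x0_def chart_inv_coord)
  define Q where "Q = g c p"
  obtain a \<rho> where a: "a > 0" and \<rho>: "\<rho> > 0" and cb: "cball x0 \<rho> \<subseteq> chart_img c"
    and low: "\<And>v. a * (norm v)\<^sup>2 \<le> v \<bullet> (Q *v v)"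
    and near1: "\<And>x v. x \<in> cball x0 \<rho> \<Longrightarrow> v \<bullet> (Q *v v) / 4 \<le> v \<bullet> (g c (chart_inv c x) *v v)"
    and near2: "\<And>x v. x \<in> cball x0 \<rho> \<Longrightarrow> v \<bullet> (g c (chart_inv c x) *v v) \<le> 4 * (v \<bullet> (Q *v v))"
    using metric_near[OF c(1) x0(1) open_UNIV UNIV_I] unfolding x0(2) Q_def by blast
  have Qpos: "v \<noteq> 0 \<Longrightarrow> v \<bullet> (Q *v v) > 0" for v unfolding Q_def by (rule g_pos[OF c])
  have Qsym: "v \<bullet> (Q *v w) = w \<bullet> (Q *v v)" for v w unfolding Q_def by (rule g_sym[OF c])
  \<comment> \<open>Squared distance from \<open>x0\<close> in the metric frozen at
    \<open>p\<close>: a quadratic polynomial, hence smooth, unlike the Riemannian distance.\<close>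
  define N2 where "N2 y = (y - x0) \<bullet> (Q *v (y - x0))" for y
  have N2_nonneg: "N2 y \<ge> 0" for y unfolding N2_def using Qpos[of "y - x0"] by (cases "y - x0 = 0") auto
  have N2_smooth: "smooth_on UNIV N2"
    unfolding N2_def[abs_def]
    by (intro smooth_on_inner smooth_on_matrix_vector_mult smooth_on_diff smooth_on_ident smooth_on_const open_UNIV)
  have N2_cont: "continuous_on UNIV N2" by (rule smooth_on_imp_continuous_on[OF N2_smooth])
  \<comment> \<open>By the lower bound \<open>a\<close> on \<open>Q\<close>, the ellipsoid
    \<open>N2 \<le> r^2\<close> then lies in the ball of radius \<open>\<rho>\<close>, where
    \<open>g\<close> is comparable to \<open>Q\<close>.\<close>
  define r where "r = sqrt a * \<rho>"
  have r: "r > 0" "r\<^sup>2 = a * \<rho>\<^sup>2" using a \<rho> by (auto simp: r_def power_mult_distrib)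
  define E where "E = {y. N2 y \<le> r\<^sup>2}"
  have E_cb: "E \<subseteq> cball x0 \<rho>"
  proof
    fix y assume "y \<in> E"
    then have "a * (norm (y - x0))\<^sup>2 \<le> a * \<rho>\<^sup>2" using low[of "y - x0"] r(2) by (simp add: E_def N2_def)
    then have "(norm (y - x0))\<^sup>2 \<le> \<rho>\<^sup>2" using a mult_le_cancel_left_pos by blast
    then have "norm (y - x0) \<le> \<rho>" by (rule power2_le_imp_le) (use \<rho> in simp)
    then show "y \<in> cball x0 \<rho>" by (simp add: dist_norm norm_minus_commute)
  qed
  have cl: "closed {y. N2 y \<le> t}" for t
    using continuous_closed_vimage[of "{..t}" N2] N2_cont by (simp add: vimage_def continuous_on_eq_continuous_at)
  have E_compact: "compact E"
    using E_cb cl[of "r\<^sup>2"] unfolding E_def by (metis bounded_cball bounded_subset compact_eq_bounded_closed)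
  have E_img: "E \<subseteq> chart_img c" using E_cb cb by blast
  define X where "X = {y. N2 y < r\<^sup>2}"
  have X: "open X"
    using continuous_open_vimage[of "{..<r\<^sup>2}" N2] N2_cont by (simp add: X_def vimage_def continuous_on_eq_continuous_at)
  have XE: "X \<subseteq> E" by (auto simp: X_def E_def)
  have x0X: "x0 \<in> X" using r(1) by (simp add: X_def N2_def)
  have Dlow: "sup_subsolution p - r / 16 \<le> sup_subsolution (chart_inv c s)" if s: "s \<in> E" for s
  proof (rule ccontr)
    \<comment> \<open>Then \<open>D (x k) - D s > r / 16 - r / 1000\<close>, and 100 times this
      exceeds the length \<open>4 * r\<close> of a path from \<open>x k\<close> to \<open>s\<close>,
      so \<open>s\<close> was a candidate for the step from \<open>x k\<close>. Half of this drop is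
      more than \<open>3 / 100 * r\<close>, whereas the step lost less than
      \<open>r / 100\<close>.\<close>
    assume neg: "\<not> sup_subsolution p - r / 16 \<le> sup_subsolution (chart_inv c s)"
    have "\<forall>\<^sub>F k in sequentially. x k \<in> {q \<in> chart_dom c. coord c q \<in> X}"
      by (rule riem_dist_tendsto_eventually[OF lim open_chart_preimage[OF c(1) X]])
        (use c x0X in \<open>auto simp: x0_def\<close>)
    moreover have "\<forall>\<^sub>F k in sequentially. sup_subsolution (x k) - sup_subsolution (x (Suc k)) < r / 100"
      by (rule order_tendstoD(2)[OF dd]) (use r in simp)
    moreover have "\<forall>\<^sub>F k in sequentially. riem_dist A g (x k) p < ennreal (r / 1000)"
      by (rule ev) (use r in simp)
    ultimately have "\<forall>\<^sub>F k in sequentially. x k \<in> {q \<in> chart_dom c. coord c q \<in> X} \<and>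
        sup_subsolution (x k) - sup_subsolution (x (Suc k)) < r / 100 \<and> riem_dist A g (x k) p < ennreal (r / 1000)"
      by (intro eventually_conj)
    then obtain k where k: "x k \<in> chart_dom c" "coord c (x k) \<in> X"
        "sup_subsolution (x k) - sup_subsolution (x (Suc k)) < r / 100" "riem_dist A g (x k) p < ennreal (r / 1000)"
      using eventually_happens'[OF sequentially_bot] by blast
    define y where "y = coord c (x k)"
    have y: "y \<in> E" "chart_inv c y = x k" using k XE by (auto simp: y_def chart_inv_coord c)
    have seg: "closed_segment y s \<subseteq> cball x0 \<rho>"
      by (rule closed_segment_subset) (use y s E_cb in auto)
    \<comment> \<open>\<open>g\<close> is at most 4 times \<open>Q\<close>, and the parallelogram
      inequality bounds the \<open>Q\<close>-form of \<open>s - y\<close> by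
      \<open>2 * r^2 + 2 * r^2\<close>; the product is \<open>(4 * r)^2\<close>.\<close>
    have "reach (4 * r) (chart_inv c y) (chart_inv c s)"
    proof (rule reach_segment[OF c(1)])
      show "closed_segment y s \<subseteq> chart_img c" using seg cb by blast
      show "0 < 4 * r" using r by simp
      fix z assume "z \<in> closed_segment y s"
      then have "(s - y) \<bullet> (g c (chart_inv c z) *v (s - y)) \<le> 4 * ((s - y) \<bullet> (Q *v (s - y)))"
        using near2 seg by blast
      also have "\<dots> \<le> 4 * (2 * N2 s + 2 * N2 y)"
        using posdef_parallelogram[OF Qpos, of "s - x0" "y - x0"] by (simp add: N2_def)
      also have "\<dots> \<le> (4 * r)\<^sup>2" using s y(1) by (simp add: E_def power_mult_distrib)
      finally show "(s - y) \<bullet> (g c (chart_inv c z) *v (s - y)) \<le> (4 * r)\<^sup>2" .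
    qed
    moreover have *: "sup_subsolution (x k) - sup_subsolution (chart_inv c s) > r / 16 - r / 1000"
      using neg abs_le_D1[OF Dclose[OF k(4)]] r by simp
    ultimately have "reach (100 * (sup_subsolution (x k) - sup_subsolution (chart_inv c s))) (x k) (chart_inv c s)"
      unfolding y(2) by (rule_tac reach_mono) (use r in auto)
    from ek[OF this] k(3) * r show False by simp
  qed
  \<comment> \<open>\<open>D\<close> need not be attained by a single function. Compactness of
    \<open>E\<close> leaves finitely many, each within \<open>r / 100\<close> of the lower bound on
    its piece, and \<open>subsolutions_finite\<close> merges them at the cost of another
    \<open>r / 100\<close>.\<close>
  have "\<exists>S. S \<subseteq> subsolutions \<and> finite S \<and> E \<subseteq> (\<Union>u\<in>S. {y \<in> chart_img c. sup_subsolution p - r / 16 - r / 100 < u (chart_inv c y)})"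
  proof -
    have op: "open {y \<in> chart_img c. sup_subsolution p - r / 16 - r / 100 < u (chart_inv c y)}" if "u \<in> subsolutions" for u
    proof -
      have "smooth_fun A u" using that by (simp add: subsolutions_def)
      then have "continuous_on (chart_img c) (\<lambda>y. u (chart_inv c y))"
        using smooth_on_imp_continuous_on[OF smooth_fun_comp] c(1) by blast
      then have "open ((\<lambda>y. u (chart_inv c y)) -` {sup_subsolution p - r / 16 - r / 100<..} \<inter> chart_img c)"
        using continuous_on_open_vimage[OF open_img[OF c(1)], of "\<lambda>y. u (chart_inv c y)"] open_greaterThan by blast
      moreover have "(\<lambda>y. u (chart_inv c y)) -` {sup_subsolution p - r / 16 - r / 100<..} \<inter> chart_img c = {y \<in> chart_img c. sup_subsolution p - r / 16 - r / 100 < u (chart_inv c y)}"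
        by auto
      ultimately show ?thesis by simp
    qed
    have cov: "E \<subseteq> (\<Union>u\<in>subsolutions. {y \<in> chart_img c. sup_subsolution p - r / 16 - r / 100 < u (chart_inv c y)})"
    proof
      fix s assume s: "s \<in> E"
      have "finite_at (chart_inv c s)"
      proof -
        have "closed_segment x0 s \<subseteq> cball x0 \<rho>"
          by (rule closed_segment_subset) (use s E_cb \<rho> in auto)
        then have "reach (4 * r) (chart_inv c x0) (chart_inv c s)"
        proof (intro reach_segment[OF c(1)])
          assume seg: "closed_segment x0 s \<subseteq> cball x0 \<rho>"
          show "closed_segment x0 s \<subseteq> chart_img c" using seg cb by blast
          show "0 < 4 * r" using r by simp
          fix z assume "z \<in> closed_segment x0 s"
          then have "(s - x0) \<bullet> (g c (chart_inv c z) *v (s - x0)) \<le> 4 * N2 s"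
            unfolding N2_def using near2 seg by blast
          also have "\<dots> \<le> (4 * r)\<^sup>2" using s N2_nonneg[of s] by (simp add: E_def power_mult_distrib)
          finally show "(s - x0) \<bullet> (g c (chart_inv c z) *v (s - x0)) \<le> (4 * r)\<^sup>2" .
        qed
        then show ?thesis using finite_at_reach(1)[OF fp] x0(2) by simp
      qed
      moreover have "sup_subsolution p - r / 16 - r / 100 < sup_subsolution (chart_inv c s)" using Dlow[OF s] r by simp
      ultimately obtain u where "u \<in> subsolutions" "sup_subsolution p - r / 16 - r / 100 < u (chart_inv c s)"
        using sup_subsolution_approx by blast
      then show "s \<in> (\<Union>u\<in>subsolutions. {y \<in> chart_img c. sup_subsolution p - r / 16 - r / 100 < u (chart_inv c y)})"
        using s E_img by blast
    qed
    show ?thesis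
      by (rule compactE_image[OF E_compact op cov]) blast+
  qed
  then obtain S where S: "S \<subseteq> subsolutions" "finite S"
    "E \<subseteq> (\<Union>u\<in>S. {y \<in> chart_img c. sup_subsolution p - r / 16 - r / 100 < u (chart_inv c y)})" by blast
  obtain u where u: "u \<in> subsolutions" "\<And>v q. v \<in> S \<Longrightarrow> v q - r / 100 \<le> u q"
    using subsolutions_finite[OF S(2,1), of "r / 100"] r by auto
  have ulow: "sup_subsolution p - r / 16 - r / 50 \<le> u (chart_inv c y)" if y: "y \<in> E" for y
  proof -
    obtain v where v: "v \<in> S" "sup_subsolution p - r / 16 - r / 100 < v (chart_inv c y)" using S(3) y by blast
    show ?thesis using u(2)[OF v(1), of "chart_inv c y"] v(2) by simp
  qed
  \<comment> \<open>The coefficient \<open>1 / (4 * r)\<close> gives slope at most 1/2 on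
    \<open>X\<close> with respect to \<open>Q\<close>; lengths in \<open>Q\<close> and
    \<open>g\<close> differ by a factor of at most 2, so the slope in \<open>g\<close> is at most
    1.\<close>
  define \<eta> where "\<eta> = (\<lambda>y. (sup_subsolution p + r / 100) - inverse (4 * r) * N2 y)"
  \<comment> \<open>Outside \<open>K\<close> the paraboloid has dropped by at least
    \<open>81 / 400 * r\<close>. As \<open>81 / 400 - 1 / 100\<close> exceeds
    \<open>1 / 16 + 1 / 50\<close>, it lies below \<open>u\<close> there, and \<open>smax\<close>
    returns \<open>u\<close> exactly.\<close>
  define K where "K = {y. N2 y \<le> (81 / 100) * r\<^sup>2}"
  have KX: "K \<subseteq> X"
  proof
    fix y assume "y \<in> K"
    moreover have "(81 / 100) * r\<^sup>2 < r\<^sup>2" using r(1) by simp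
    ultimately have "N2 y < r\<^sup>2" unfolding K_def mem_Collect_eq by (rule le_less_trans)
    then show "y \<in> X" by (simp add: X_def)
  qed
  have K: "compact K"
    using KX XE E_compact cl[of "(81 / 100) * r\<^sup>2"] unfolding K_def
    by (metis closed_Int_compact inf.absorb1 order_trans)
  have usm: "smooth_fun A u" "grad_bound u 1" "compact (closure {q. u q > 0})"
    using u(1) by (auto simp: subsolutions_def)
  \<comment> \<open>Smoothing costs at most \<open>r / 200\<close>, half of the surplus
    \<open>r / 100\<close> of \<open>\<eta>\<close> over \<open>D\<close> at
    \<open>p\<close>.\<close>
  define w where "w = (\<lambda>y. smax (r / 200) (u (chart_inv c y)) (\<eta> y))"
  have sm\<eta>: "smooth_on UNIV \<eta>"
    unfolding \<eta>_def by (intro smooth_on_diff smooth_on_mult smooth_on_const N2_smooth open_UNIV)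
  have smu: "smooth_on X (\<lambda>y. u (chart_inv c y))"
    by (rule smooth_on_subset[OF smooth_fun_comp[OF usm(1) c(1)]]) (use XE E_img in blast)
  have w: "smooth_on X w"
    unfolding w_def by (rule smooth_on_smax[OF X smu smooth_on_subset[OF sm\<eta>]]) simp
  have r200: "r / 200 > 0" using r by simp
  have weq: "w y = u (chart_inv c y)" if y: "y \<in> X - K" for y
  proof -
    have "(81 / 100) * r\<^sup>2 < N2 y" using y by (simp add: K_def)
    then have "inverse (4 * r) * ((81 / 100) * r\<^sup>2) \<le> inverse (4 * r) * N2 y" using r(1) by (intro mult_left_mono) auto
    moreover have "inverse (4 * r) * ((81 / 100) * r\<^sup>2) = 81 / 400 * r" using r(1) by (simp add: power2_eq_square)
    ultimately have "81 / 400 * r \<le> inverse (4 * r) * N2 y" by metis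
    moreover have "sup_subsolution p - r / 16 - r / 50 \<le> u (chart_inv c y)" using ulow[of y] y XE by blast
    ultimately have "\<eta> y \<le> u (chart_inv c y)" unfolding \<eta>_def using r(1) by linarith
    then show ?thesis unfolding w_def by (rule smax_bounds(4)[OF r200])
  qed
  have wb: "\<bar>dir_deriv w y z\<bar> \<le> 1 * sqrt (z \<bullet> (g c (chart_inv c y) *v z))" if y: "y \<in> X" for y z
  proof -
    let ?G = "g c (chart_inv c y)"
    have yE: "y \<in> cball x0 \<rho>" "y \<in> chart_img c" using y XE E_cb cb by auto
    have "(\<eta> has_derivative (\<lambda>z. - (inverse (4 * r) * ((y - x0) \<bullet> (Q *v z) + z \<bullet> (Q *v (y - x0)))))) (at y)"
    proof -
      have 1: "((\<lambda>y. y - x0) has_derivative (\<lambda>z. z)) (at y)" by (auto intro!: derivative_eq_intros)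
      have 2: "((\<lambda>y. Q *v (y - x0)) has_derivative (\<lambda>z. Q *v z)) (at y)"
        by (rule bounded_linear.has_derivative[OF matrix_vector_mul_bounded_linear 1])
      have 3: "(N2 has_derivative (\<lambda>z. (y - x0) \<bullet> (Q *v z) + z \<bullet> (Q *v (y - x0)))) (at y)"
        unfolding N2_def[abs_def] by (rule has_derivative_inner[OF 1 2])
      show ?thesis unfolding \<eta>_def
        using has_derivative_diff[OF has_derivative_const[of "sup_subsolution p + r / 100"] has_derivative_mult_right[OF 3, of "inverse (4 * r)"]]
        by (simp only: diff_0)
    qed
    from dir_deriv_derivative[OF this, of z]
    have d\<eta>: "dir_deriv \<eta> y z = - (inverse (2 * r) * ((y - x0) \<bullet> (Q *v z)))"
      using Qsym[of z "y - x0"] by (simp add: field_simps)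
    have b\<eta>: "\<bar>dir_deriv \<eta> y z\<bar> \<le> sqrt (z \<bullet> (?G *v z))"
    proof -
      have "((y - x0) \<bullet> (Q *v z))\<^sup>2 \<le> N2 y * (z \<bullet> (Q *v z))"
        unfolding N2_def by (rule posdef_cauchy_schwarz[OF Qsym Qpos])
      also have "\<dots> \<le> r\<^sup>2 * (4 * (z \<bullet> (?G *v z)))"
        using y near1[OF yE(1), of z] N2_nonneg Qpos[of z]
        by (intro mult_mono) (auto simp: X_def, cases "z = 0", auto)
      also have "\<dots> = (2 * r * sqrt (z \<bullet> (?G *v z)))\<^sup>2"
        using g_nonneg[OF c(1) chart_inv_in[OF c(1) yE(2)], of z] by (simp add: power_mult_distrib)
      finally have "\<bar>(y - x0) \<bullet> (Q *v z)\<bar> \<le> \<bar>2 * r * sqrt (z \<bullet> (?G *v z))\<bar>"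
        by (rule abs_le_square_iff[THEN iffD2])
      also have "\<bar>2 * r * sqrt (z \<bullet> (?G *v z))\<bar> = 2 * r * sqrt (z \<bullet> (?G *v z))"
        using r(1) g_nonneg[OF c(1) chart_inv_in[OF c(1) yE(2)], of z] by simp
      finally have "\<bar>(y - x0) \<bullet> (Q *v z)\<bar> \<le> 2 * r * sqrt (z \<bullet> (?G *v z))" .
      then show ?thesis using r(1) by (simp add: d\<eta> abs_mult field_simps)
    qed
    have bu: "\<bar>dir_deriv (\<lambda>y. u (chart_inv c y)) y z\<bar> \<le> sqrt (z \<bullet> (?G *v z))"
      using grad_boundD[OF usm(2) c(1) chart_inv_in[OF c(1) yE(2)], of z] by (simp add: coord_chart_inv[OF c(1) yE(2)])
    obtain \<theta> where \<theta>: "\<theta> \<in> {0..1}" "\<And>z. dir_deriv w y z = (1 - \<theta>) * dir_deriv (\<lambda>y. u (chart_inv c y)) y z + \<theta> * dir_deriv \<eta> y z"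
      using dir_deriv_smax[OF r200 smooth_on_at[OF smu X y] smooth_on_at[OF sm\<eta> open_UNIV UNIV_I, of y]] unfolding w_def by blast
    show ?thesis unfolding \<theta>(2) using abs_convex_bound[OF bu b\<eta> \<theta>(1)] by simp
  qed
  let ?h = "\<lambda>q. if q \<in> chart_dom c \<and> coord c q \<in> X then w (coord c q) else u q"
  have X_img: "X \<subseteq> chart_img c" using XE E_img by blast
  have hs: "smooth_fun A ?h"
    by (rule smooth_fun_patch(1)[OF c(1) X X_img K KX usm(1) w weq])
  have hb: "grad_bound ?h 1"
    by (rule smooth_fun_patch(2)[OF c(1) X X_img K KX usm(1) w weq usm(2) wb])
  have cE: "compact (chart_inv c ` E)"
    by (rule compact_continuous_image[OF continuous_on_subset[OF cont_chart_inv[OF c(1)] E_img] E_compact])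
  have "{q. ?h q > 0} \<subseteq> closure {q. u q > 0} \<union> chart_inv c ` E"
  proof
    fix q assume q: "q \<in> {q. ?h q > 0}"
    show "q \<in> closure {q. u q > 0} \<union> chart_inv c ` E"
    proof (cases "q \<in> chart_dom c \<and> coord c q \<in> X")
      case True
      then have "q = chart_inv c (coord c q)" "coord c q \<in> E" using XE by (auto simp: chart_inv_coord c)
      then show ?thesis by blast
    next
      case False
      then have "u q > 0" using q by auto
      then have "q \<in> closure {q. u q > 0}" by (intro subsetD[OF closure_subset]) simp
      then show ?thesis by simp
    qed
  qed
  then have "compact (closure {q. ?h q > 0})"
    by (rule compact_closure_subset[OF compact_Un[OF usm(3) cE]])
  then have "?h \<in> subsolutions" using hs hb by (simp add: subsolutions_def)
  then have "?h p \<le> sup_subsolution p" by (rule sup_subsolution_upper[OF fp])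
  moreover have "?h p = w x0" using c x0X by (simp add: x0_def)
  moreover have "\<eta> x0 - r / 200 \<le> w x0" unfolding w_def by (rule smax_bounds(2)[OF r200])
  moreover have "\<eta> x0 = sup_subsolution p + r / 100" by (simp add: \<eta>_def N2_def)
  ultimately show False using r(1) by simp
qed

text \<open>A subsolution with value at least \<open>R + 1\<close> at \<open>p\<close> is divided by
  \<open>R\<close>. Taking the smooth positive part first loses at most 1, and because it vanishes
  exactly where \<open>v \<le> 0\<close>, compactness of the closure of \<open>{v > 0}\<close>
  becomes compact support.\<close>

lemma cutoff_exists:
  assumes complete: "riem_complete A g" and R: "R > 0"
  shows "\<exists>u. smooth_fun A u \<and> grad_bound u (1 / R) \<and> compact (closure {q. u q \<noteq> 0}) \<and> u p \<ge> 1"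
proof -
  obtain v where v: "v \<in> subsolutions" "R + 1 \<le> v p" using unbounded_subsolution[OF complete] by blast
  define u where "u = (\<lambda>q. (1 / R) * smax 1 0 (v q))"
  have vs: "smooth_fun A v" "grad_bound v 1" "compact (closure {q. v q > 0})" using v(1) by (auto simp: subsolutions_def)
  have 0: "smooth_fun A (\<lambda>q. 0)" "grad_bound (\<lambda>q. 0) 1" using zero_subsolution by (auto simp: subsolutions_def)
  have ws: "smooth_fun A (\<lambda>q. smax 1 0 (v q))" by (rule smooth_fun_smax[OF 0(1) vs(1)])
  have wb: "grad_bound (\<lambda>q. smax 1 0 (v q)) 1" by (rule grad_bound_smax[OF 0(1) vs(1) 0(2) vs(2)]) simp
  have us: "smooth_fun A u"
    unfolding smooth_fun_def o_def u_def
    using smooth_on_mult[OF open_img smooth_on_const smooth_fun_comp[OF ws]] by blast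
  have "grad_bound u (1 / R)"
    unfolding grad_bound_def
  proof (intro ballI allI)
    fix c q z assume c: "c \<in> A" "q \<in> chart_dom c"
    have "dir_deriv (\<lambda>y. u (chart_inv c y)) (coord c q) z = (1 / R) * dir_deriv (\<lambda>y. smax 1 0 (v (chart_inv c y))) (coord c q) z"
      unfolding u_def
      by (rule dir_deriv_derivative[OF has_derivative_mult_right[OF has_derivative_dir_deriv[OF chart_comp_differentiable[OF ws c]]]])
    then show "\<bar>dir_deriv (\<lambda>y. u (chart_inv c y)) (coord c q) z\<bar> \<le> 1 / R * sqrt (z \<bullet> (g c q *v z))"
      using grad_boundD[OF wb c, of z] R by (simp add: abs_mult divide_right_mono)
  qed
  moreover have "{q. u q \<noteq> 0} \<subseteq> {q. v q > 0}"
    using smax_bounds(4)[of 1 _ 0] by (auto simp: u_def) (metis not_less zero_less_one)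
  then have "compact (closure {q. u q \<noteq> 0})"
    by (intro compact_closure_subset[OF vs(3)]) (rule order_trans[OF _ closure_subset])
  moreover have "u p \<ge> 1"
    using smax_bounds(2)[of 1 "v p" 0] v(2) R by (simp add: u_def)
  ultimately show ?thesis using us by blast
qed

end

section \<open>Trace inequalities\<close>

lemma trace_add: "trace (A + B :: real^'n::finite^'n) = trace A + trace B"
  by (simp add: trace_def sum.distrib)

lemma trace_diff: "trace (A - B :: real^'n::finite^'n) = trace A - trace B"
  by (simp add: trace_def sum_subtractf)

lemma trace_scaleR: "trace (a *\<^sub>R A :: real^'n::finite^'n) = a * trace A"
  by (simp add: trace_def sum_distrib_left)

lemma trace_mat_1: "trace (mat 1 :: real^'n::finite^'n) = real CARD('n)"
  by (simp add: trace_def mat_def)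

lemma trace_conjugate:
  fixes T M M' :: "real^'n::finite^'n"
  assumes "invertible T" "T ** M = M' ** T"
  shows "trace M = trace M'"
proof -
  have "trace M = trace (matrix_inv T ** (T ** M))"
    by (simp add: matrix_mul_assoc matrix_inv_left assms(1))
  also have "\<dots> = trace (M' ** T ** matrix_inv T)"
    unfolding assms(2) by (rule trace_mul_sym)
  also have "\<dots> = trace M'"
    by (simp add: matrix_mul_assoc[symmetric] matrix_inv_right assms(1))
  finally show ?thesis .
qed

lemma axis_matrix_nth: "axis i 1 \<bullet> (M *v axis j 1) = (M :: real^'n::finite^'m::finite) $ i $ j"
  by (simp add: matrix_vector_mult_basis column_def inner_axis')

text \<open>Eliminating one index at a time from the support of \<open>M\<close> by Schur complements.\<close>

lemma psd_inner_nonneg_support: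
  fixes K M :: "real^'n::finite^'n"
  assumes K: "\<And>v. 0 \<le> v \<bullet> (K *v v)"
    and sym: "\<And>v w. v \<bullet> (M *v w) = w \<bullet> (M *v v)" and M: "\<And>v. 0 \<le> v \<bullet> (M *v v)"
    and I: "finite I" and supp: "\<And>i j. i \<notin> I \<or> j \<notin> I \<Longrightarrow> M $ i $ j = 0"
  shows "0 \<le> (\<Sum>i\<in>UNIV. \<Sum>k\<in>UNIV. K $ i $ k * M $ i $ k)"
  using I sym M supp
proof (induction I arbitrary: M rule: finite_induct)
  case empty
  then show ?case by simp
next
  case (insert p I)
  note sym = insert.prems(1) and M = insert.prems(2) and supp = insert.prems(3)
  define a where "a = M *v axis p 1"
  have a_nth: "a $ i = M $ i $ p" for i by (simp add: a_def matrix_vector_mult_basis column_def)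
  have Msym: "M $ i $ j = M $ j $ i" for i j using sym[of "axis i 1" "axis j 1"] by (simp add: axis_matrix_nth)
  have ea: "axis p 1 \<bullet> (M *v v) = a \<bullet> v" for v
    using sym[of "axis p 1" v] by (simp add: a_def inner_commute)
  have quad: "0 \<le> v \<bullet> (M *v v) + 2 * s * (a \<bullet> v) + s * s * M $ p $ p" for v and s :: real
  proof -
    have "0 \<le> (v + s *\<^sub>R axis p 1) \<bullet> (M *v (v + s *\<^sub>R axis p 1))" by (rule M)
    also have "\<dots> = v \<bullet> (M *v v) + 2 * s * (a \<bullet> v) + s * s * M $ p $ p"
      unfolding mv_add_right mv_scaleR_right
      using axis_matrix_nth[of p M p]
      by (simp add: inner_add_left inner_add_right ea axis_matrix_nth a_def[symmetric] inner_commute[of v a] algebra_simps)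
    finally show ?thesis .
  qed
  show ?case
  proof (cases "M $ p $ p = 0")
    case True
    have "a $ j = 0" for j
    proof (rule ccontr)
      assume ne: "a $ j \<noteq> 0"
      \<comment> \<open>With this \<open>t\<close> the form takes the value -1 on the
        \<open>j\<close>-th axis vector plus \<open>t\<close> times the \<open>p\<close>-th: a
        vanishing diagonal entry of a semidefinite matrix forces its row to vanish.\<close>
      define t where "t = - (M $ j $ j + 1) / (2 * (a $ j))"
      have "0 \<le> M $ j $ j + 2 * t * (a $ j)"
        using quad[of "axis j 1" t] True by (simp add: axis_matrix_nth inner_axis)
      also have "\<dots> = -1" using ne by (simp add: t_def field_simps)
      finally show False by simp
    qed
    then have "M $ i $ p = 0" "M $ p $ i = 0" for i using a_nth Msym by metis+
    then have "M $ i $ j = 0" if "i \<notin> I \<or> j \<notin> I" for i j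
      using supp[of i j] that by (metis insertE)
    then show ?thesis using insert.IH[of M] sym M by blast
  next
    case False
    define m where "m = M $ p $ p"
    have m: "m > 0" using M[of "axis p 1"] False by (simp add: m_def axis_matrix_nth)
    \<comment> \<open>Subtracting \<open>a * a^T / m\<close> clears row and column \<open>p\<close>
      and keeps the form semidefinite; the part removed contributes
      \<open>a \<bullet> (K *v a) / m\<close>, which is nonnegative.\<close>
    define M' where "M' = (\<chi> i j. M $ i $ j - a $ i * a $ j / m)"
    have M'v: "v \<bullet> (M' *v w) = v \<bullet> (M *v w) - (a \<bullet> v) * (a \<bullet> w) / m" for v w
    proof -
      have "v \<bullet> (M' *v w) = (\<Sum>i\<in>UNIV. \<Sum>j\<in>UNIV. v $ i * (M $ i $ j * w $ j)) - (\<Sum>i\<in>UNIV. \<Sum>j\<in>UNIV. (a $ i * v $ i) * (a $ j * w $ j)) / m"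
        by (simp add: inner_vec_def matrix_vector_mult_def M'_def sum_distrib_left sum_subtractf[symmetric]
            sum_divide_distrib algebra_simps)
      moreover have "v \<bullet> (M *v w) = (\<Sum>i\<in>UNIV. \<Sum>j\<in>UNIV. v $ i * (M $ i $ j * w $ j))"
        by (simp add: inner_vec_def matrix_vector_mult_def sum_distrib_left)
      moreover have "(a \<bullet> v) * (a \<bullet> w) = (\<Sum>i\<in>UNIV. \<Sum>j\<in>UNIV. (a $ i * v $ i) * (a $ j * w $ j))"
        by (simp add: inner_vec_def sum_product)
      ultimately show ?thesis by metis
    qed
    have 1: "v \<bullet> (M' *v w) = w \<bullet> (M' *v v)" for v w unfolding M'v using sym[of v w] by simp
    have 2: "0 \<le> v \<bullet> (M' *v v)" for v
    proof -
      \<comment> \<open>The parameter of \<open>quad\<close> is the minimiser of the quadratic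
        polynomial.\<close>
      have "0 \<le> v \<bullet> (M *v v) + 2 * (- (a \<bullet> v) / m) * (a \<bullet> v) + (- (a \<bullet> v) / m) * (- (a \<bullet> v) / m) * m"
        unfolding m_def by (rule quad)
      also have "\<dots> = v \<bullet> (M *v v) - (a \<bullet> v) * (a \<bullet> v) / m" using m by (simp add: field_simps)
      finally show ?thesis unfolding M'v .
    qed
    have 3: "M' $ i $ j = 0" if "i \<notin> I \<or> j \<notin> I" for i j
    proof (cases "i = p \<or> j = p")
      case True
      have "a $ p = m" by (simp add: a_nth m_def)
      moreover have "a $ i = M $ i $ p" "a $ j = M $ p $ j" using a_nth[of i] a_nth[of j] Msym[of j p] by simp_all
      ultimately show ?thesis using True m unfolding M'_def by (elim disjE) simp_all
    next
      case False
      then have "M $ i $ j = 0" "M $ i $ p = 0 \<or> M $ j $ p = 0" using that supp by auto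
      then have "a $ i * a $ j = 0" using a_nth[of i] a_nth[of j] by auto
      then show ?thesis using \<open>M $ i $ j = 0\<close> by (simp add: M'_def)
    qed
    have "(\<Sum>i\<in>UNIV. \<Sum>k\<in>UNIV. K $ i $ k * M $ i $ k) = (\<Sum>i\<in>UNIV. \<Sum>k\<in>UNIV. K $ i $ k * M' $ i $ k) + (a \<bullet> (K *v a)) / m"
      by (simp add: inner_vec_def matrix_vector_mult_def M'_def sum_distrib_left sum.distrib[symmetric]
          sum_divide_distrib algebra_simps)
    moreover have "0 \<le> (\<Sum>i\<in>UNIV. \<Sum>k\<in>UNIV. K $ i $ k * M' $ i $ k)"
      by (rule insert.IH[of M', OF 1 2 3])
    ultimately show ?thesis using K[of a] m by simp
  qed
qed

lemma psd_trace_nonneg: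
  fixes K M :: "real^'n::finite^'n"
  assumes K: "\<And>v. 0 \<le> v \<bullet> (K *v v)" and sym: "transpose M = M" and M: "\<And>v. 0 \<le> v \<bullet> (M *v v)"
  shows "0 \<le> trace (K ** M)"
proof -
  have s: "v \<bullet> (M *v w) = w \<bullet> (M *v v)" for v w by (metis inner_transpose_mult sym inner_commute)
  have "M $ k $ i = M $ i $ k" for i k using s[of "axis k 1" "axis i 1"] by (simp add: axis_matrix_nth)
  then have "trace (K ** M) = (\<Sum>i\<in>UNIV. \<Sum>k\<in>UNIV. K $ i $ k * M $ i $ k)"
    by (simp add: trace_def matrix_matrix_mult_def)
  then show ?thesis using psd_inner_nonneg_support[OF K s M, of UNIV] by simp
qed

text \<open>The trace-free part \<open>e = b - t h\<close> has nonnegative squared norm, measured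
  with the inverse metric \<open>K\<close>; expanding it with \<open>t\<close> the mean of the trace
  gives the inequality. Written with \<open>transpose b\<close>, it covers every bilinear
  form.\<close>

lemma trace_cauchy_schwarz:
  fixes h b :: "real^'n::finite^'n"
  assumes sym: "transpose h = h" and pos: "\<And>v. v \<noteq> 0 \<Longrightarrow> 0 < v \<bullet> (h *v v)"
  defines "K \<equiv> matrix_inv h"
  shows "(trace (K ** b))\<^sup>2 / real CARD('n) \<le> trace (K ** (b ** K ** transpose b))"
proof -
  have inv: "invertible h" by (rule posdef_invertible[OF pos])
  have hK: "h ** K = mat 1" and Kh: "K ** h = mat 1"
    using matrix_inv_right[OF inv] matrix_inv_left[OF inv] by (auto simp: K_def)
  have "transpose K ** h = mat 1"
    using arg_cong[OF hK, of transpose] by (simp add: matrix_transpose_mul sym transpose_mat)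
  then have Ksym: "transpose K = K"
    by (metis hK matrix_mul_assoc matrix_mul_lid matrix_mul_rid)
  have Kpos: "0 \<le> v \<bullet> (K *v v)" for v
  proof -
    have "v \<bullet> (K *v v) = (K *v v) \<bullet> (h *v (K *v v))"
      by (simp add: matrix_vector_mul_assoc hK inner_commute)
    then show ?thesis using pos[of "K *v v"] by (cases "K *v v = 0") auto
  qed
  define n where "n = real CARD('n)"
  have n: "n > 0" by (simp add: n_def)
  define t where "t = trace (K ** b) / n"
  define e where "e = b - t *\<^sub>R h"
  have "0 \<le> trace (K ** (e ** K ** transpose e))"
  proof (rule psd_trace_nonneg[OF Kpos])
    show "transpose (e ** K ** transpose e) = e ** K ** transpose e"
      by (simp add: matrix_transpose_mul Ksym matrix_mul_assoc)
    show "0 \<le> v \<bullet> ((e ** K ** transpose e) *v v)" for v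
    proof -
      have "v \<bullet> ((e ** K ** transpose e) *v v) = (transpose e *v v) \<bullet> (K *v (transpose e *v v))"
        using inner_transpose_mult[of v "transpose e" "K *v (transpose e *v v)"]
        by (simp only: matrix_vector_mul_assoc[symmetric] transpose_transpose)
      then show ?thesis using Kpos[of "transpose e *v v"] by (simp only:)
    qed
  qed
  also have "K ** (e ** K ** transpose e) = K ** (b ** K ** transpose b) - t *\<^sub>R (K ** b) - t *\<^sub>R (K ** transpose b) + (t * t) *\<^sub>R mat 1"
  proof -
    note bil = bounded_bilinear.diff_left[OF bounded_bilinear_matrix_mult] bounded_bilinear.diff_right[OF bounded_bilinear_matrix_mult]
    have te: "transpose e = transpose b - t *\<^sub>R h"
      using sym by (simp add: e_def transpose_def vec_eq_iff)
    have "e ** K = b ** K - t *\<^sub>R mat 1" unfolding e_def bil mm_scaleR_left hK ..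
    then have "e ** K ** transpose e = (b ** K - t *\<^sub>R mat 1) ** (transpose b - t *\<^sub>R h)"
      unfolding te by simp
    also have "\<dots> = b ** K ** transpose b - t *\<^sub>R b - t *\<^sub>R transpose b + (t * t) *\<^sub>R h"
      unfolding bil mm_scaleR_left mm_scaleR_right
      by (simp add: matrix_mul_assoc[symmetric] Kh algebra_simps)
    finally show ?thesis
      by (simp add: bil bounded_bilinear.add_right[OF bounded_bilinear_matrix_mult] mm_scaleR_right Kh)
  qed
  also have "trace \<dots> = trace (K ** (b ** K ** transpose b)) - 2 * t * trace (K ** b) + t * t * n"
  proof -
    have "trace (K ** transpose b) = trace (transpose (K ** transpose b))" by (simp add: trace_def transpose_def)
    also have "\<dots> = trace (b ** K)" by (simp add: matrix_transpose_mul Ksym)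
    also have "\<dots> = trace (K ** b)" by (rule trace_mul_sym)
    finally show ?thesis by (simp add: trace_add trace_diff trace_scaleR trace_mat_1 n_def)
  qed
  also have "\<dots> = trace (K ** (b ** K ** transpose b)) - (trace (K ** b))\<^sup>2 / n"
    using n by (simp add: t_def power2_eq_square field_simps)
  finally show ?thesis by (simp add: n_def)
qed

lemma quad_form_trace:
  fixes K h :: "real^'n::finite^'n"
  assumes sym: "transpose K = K"
  shows "(\<Sum>i\<in>UNIV. \<Sum>j\<in>UNIV. \<Sum>k\<in>UNIV. \<Sum>l\<in>UNIV. K $ i $ k * K $ j $ l * h $ i $ j * h $ k $ l)
    = trace (K ** (h ** K ** transpose h))"
proof -
  have s: "K $ i $ j = K $ j $ i" for i j using sym by (metis transpose_def vec_lambda_beta)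
  have "trace (K ** (h ** K ** transpose h)) = (\<Sum>i\<in>UNIV. \<Sum>k\<in>UNIV. \<Sum>j\<in>UNIV. \<Sum>l\<in>UNIV. K $ i $ k * K $ j $ l * h $ i $ j * h $ k $ l)"
    by (simp add: trace_def matrix_matrix_mult_def transpose_def sum_distrib_left sum_distrib_right s mult_ac)
  also have "\<dots> = (\<Sum>i\<in>UNIV. \<Sum>j\<in>UNIV. \<Sum>k\<in>UNIV. \<Sum>l\<in>UNIV. K $ i $ k * K $ j $ l * h $ i $ j * h $ k $ l)"
    by (rule sum.cong[OF refl], rule sum.swap)
  finally show ?thesis by simp
qed

text \<open>Raising one index turns both \<open>b\<close> and \<open>transpose b\<close> into
  endomorphisms, which are conjugated by \<open>T\<close>; hence so is their product, whose trace
  this is.\<close>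

lemma quad_trace_conjugate:
  fixes T h h' b b' :: "real^'n::finite^'n"
  assumes T: "invertible T" and inv: "invertible h" "invertible h'"
    and h: "h = transpose T ** h' ** T" and b: "b = transpose T ** b' ** T"
  shows "trace (matrix_inv h ** (b ** matrix_inv h ** transpose b))
    = trace (matrix_inv h' ** (b' ** matrix_inv h' ** transpose b'))"
proof -
  have tT: "invertible (transpose T)" using T unfolding invertible_def by (metis matrix_transpose_mul transpose_mat)
  have P: "T ** (matrix_inv h ** x) = (matrix_inv h' ** x') ** T" if "x = transpose T ** x' ** T" for x x'
  proof -
    have "transpose T ** (h' ** (T ** (matrix_inv h ** x))) = h ** matrix_inv h ** x"
      unfolding h by (simp only: matrix_mul_assoc)
    also have "\<dots> = transpose T ** (x' ** T)"
      by (simp add: matrix_inv_right inv that matrix_mul_assoc)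
    finally have "matrix_inv (transpose T) ** (transpose T ** (h' ** (T ** (matrix_inv h ** x)))) = matrix_inv (transpose T) ** (transpose T ** (x' ** T))"
      by simp
    then have "h' ** (T ** (matrix_inv h ** x)) = x' ** T"
      by (simp add: matrix_mul_assoc matrix_inv_left tT)
    then have "matrix_inv h' ** (h' ** (T ** (matrix_inv h ** x))) = matrix_inv h' ** (x' ** T)" by simp
    then show ?thesis by (simp add: matrix_mul_assoc matrix_inv_left inv)
  qed
  have tb: "transpose b = transpose T ** transpose b' ** T"
    unfolding b by (simp add: matrix_transpose_mul matrix_mul_assoc)
  have "T ** ((matrix_inv h ** b) ** (matrix_inv h ** transpose b)) = ((matrix_inv h' ** b') ** (matrix_inv h' ** transpose b')) ** T"
    by (metis P[OF b] P[OF tb] matrix_mul_assoc)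
  from trace_conjugate[OF T this] show ?thesis by (simp add: matrix_mul_assoc)
qed

text \<open>All matrices on the segment from the identity to \<open>h\<close> are positive definite,
  hence invertible. The determinant starts at 1 and cannot change sign on the way.\<close>

lemma posdef_det_pos:
  fixes h :: "real^'n::finite^'n"
  assumes pos: "\<And>v. v \<noteq> 0 \<Longrightarrow> 0 < v \<bullet> (h *v v)"
  shows "0 < det h"
proof (rule ccontr)
  assume neg: "\<not> 0 < det h"
  define F where "F t = det (t *\<^sub>R h + (1 - t) *\<^sub>R mat 1)" for t :: real
  have co: "continuous_on {0..1} F"
    unfolding F_def det_def by (intro continuous_intros)
  have "\<exists>t\<ge>0. t \<le> 1 \<and> F t = 0"
    by (rule IVT2') (use neg co in \<open>auto simp: F_def\<close>)
  then obtain t where t: "0 \<le> t" "t \<le> 1" "F t = 0" by blast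
  have "invertible (t *\<^sub>R h + (1 - t) *\<^sub>R mat 1)"
  proof (rule posdef_invertible)
    fix v :: "real^'n" assume v: "v \<noteq> 0"
    have e: "v \<bullet> ((t *\<^sub>R h + (1 - t) *\<^sub>R mat 1) *v v) = t * (v \<bullet> (h *v v)) + (1 - t) * (v \<bullet> v)"
      unfolding mv_add_left mv_scaleR_left by (simp add: inner_add_right)
    show "0 < v \<bullet> ((t *\<^sub>R h + (1 - t) *\<^sub>R mat 1) *v v)"
      unfolding e using pos[OF v] v t
      by (cases "t = 0") (auto intro!: add_pos_nonneg mult_nonneg_nonneg)
  qed
  then show False using t(3) invertible_det_nz unfolding F_def by blast
qed

section \<open>Two-sided hypersurfaces\<close>

lemma jac_comp:
  assumes d: "atlas_manifold A" "d \<in> A" and N: "open N" "coord c p \<in> N" "chart_inv c (coord c p) = p"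
    "\<And>x. x \<in> N \<Longrightarrow> F (chart_inv c x) \<in> chart_dom d"
    and F: "(coord d \<circ> F \<circ> chart_inv c) differentiable at (coord c p)"
    and H: "(coord e \<circ> H \<circ> chart_inv d) differentiable at (coord d (F p))"
  shows "jac c e (H \<circ> F) p = jac d e H (F p) ** jac c d F p"
proof -
  interpret atlas_manifold A by (rule d(1))
  let ?F = "coord d \<circ> F \<circ> chart_inv c" and ?H = "coord e \<circ> H \<circ> chart_inv d"
  have x: "?F (coord c p) = coord d (F p)" using N(3) by simp
  have "pd i (coord e \<circ> (H \<circ> F) \<circ> chart_inv c) (coord c p) = pd i (\<lambda>x. ?H (?F x)) (coord c p)" for i
    by (rule pd_cong_open[OF N(1,2)]) (simp add: chart_inv_coord[OF d(2)] N(4))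
  also have "pd i (\<lambda>x. ?H (?F x)) (coord c p) = (\<Sum>j\<in>UNIV. pd i ?F (coord c p) $ j *\<^sub>R pd j ?H (coord d (F p)))" for i
    using pd_chain[where F = ?F and k = ?H, OF F] H x by simp
  finally have e: "pd i (coord e \<circ> (H \<circ> F) \<circ> chart_inv c) (coord c p) = (\<Sum>j\<in>UNIV. pd i ?F (coord c p) $ j *\<^sub>R pd j ?H (coord d (F p)))" for i .
  show ?thesis
    unfolding jac_def jacobian_nth e by (simp add: vec_eq_iff matrix_matrix_mult_def mult.commute)
qed

section \<open>The immersion in charts and the induced metric\<close>

locale hypersurface = amb: riemannian_manifold A g + sig: atlas_manifold B
  for A :: "('a::{t2_space,second_countable_topology}, 'n::finite) chart set"
    and g :: "('a, 'n) metric"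
    and B :: "('b::{t2_space,second_countable_topology}, 'm::finite) chart set" +
  fixes f :: "'a \<Rightarrow> real" and \<iota> :: "'b \<Rightarrow> 'a" and \<nu> :: "('a, 'n) chart \<Rightarrow> 'b \<Rightarrow> real^'n"
  assumes f: "smooth_fun A f"
    and imm: "immersed_hypersurface B A \<iota>"
    and nor: "unit_normal_field B A g \<iota> \<nu>"
begin

lemma dims: "real CARD('n) - 1 = real CARD('m)"
  using imm unfolding immersed_hypersurface_def by linarith

lemma cont_\<iota>: "continuous_on UNIV \<iota>"
  and smooth_\<iota>: "c \<in> B \<Longrightarrow> d \<in> A \<Longrightarrow> smooth_on (coord c ` (chart_dom c \<inter> \<iota> -` chart_dom d)) (coord d \<circ> \<iota> \<circ> chart_inv c)"
  and inj_jac: "c \<in> B \<Longrightarrow> d \<in> A \<Longrightarrow> p \<in> chart_dom c \<Longrightarrow> \<iota> p \<in> chart_dom d \<Longrightarrow> inj ((*v) (jac c d \<iota> p))"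
  using imm unfolding immersed_hypersurface_def by blast+

lemma normal_change: "d \<in> A \<Longrightarrow> d' \<in> A \<Longrightarrow> \<iota> p \<in> chart_dom d \<Longrightarrow> \<iota> p \<in> chart_dom d' \<Longrightarrow> \<nu> d' p = jac d d' id (\<iota> p) *v \<nu> d p"
  and smooth_\<nu>: "c \<in> B \<Longrightarrow> d \<in> A \<Longrightarrow> smooth_on (coord c ` (chart_dom c \<inter> \<iota> -` chart_dom d)) (\<nu> d \<circ> chart_inv c)"
  and unit_\<nu>: "d \<in> A \<Longrightarrow> \<iota> p \<in> chart_dom d \<Longrightarrow> \<nu> d p \<bullet> (g d (\<iota> p) *v \<nu> d p) = 1"
  using nor unfolding unit_normal_field_def by blast+

abbreviation h :: "('b, 'm) metric" where "h \<equiv> induced_metric A g \<iota>"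

text \<open>The part of chart \<open>c\<close> that \<iota> sends into chart \<open>d\<close>, in
  coordinates: here \<open>loc\<close> and \<open>nloc\<close> express \<iota> and \<nu>.\<close>

definition dom2 :: "('b, 'm) chart \<Rightarrow> ('a, 'n) chart \<Rightarrow> (real^'m) set" where
  "dom2 c d = coord c ` (chart_dom c \<inter> \<iota> -` chart_dom d)"

definition loc :: "('b, 'm) chart \<Rightarrow> ('a, 'n) chart \<Rightarrow> real^'m \<Rightarrow> real^'n" where
  "loc c d x = coord d (\<iota> (chart_inv c x))"

definition nloc :: "('b, 'm) chart \<Rightarrow> ('a, 'n) chart \<Rightarrow> real^'m \<Rightarrow> real^'n" where
  "nloc c d x = \<nu> d (chart_inv c x)"

lemma open_preimage: "d \<in> A \<Longrightarrow> open (\<iota> -` chart_dom d)"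
  using continuous_on_open_vimage[OF open_UNIV, of \<iota>] cont_\<iota> amb.open_dom by auto

lemma open_dom2: "c \<in> B \<Longrightarrow> d \<in> A \<Longrightarrow> open (dom2 c d)"
  unfolding dom2_def by (rule sig.open_coord_image[OF _ open_preimage])

lemma dom2_iff: "c \<in> B \<Longrightarrow> x \<in> dom2 c d \<longleftrightarrow> x \<in> chart_img c \<and> \<iota> (chart_inv c x) \<in> chart_dom d"
  unfolding dom2_def using sig.coord_image_iff by auto

lemma loc_eq: "coord d \<circ> \<iota> \<circ> chart_inv c = loc c d"
  by (simp add: loc_def fun_eq_iff)

lemma nloc_eq: "\<nu> d \<circ> chart_inv c = nloc c d"
  by (simp add: nloc_def fun_eq_iff)

lemma smooth_loc: "c \<in> B \<Longrightarrow> d \<in> A \<Longrightarrow> smooth_on (dom2 c d) (loc c d)"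
  using smooth_\<iota> by (simp add: loc_eq dom2_def)

lemma smooth_nloc: "c \<in> B \<Longrightarrow> d \<in> A \<Longrightarrow> smooth_on (dom2 c d) (nloc c d)"
  using smooth_\<nu> by (simp add: nloc_eq dom2_def)

lemma loc_in: "c \<in> B \<Longrightarrow> d \<in> A \<Longrightarrow> loc c d ` dom2 c d \<subseteq> chart_img d"
  by (auto simp: loc_def dom2_iff)

lemma chart_inv_loc: "c \<in> B \<Longrightarrow> d \<in> A \<Longrightarrow> x \<in> dom2 c d \<Longrightarrow> chart_inv d (loc c d x) = \<iota> (chart_inv c x)"
  by (simp add: loc_def dom2_iff amb.chart_inv_coord)

lemma coord_in_dom2: "c \<in> B \<Longrightarrow> p \<in> chart_dom c \<Longrightarrow> \<iota> p \<in> chart_dom d \<Longrightarrow> coord c p \<in> dom2 c d"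
  unfolding dom2_def by blast

lemma loc_coord: "c \<in> B \<Longrightarrow> p \<in> chart_dom c \<Longrightarrow> loc c d (coord c p) = coord d (\<iota> p)"
  by (simp add: loc_def sig.chart_inv_coord)

lemma nloc_coord: "c \<in> B \<Longrightarrow> p \<in> chart_dom c \<Longrightarrow> nloc c d (coord c p) = \<nu> d p"
  by (simp add: nloc_def sig.chart_inv_coord)

lemma jac_loc: "jac c d \<iota> p = matrix (frechet_derivative (loc c d) (at (coord c p)))"
  by (simp add: jac_def loc_eq)

lemma jac_axis: "jac c d \<iota> p *v axis i 1 = pd i (loc c d) (coord c p)"
  unfolding jac_loc jacobian_mult by (rule sum_axis)

lemma jac_change_ambient:
  assumes c: "c \<in> B" "p \<in> chart_dom c" and d: "d \<in> A" "d' \<in> A" "\<iota> p \<in> chart_dom d" "\<iota> p \<in> chart_dom d'"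
  shows "jac c d' \<iota> p = jac d d' id (\<iota> p) ** jac c d \<iota> p"
proof -
  have "jac c d' (id \<circ> \<iota>) p = jac d d' id (\<iota> p) ** jac c d \<iota> p"
  proof (rule jac_comp[OF amb.atlas_manifold_axioms d(1) open_dom2[OF c(1) d(1)] coord_in_dom2[OF c d(3)]])
    show "chart_inv c (coord c p) = p" by (rule sig.chart_inv_coord[OF c])
    show "\<iota> (chart_inv c x) \<in> chart_dom d" if "x \<in> dom2 c d" for x using that dom2_iff[OF c(1)] by blast
    show "(coord d \<circ> \<iota> \<circ> chart_inv c) differentiable at (coord c p)"
      unfolding loc_eq by (rule smooth_on_at[OF smooth_loc[OF c(1) d(1)] open_dom2[OF c(1) d(1)] coord_in_dom2[OF c d(3)]])
    show "(coord d' \<circ> id \<circ> chart_inv d) differentiable at (coord d (\<iota> p))"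
      using amb.transition_differentiable[OF d] by simp
  qed
  then show ?thesis by simp
qed

lemma jac_change_chart:
  assumes c: "c \<in> B" "c' \<in> B" "p \<in> chart_dom c" "p \<in> chart_dom c'" and d: "d \<in> A" "\<iota> p \<in> chart_dom d"
  shows "jac c d \<iota> p = jac c' d \<iota> p ** jac c c' id p"
proof -
  have "jac c d (\<iota> \<circ> id) p = jac c' d \<iota> (id p) ** jac c c' id p"
  proof (rule jac_comp[OF sig.atlas_manifold_axioms c(2) sig.open_coord_image[OF c(1) sig.open_dom[OF c(2)]]])
    show "coord c p \<in> coord c ` (chart_dom c \<inter> chart_dom c')" using c by blast
    show "chart_inv c (coord c p) = p" by (rule sig.chart_inv_coord[OF c(1,3)])
    show "id (chart_inv c x) \<in> chart_dom c'" if "x \<in> coord c ` (chart_dom c \<inter> chart_dom c')" for x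
      using that sig.chart_inv_coord[OF c(1)] by auto
    show "(coord c' \<circ> id \<circ> chart_inv c) differentiable at (coord c p)"
      using sig.transition_differentiable[OF c] by simp
    show "(coord d \<circ> \<iota> \<circ> chart_inv c') differentiable at (coord c' (id p))"
      unfolding loc_eq using smooth_on_at[OF smooth_loc[OF c(2) d(1)] open_dom2[OF c(2) d(1)] coord_in_dom2[OF c(2,4) d(2)]] by simp
  qed
  then show ?thesis by simp
qed

text \<open>\<open>induced_metric\<close> takes its ambient chart from \<open>chart_at\<close>.
  Smoothness near a point requires one fixed \<open>d\<close>, and the invariance of
  \<open>g\<close> provides it.\<close>

lemma h_bilinear:
  assumes c: "c \<in> B" "p \<in> chart_dom c" and d: "d \<in> A" "\<iota> p \<in> chart_dom d"
  shows "v \<bullet> (h c p *v w) = (jac c d \<iota> p *v v) \<bullet> (g d (\<iota> p) *v (jac c d \<iota> p *v w))"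
proof -
  let ?d = "chart_at A (\<iota> p)"
  have d': "?d \<in> A" "\<iota> p \<in> chart_dom ?d" using amb.chart_at_in by auto
  have "v \<bullet> (h c p *v w) = (jac c ?d \<iota> p *v v) \<bullet> (g ?d (\<iota> p) *v (jac c ?d \<iota> p *v w))"
    by (simp only: induced_metric_def Let_def matrix_vector_mul_assoc[symmetric] inner_transpose_mult)
  also have "\<dots> = (jac c d \<iota> p *v v) \<bullet> (g d (\<iota> p) *v (jac c d \<iota> p *v w))"
    unfolding jac_change_ambient[OF c d(1) d'(1) d(2) d'(2)] matrix_vector_mul_assoc[symmetric]
    by (rule amb.g_transform[OF d(1) d'(1) d(2) d'(2), symmetric])
  finally show ?thesis .
qed

lemma h_eq:
  assumes "c \<in> B" "p \<in> chart_dom c" "d \<in> A" "\<iota> p \<in> chart_dom d"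
  shows "h c p = transpose (jac c d \<iota> p) ** g d (\<iota> p) ** jac c d \<iota> p"
  by (rule matrix_eq_bilinear)
    (simp only: h_bilinear[OF assms] matrix_vector_mul_assoc[symmetric] inner_transpose_mult)

lemma h_riemannian: "riemannian_metric B h"
  unfolding riemannian_metric_def
proof (intro conjI ballI allI impI)
  fix c assume c: "c \<in> B"
  show "smooth_on (chart_img c) (h c \<circ> chart_inv c)"
  proof (rule smooth_on_local)
    fix x assume x: "x \<in> chart_img c"
    obtain d where d: "d \<in> A" "\<iota> (chart_inv c x) \<in> chart_dom d" using amb.ex_chart by blast
    have o: "open (dom2 c d)" "x \<in> dom2 c d" using open_dom2[OF c d(1)] dom2_iff[OF c] x d by auto
    let ?J = "\<lambda>x. matrix (frechet_derivative (loc c d) (at x))"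
    have "smooth_on (dom2 c d) (\<lambda>x. transpose (?J x) ** g d (chart_inv d (loc c d x)) ** ?J x)"
      by (intro smooth_on_matrix_mult smooth_on_transpose smooth_on_jacobian o(1) smooth_loc c d(1)
          smooth_on_compose[OF o(1) amb.open_img[OF d(1)] loc_in[OF c d(1)] smooth_loc[OF c d(1)] amb.g_smooth[OF d(1)]])
    then have "smooth_on (dom2 c d) (h c \<circ> chart_inv c)"
    proof (rule smooth_on_cong[THEN iffD2, OF o(1), rotated])
      fix y assume y: "y \<in> dom2 c d"
      then have y': "y \<in> chart_img c" "\<iota> (chart_inv c y) \<in> chart_dom d" using dom2_iff[OF c] by auto
      show "(h c \<circ> chart_inv c) y = transpose (?J y) ** g d (chart_inv d (loc c d y)) ** ?J y"
        unfolding chart_inv_loc[OF c d(1) y] o_apply h_eq[OF c sig.chart_inv_in[OF c y'(1)] d(1) y'(2)] jac_loc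
          sig.coord_chart_inv[OF c y'(1)] ..
    qed
    then show "\<exists>T. open T \<and> x \<in> T \<and> smooth_on T (h c \<circ> chart_inv c)" using o by blast
  qed
next
  fix c p assume c: "c \<in> B" "p \<in> chart_dom c"
  obtain d where d: "d \<in> A" "\<iota> p \<in> chart_dom d" using amb.ex_chart by blast
  show "transpose (h c p) = h c p"
    unfolding h_eq[OF c d] by (simp add: matrix_transpose_mul amb.g_transpose[OF d] matrix_mul_assoc)
  fix v :: "real^'m" assume v: "v \<noteq> 0"
  have "jac c d \<iota> p *v v \<noteq> 0"
    using inj_jac[OF c(1) d(1) c(2) d(2)] v by (metis injD matrix_vector_mult_0_right)
  then show "0 < v \<bullet> (h c p *v v)"
    unfolding h_bilinear[OF c d] by (rule amb.g_pos[OF d])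
next
  fix c c' p assume c: "c \<in> B" "c' \<in> B" and p: "p \<in> chart_dom c \<inter> chart_dom c'"
  obtain d where d: "d \<in> A" "\<iota> p \<in> chart_dom d" using amb.ex_chart by blast
  have p': "p \<in> chart_dom c" "p \<in> chart_dom c'" using p by auto
  show "h c p = transpose (jac c c' id p) ** h c' p ** jac c c' id p"
    unfolding h_eq[OF c(1) p'(1) d] h_eq[OF c(2) p'(2) d] jac_change_chart[OF c p' d]
    by (simp only: matrix_transpose_mul matrix_mul_assoc)
qed

sublocale sig: riemannian_manifold B h
  by unfold_locales (rule h_riemannian)

section \<open>The second fundamental form\<close>

text \<open>The covariant derivative of \<nu> along the \<open>i\<close>-th coordinate field, as
  inside \<open>second_form\<close> but with a free choice of ambient chart.\<close>

definition dnu :: "('b, 'm) chart \<Rightarrow> ('a, 'n) chart \<Rightarrow> 'm \<Rightarrow> real^'m \<Rightarrow> real^'n" where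
  "dnu c d i x = pd i (nloc c d) x + christoffel_vec (g d \<circ> chart_inv d) (loc c d x) (pd i (loc c d) x) (nloc c d x)"

text \<open>Differentiating the transformed normal also differentiates the Jacobian. This extra term
  is exactly the inhomogeneous one in the law for \<Gamma>, so the covariant derivative transforms
  as a vector.\<close>

lemma dnu_change_ambient:
  assumes c: "c \<in> B" "p \<in> chart_dom c" and d: "d \<in> A" "d' \<in> A" "\<iota> p \<in> chart_dom d" "\<iota> p \<in> chart_dom d'"
  shows "dnu c d' i (coord c p) = jac d d' id (\<iota> p) *v dnu c d i (coord c p)"
proof -
  let ?x = "coord c p" and ?\<Phi> = "coord d' \<circ> chart_inv d"
  let ?J = "\<lambda>z. matrix (frechet_derivative ?\<Phi> (at z))"
  let ?U = "coord d ` (chart_dom d \<inter> chart_dom d')" and ?N = "dom2 c d \<inter> dom2 c d'"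
  have U: "open ?U" by (rule amb.open_coord_image[OF d(1) amb.open_dom[OF d(2)]])
  have N: "open ?N" "?x \<in> ?N"
    using open_Int[OF open_dom2[OF c(1) d(1)] open_dom2[OF c(1) d(2)]] coord_in_dom2[OF c d(3)] coord_in_dom2[OF c d(4)]
    by auto
  have smJ: "smooth_on ?U ?J" by (rule smooth_on_jacobian[OF U amb.smooth_transition[OF d(1,2)]])
  have lx: "loc c d ?x = coord d (\<iota> p)" by (rule loc_coord[OF c])
  have nx: "nloc c d ?x = \<nu> d p" by (rule nloc_coord[OF c])
  have lU: "loc c d ` ?N \<subseteq> ?U"
  proof
    fix z assume "z \<in> loc c d ` ?N"
    then obtain y where y: "y \<in> ?N" "z = coord d (\<iota> (chart_inv c y))" unfolding loc_def by blast
    then have "\<iota> (chart_inv c y) \<in> chart_dom d \<inter> chart_dom d'" using dom2_iff[OF c(1)] by blast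
    then show "z \<in> ?U" using y(2) by blast
  qed
  have dl: "loc c d differentiable at ?x"
    by (rule smooth_on_at[OF smooth_loc open_dom2 coord_in_dom2]) (use c d in auto)
  have dn: "nloc c d differentiable at ?x"
    by (rule smooth_on_at[OF smooth_nloc open_dom2 coord_in_dom2]) (use c d in auto)
  have dJ: "?J differentiable at (loc c d ?x)"
    by (rule smooth_on_at[OF smJ U]) (use lU N in blast)
  have dJl: "(\<lambda>x. ?J (loc c d x)) differentiable at ?x"
    by (rule smooth_on_at[OF smooth_on_compose[OF N(1) U lU smooth_on_subset[OF smooth_loc] smJ] N]) (use c d in auto)
  have Jx: "?J (loc c d ?x) = jac d d' id (\<iota> p)" by (simp add: lx amb.jac_id)
  have n_eq: "nloc c d' x = ?J (loc c d x) *v nloc c d x" if "x \<in> ?N" for x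
    using normal_change[OF d(1,2), of "chart_inv c x"] that dom2_iff[OF c(1)]
    by (simp add: nloc_def loc_def amb.jac_id)
  have "pd i (nloc c d') ?x = pd i (\<lambda>x. ?J (loc c d x) *v nloc c d x) ?x"
    by (rule pd_cong_open[OF N n_eq])
  also have "\<dots> = ?J (loc c d ?x) *v pd i (nloc c d) ?x + pd i (\<lambda>x. ?J (loc c d x)) ?x *v nloc c d ?x"
    by (rule pd_matrix_vector_mult[OF dJl dn])
  also have "pd i (\<lambda>x. ?J (loc c d x)) ?x = (\<Sum>a\<in>UNIV. pd i (loc c d) ?x $ a *\<^sub>R pd a ?J (loc c d ?x))"
    by (rule pd_chain[OF dl dJ])
  finally have 1: "pd i (nloc c d') ?x = jac d d' id (\<iota> p) *v pd i (nloc c d) ?x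
      + (\<Sum>a\<in>UNIV. pd i (loc c d) ?x $ a *\<^sub>R (pd a ?J (loc c d ?x) *v nloc c d ?x))"
    by (simp only: mv_sum_left mv_scaleR_left Jx)
  have 2: "pd i (loc c d') ?x = jac d d' id (\<iota> p) *v pd i (loc c d) ?x"
    using jac_change_ambient[OF c d] by (metis jac_axis matrix_vector_mul_assoc)
  have 3: "nloc c d' ?x = jac d d' id (\<iota> p) *v nloc c d ?x"
    using n_eq[OF N(2)] Jx by simp
  show ?thesis
    unfolding dnu_def 1 2 3 mv_add_right lx amb.christoffel_vec_change[OF d] loc_coord[OF c]
    by simp
qed

lemma second_form_eq:
  assumes c: "c \<in> B" "p \<in> chart_dom c" and d: "d \<in> A" "\<iota> p \<in> chart_dom d"
  shows "second_form A g \<iota> \<nu> c p = (\<chi> i j. dnu c d i (coord c p) \<bullet> (g d (\<iota> p) *v pd j (loc c d) (coord c p)))"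
proof -
  let ?d = "chart_at A (\<iota> p)"
  have d': "?d \<in> A" "\<iota> p \<in> chart_dom ?d" using amb.chart_at_in by auto
  have "second_form A g \<iota> \<nu> c p = (\<chi> i j. dnu c ?d i (coord c p) \<bullet> (g ?d (\<iota> p) *v pd j (loc c ?d) (coord c p)))"
    unfolding second_form_def Let_def dnu_def christoffel_vec_def loc_eq nloc_eq loc_coord[OF c] nloc_coord[OF c] ..
  also have "\<dots> = (\<chi> i j. dnu c d i (coord c p) \<bullet> (g d (\<iota> p) *v pd j (loc c d) (coord c p)))"
  proof -
    have "pd j (loc c ?d) (coord c p) = jac d ?d id (\<iota> p) *v pd j (loc c d) (coord c p)" for j
      using jac_change_ambient[OF c d(1) d'(1) d(2) d'(2)] by (metis jac_axis matrix_vector_mul_assoc)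
    then show ?thesis
      unfolding dnu_change_ambient[OF c d(1) d'(1) d(2) d'(2)] amb.g_transform[OF d(1) d'(1) d(2) d'(2)]
      by simp
  qed
  finally show ?thesis .
qed

lemma pd_change_chart:
  fixes u :: "'b \<Rightarrow> 'e::real_normed_vector"
  assumes c: "c \<in> B" "c' \<in> B" "p \<in> chart_dom c" "p \<in> chart_dom c'"
    and du: "(\<lambda>x. u (chart_inv c' x)) differentiable at (coord c' p)"
  shows "pd i (\<lambda>x. u (chart_inv c x)) (coord c p) = (\<Sum>k\<in>UNIV. jac c c' id p $ k $ i *\<^sub>R pd k (\<lambda>x. u (chart_inv c' x)) (coord c' p))"
proof -
  let ?\<Phi> = "coord c' \<circ> chart_inv c" and ?U = "coord c ` (chart_dom c \<inter> chart_dom c')"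
  have U: "open ?U" "coord c p \<in> ?U" using sig.open_coord_image[OF c(1) sig.open_dom[OF c(2)]] c by auto
  have x: "?\<Phi> (coord c p) = coord c' p" by (simp add: sig.chart_inv_coord c)
  have "pd i (\<lambda>x. u (chart_inv c x)) (coord c p) = pd i (\<lambda>x. u (chart_inv c' (?\<Phi> x))) (coord c p)"
    by (rule pd_cong_open[OF U]) (auto simp: sig.chart_inv_coord c)
  also have "\<dots> = (\<Sum>k\<in>UNIV. pd i ?\<Phi> (coord c p) $ k *\<^sub>R pd k (\<lambda>x. u (chart_inv c' x)) (coord c' p))"
    using pd_chain[where F = ?\<Phi> and k = "\<lambda>x. u (chart_inv c' x)", OF sig.transition_differentiable[OF c]] du x by simp
  finally show ?thesis by (simp add: sig.jac_id jacobian_nth)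
qed

text \<open>A change of chart on the hypersurface only recombines the directions of differentiation,
  and \<open>dnu\<close> is linear in them; no second derivatives of the transition map
  arise.\<close>

lemma second_form_change:
  assumes c: "c \<in> B" "c' \<in> B" "p \<in> chart_dom c" "p \<in> chart_dom c'"
  shows "second_form A g \<iota> \<nu> c p = transpose (jac c c' id p) ** second_form A g \<iota> \<nu> c' p ** jac c c' id p"
proof -
  obtain d where d: "d \<in> A" "\<iota> p \<in> chart_dom d" using amb.ex_chart by blast
  let ?T = "jac c c' id p"
  have dl: "(\<lambda>x. coord d (\<iota> (chart_inv c' x))) differentiable at (coord c' p)"
    using smooth_on_at[OF smooth_loc[OF c(2) d(1)] open_dom2[OF c(2) d(1)] coord_in_dom2[OF c(2,4) d(2)]]
    by (simp add: loc_def[abs_def])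
  have dn: "(\<lambda>x. \<nu> d (chart_inv c' x)) differentiable at (coord c' p)"
    using smooth_on_at[OF smooth_nloc[OF c(2) d(1)] open_dom2[OF c(2) d(1)] coord_in_dom2[OF c(2,4) d(2)]]
    by (simp add: nloc_def[abs_def])
  have l: "pd i (loc c d) (coord c p) = (\<Sum>k\<in>UNIV. ?T $ k $ i *\<^sub>R pd k (loc c' d) (coord c' p))" for i
    using pd_change_chart[OF c dl] by (simp add: loc_def[abs_def])
  have n: "pd i (nloc c d) (coord c p) = (\<Sum>k\<in>UNIV. ?T $ k $ i *\<^sub>R pd k (nloc c' d) (coord c' p))" for i
    using pd_change_chart[OF c dn] by (simp add: nloc_def[abs_def])
  have christoffel_vec_sum: "christoffel_vec G x (\<Sum>k\<in>UNIV. s k *\<^sub>R q k) v = (\<Sum>k\<in>UNIV. s k *\<^sub>R christoffel_vec G x (q k) v)"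
    for G :: "real^'n \<Rightarrow> real^'n^'n" and x v q and s :: "'m \<Rightarrow> real"
  proof -
    have "linear (\<lambda>u. christoffel_vec G x u v)" unfolding christoffel_vec_conn_matrix by (rule linear_lincomb)
    then show ?thesis
      using linear_sum[of "\<lambda>u. christoffel_vec G x u v" "\<lambda>k. s k *\<^sub>R q k" UNIV] linear_scale[of "\<lambda>u. christoffel_vec G x u v"] by simp
  qed
  have D: "dnu c d i (coord c p) = (\<Sum>k\<in>UNIV. ?T $ k $ i *\<^sub>R dnu c' d k (coord c' p))" for i
    unfolding dnu_def n l christoffel_vec_sum loc_coord[OF c(1,3)] loc_coord[OF c(2,4)] nloc_coord[OF c(1,3)] nloc_coord[OF c(2,4)]
    by (simp add: scaleR_add_right sum.distrib)
  show ?thesis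
    unfolding second_form_eq[OF c(1,3) d] second_form_eq[OF c(2,4) d] D l
    by (simp add: vec_eq_iff matrix_matrix_mult_def transpose_def mv_sum_right mv_scaleR_right
        inner_sum_left inner_sum_right sum_distrib_left sum_distrib_right mult_ac)
qed

end

section \<open>The Jacobi potential: positivity and continuity\<close>

lemma transpose_matrix_inv:
  fixes h :: "real^'n::finite^'n"
  assumes sym: "transpose h = h" and inv: "invertible h"
  shows "transpose (matrix_inv h) = matrix_inv h"
proof -
  have "transpose (matrix_inv h) ** h = mat 1"
    using arg_cong[OF matrix_inv_right[OF inv], of transpose] by (simp add: matrix_transpose_mul sym transpose_mat)
  then show ?thesis
    by (metis matrix_inv_right[OF inv] matrix_mul_assoc matrix_mul_lid matrix_mul_rid)
qed

lemma smooth_on_trace: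
  fixes M :: "real^'n::finite \<Rightarrow> real^'k::finite^'k"
  shows "\<lbrakk>open S; smooth_on S M\<rbrakk> \<Longrightarrow> smooth_on S (\<lambda>x. trace (M x))"
  unfolding trace_def by (intro smooth_on_sum smooth_on_nth)

context hypersurface
begin

text \<open>The weight of \<open>\<phi>^2\<close> in the stability inequality, that is, the
  zeroth-order coefficient of the Jacobi operator.\<close>

definition jacobi_potential :: "'b \<Rightarrow> real" where
  "jacobi_potential p = ric_inf_normal A g f \<iota> \<nu> p + second_form_norm2 B A g \<iota> \<nu> p"

lemma ric_inf_normal_eq:
  assumes d: "d \<in> A" "\<iota> p \<in> chart_dom d"
  shows "ric_inf_normal A g f \<iota> \<nu> p = \<nu> d p \<bullet> (ric_inf g f d (\<iota> p) *v \<nu> d p)"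
proof -
  let ?d = "chart_at A (\<iota> p)"
  have d': "?d \<in> A" "\<iota> p \<in> chart_dom ?d" using amb.chart_at_in by auto
  show ?thesis
    unfolding ric_inf_normal_def Let_def amb.ric_inf_change[OF d(1) d'(1) d(2) d'(2) f]
      normal_change[OF d(1) d'(1) d(2) d'(2)] ..
qed

text \<open>The form \<open>|II|^2\<close> in a given chart, written as a trace: its invariance and
  smoothness can then be seen from matrix rules.\<close>

definition shape_norm2 :: "('b, 'm) chart \<Rightarrow> 'b \<Rightarrow> real" where
  "shape_norm2 c p = trace (matrix_inv (h c p) ** (second_form A g \<iota> \<nu> c p ** matrix_inv (h c p) ** transpose (second_form A g \<iota> \<nu> c p)))"

lemma second_form_norm2_eq:
  assumes c: "c \<in> B" "p \<in> chart_dom c"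
  shows "second_form_norm2 B A g \<iota> \<nu> p = shape_norm2 c p"
proof -
  let ?c = "chart_at B p"
  have c': "?c \<in> B" "p \<in> chart_dom ?c" using sig.chart_at_in by auto
  have "second_form_norm2 B A g \<iota> \<nu> p = shape_norm2 ?c p"
    unfolding second_form_norm2_def Let_def shape_norm2_def
    by (rule quad_form_trace[OF transpose_matrix_inv[OF sig.g_transpose[OF c'] sig.g_inv[OF c']]])
  also have "\<dots> = shape_norm2 c p"
  proof -
    interpret cc: coord_change "coord ?c ` (chart_dom ?c \<inter> chart_dom c)" "chart_img c" "coord c \<circ> chart_inv ?c"
      "h ?c \<circ> chart_inv ?c" "h c \<circ> chart_inv c" "\<lambda>x. matrix (frechet_derivative (coord c \<circ> chart_inv ?c) (at x))"
      by (rule sig.coord_change[OF c'(1) c(1)])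
    have "invertible (jac ?c c id p)"
      unfolding sig.jac_id by (rule cc.invJ) (use c c' in blast)
    then show ?thesis unfolding shape_norm2_def
      by (rule quad_trace_conjugate[OF _ sig.g_inv[OF c'] sig.g_inv[OF c] sig.g_change[OF c'(1) c(1) c'(2) c(2)]
            second_form_change[OF c'(1) c(1) c'(2) c(2)]])
  qed
  finally show ?thesis .
qed

text \<open>This is where \<open>H = f\<^sub>\<nu>\<close> turns the \<open>\<infinity>\<close>-weighted Ricci curvature into the \<open>1\<close>-weighted one:
  \<open>|II|\<^sup>2 \<ge> H\<^sup>2 / (n - 1) = f\<^sub>\<nu>\<^sup>2 / (n - 1)\<close>.\<close>

lemma jacobi_potential_pos:
  assumes ric: "positive_ric_one A g f" and minimal: "f_minimal B A g f \<iota> \<nu>"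
  shows "0 < jacobi_potential p"
proof -
  let ?c = "chart_at B p" and ?d = "chart_at A (\<iota> p)"
  have c: "?c \<in> B" "p \<in> chart_dom ?c" using sig.chart_at_in by auto
  have d: "?d \<in> A" "\<iota> p \<in> chart_dom ?d" using amb.chart_at_in by auto
  let ?\<nu> = "\<nu> ?d p"
  define D where "D = (\<chi> i. pd i (f \<circ> chart_inv ?d) (coord ?d (\<iota> p)))"
  have "trace (matrix_inv (h ?c p) ** second_form A g \<iota> \<nu> ?c p) = normal_derivative A g f \<iota> \<nu> p"
    using minimal unfolding f_minimal_def mean_curvature_def Let_def by (metis eq_iff_diff_eq_0)
  \<comment> \<open>Lowering the index of the gradient cancels the inverse metric, so
    \<open>f\<^sub>\<nu>\<close> is the differential of \<open>f\<close> applied to \<nu>.\<close>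
  also have "\<dots> = ?\<nu> \<bullet> D"
  proof -
    have "normal_derivative A g f \<iota> \<nu> p = ?\<nu> \<bullet> (g ?d (\<iota> p) *v grad g f ?d (\<iota> p))"
      unfolding normal_derivative_def Let_def by (rule amb.g_sym[OF d])
    then show ?thesis
      by (simp add: grad_def D_def matrix_vector_mul_assoc matrix_inv_right amb.g_inv[OF d])
  qed
  finally have "(?\<nu> \<bullet> D)\<^sup>2 / real CARD('m) \<le> second_form_norm2 B A g \<iota> \<nu> p"
    using trace_cauchy_schwarz[OF sig.g_transpose[OF c] sig.g_pos[OF c], of "second_form A g \<iota> \<nu> ?c p"]
    unfolding second_form_norm2_eq[OF c] shape_norm2_def by simp
  \<comment> \<open>By \<open>dims\<close> the divisor \<open>n - 1\<close> of
    \<open>ric_one\<close> is \<open>CARD('m)\<close>, which is also the divisor in the trace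
    inequality.\<close>
  moreover have "?\<nu> \<bullet> (ric_one g f ?d (\<iota> p) *v ?\<nu>) = ric_inf_normal A g f \<iota> \<nu> p + (?\<nu> \<bullet> D)\<^sup>2 / real CARD('m)"
  proof -
    have "ric_one g f ?d (\<iota> p) = ric_inf g f ?d (\<iota> p) + (\<chi> i j. D $ i * D $ j / real CARD('m))"
      unfolding ric_one_def ric_inf_def dims by (simp add: D_def)
    moreover have "?\<nu> \<bullet> ((\<chi> i j. D $ i * D $ j / real CARD('m)) *v ?\<nu>) = (?\<nu> \<bullet> D)\<^sup>2 / real CARD('m)"
      by (simp add: inner_vec_def matrix_vector_mult_def power2_eq_square sum_product sum_divide_distrib
          sum_distrib_left mult_ac)
    ultimately show ?thesis
      unfolding ric_inf_normal_eq[OF d] mv_add_left inner_add_right by (simp only: mv_add_left inner_add_right)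
  qed
  moreover have "?\<nu> \<noteq> 0" using unit_\<nu>[OF d] by auto
  then have "0 < ?\<nu> \<bullet> (ric_one g f ?d (\<iota> p) *v ?\<nu>)"
    using ric d unfolding positive_ric_one_def by blast
  ultimately show ?thesis by (simp add: jacobi_potential_def)
qed

text \<open>Near \<open>p\<close> one fixed pair of charts replaces those of
  \<open>chart_at\<close>; there the potential is a smooth expression in the components of the
  metric, of \<open>f\<close>, \<iota> and \<nu>.\<close>

lemma jacobi_potential_isCont: "isCont jacobi_potential p"
proof -
  obtain c where c: "c \<in> B" "p \<in> chart_dom c" using sig.ex_chart by blast
  obtain d where d: "d \<in> A" "\<iota> p \<in> chart_dom d" using amb.ex_chart by blast
  define G where "G = g d \<circ> chart_inv d"
  define u where "u = f \<circ> chart_inv d"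
  define y where "y = loc c d"
  define n where "n = nloc c d"
  define S where "S = dom2 c d"
  have S: "open S" unfolding S_def by (rule open_dom2[OF c(1) d(1)])
  have V: "open (chart_img d)" by (rule amb.open_img[OF d(1)])
  have y: "smooth_on S y" "y ` S \<subseteq> chart_img d" unfolding S_def y_def by (rule smooth_loc[OF c(1) d(1)], rule loc_in[OF c(1) d(1)])
  have n: "smooth_on S n" unfolding S_def n_def by (rule smooth_nloc[OF c(1) d(1)])
  have G: "smooth_on (chart_img d) G" using amb.g_smooth[OF d(1)] by (simp add: G_def o_def)
  have Ginv: "invertible (G z)" if "z \<in> chart_img d" for z
    unfolding G_def o_apply by (rule amb.g_inv[OF d(1) amb.chart_inv_in[OF d(1) that]])
  have u: "smooth_on (chart_img d) u" using f d(1) unfolding smooth_fun_def u_def by blast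
  note comp = smooth_on_compose[OF S V y(2,1)]
  define F1 where "F1 = (\<lambda>x. n x \<bullet> ((ricci_coord G (y x) + hess_coord G u (y x)) *v n x))"
  define bb where "bb = (\<lambda>x. \<chi> i j. (pd i n x + christoffel_vec G (y x) (pd i y x) (n x)) \<bullet> (G (y x) *v pd j y x))"
  define K where "K = (\<lambda>x. matrix_inv (h c (chart_inv c x)))"
  define F2 where "F2 = (\<lambda>x. trace (K x ** (bb x ** K x ** transpose (bb x))))"
  have sF1: "smooth_on S F1"
    unfolding F1_def
    by (intro smooth_on_inner[OF S] smooth_on_matrix_vector_mult[OF S] smooth_on_add[OF S] n
        comp[OF smooth_on_ricci_coord[OF V G Ginv]] comp[OF smooth_on_hess_coord[OF V G Ginv u]])
  have schr: "smooth_on S (\<lambda>x. christoffel_vec G (y x) (pd i y x) (n x))" for i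
    unfolding christoffel_vec_def
    by (intro smooth_on_vec_lambda[OF S] smooth_on_sum[OF S] smooth_on_mult[OF S]
        comp[OF smooth_on_christoffel[OF V G Ginv]] smooth_on_nth[OF S] smooth_on_pd y(1) n)
  have sbb: "smooth_on S bb"
    unfolding bb_def
    by (intro smooth_on_vec_lambda[OF S] smooth_on_inner[OF S] smooth_on_add[OF S] schr
        smooth_on_matrix_vector_mult[OF S] comp[OF G] smooth_on_pd y(1) n)
  have SI: "S \<subseteq> chart_img c" using dom2_iff[OF c(1)] unfolding S_def by blast
  have sK: "smooth_on S K"
    unfolding K_def
  proof (rule smooth_on_matrix_inv[OF S smooth_on_subset[OF sig.g_smooth[OF c(1)] SI]])
    show "invertible (h c (chart_inv c x))" if "x \<in> S" for x
      by (rule sig.g_inv[OF c(1) sig.chart_inv_in[OF c(1)]]) (use that SI in blast)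
  qed
  have sF2: "smooth_on S F2"
    unfolding F2_def
    by (intro smooth_on_trace[OF S] smooth_on_matrix_mult[OF S] smooth_on_transpose[OF S] sbb sK)
  have eq: "jacobi_potential q = F1 (coord c q) + F2 (coord c q)" if q: "q \<in> chart_dom c" "\<iota> q \<in> chart_dom d" for q
  proof -
    have yq: "y (coord c q) = coord d (\<iota> q)" unfolding y_def by (rule loc_coord[OF c(1) q(1)])
    have nq: "n (coord c q) = \<nu> d q" unfolding n_def by (rule nloc_coord[OF c(1) q(1)])
    have Gq: "G (coord d (\<iota> q)) = g d (\<iota> q)" by (simp add: G_def amb.chart_inv_coord[OF d(1) q(2)])
    have "bb (coord c q) = second_form A g \<iota> \<nu> c q"
      unfolding second_form_eq[OF c(1) q(1) d(1) q(2)] bb_def dnu_def yq Gq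
      unfolding y_def n_def G_def loc_coord[OF c(1) q(1)] ..
    then have "F2 (coord c q) = second_form_norm2 B A g \<iota> \<nu> q"
      unfolding second_form_norm2_eq[OF c(1) q(1)] shape_norm2_def F2_def K_def sig.chart_inv_coord[OF c(1) q(1)] by simp
    moreover have "F1 (coord c q) = ric_inf_normal A g f \<iota> \<nu> q"
      unfolding ric_inf_normal_eq[OF d(1) q(2)] F1_def nq yq ric_inf_def ricci_def hess_def G_def u_def ..
    ultimately show ?thesis by (simp add: jacobi_potential_def)
  qed
  define W where "W = chart_dom c \<inter> \<iota> -` chart_dom d"
  have W: "open W" "p \<in> W" unfolding W_def using sig.open_dom[OF c(1)] open_preimage[OF d(1)] c d by auto
  have "continuous_on S (\<lambda>x. F1 x + F2 x)"
    by (rule smooth_on_imp_continuous_on[OF smooth_on_add[OF S sF1 sF2]])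
  then have "continuous_on W (\<lambda>q. F1 (coord c q) + F2 (coord c q))"
    by (rule continuous_on_compose2[OF _ continuous_on_subset[OF sig.cont_coord[OF c(1)]]])
      (auto simp: W_def S_def dom2_def)
  then have "continuous_on W jacobi_potential"
    using continuous_on_cong[of W W jacobi_potential "\<lambda>q. F1 (coord c q) + F2 (coord c q)"] eq by (simp add: W_def)
  then show ?thesis using W continuous_on_eq_continuous_at by blast
qed

lemma jacobi_potential_continuous: "continuous_on UNIV jacobi_potential"
  using jacobi_potential_isCont continuous_at_imp_continuous_on by blast

end

section \<open>Weighted volume and the contradiction\<close>

context atlas_manifold
begin

text \<open>Lindelof's theorem for the chart domains supplies a countable subcover, so the choice in
  the definition has a witness.\<close>

lemma countable_cover: "countable_cover A k \<in> A" "(\<Union>k. chart_dom (countable_cover A k)) = UNIV"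
proof -
  have "\<exists>C. range C \<subseteq> A \<and> (\<Union>k::nat. chart_dom (C k)) = UNIV"
  proof -
    obtain F where F: "F \<subseteq> chart_dom ` A" "countable F" "\<Union>F = \<Union>(chart_dom ` A)"
      using Lindelof[of "chart_dom ` A"] open_dom by blast
    have U: "\<Union>F = UNIV" using F(3) ex_chart by auto
    then have ne: "F \<noteq> {}" by auto
    have r: "range (from_nat_into F) = F" by (rule range_from_nat_into[OF ne F(2)])
    have "\<forall>k. \<exists>c\<in>A. chart_dom c = from_nat_into F k"
      using F(1) from_nat_into[OF ne] by (metis (no_types, lifting) imageE subsetD)
    then obtain C where C: "\<And>k. C k \<in> A" "\<And>k. chart_dom (C k) = from_nat_into F k" by metis
    have "(\<Union>k. chart_dom (C k)) = UNIV" unfolding C(2) using r U by simp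
    then show ?thesis using C(1) by blast
  qed
  then have *: "range (countable_cover A) \<subseteq> A \<and> (\<Union>k. chart_dom (countable_cover A k)) = UNIV"
    unfolding countable_cover_def by (rule someI_ex)
  then show "countable_cover A k \<in> A" "(\<Union>k. chart_dom (countable_cover A k)) = UNIV" by auto
qed

end

context riemannian_manifold
begin

lemma chart_preimage_borel:
  assumes c: "c \<in> A" and S: "S \<in> sets borel"
  shows "{x \<in> chart_img c. chart_inv c x \<in> S} \<in> sets borel"
proof -
  have "chart_inv c \<in> borel_measurable (restrict_space borel (chart_img c))"
    by (rule borel_measurable_continuous_on_restrict[OF cont_chart_inv[OF c]])
  then have "chart_inv c -` S \<inter> space (restrict_space borel (chart_img c)) \<in> sets (restrict_space borel (chart_img c))"
    using S by (rule measurable_sets)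
  moreover have "chart_inv c -` S \<inter> space (restrict_space borel (chart_img c)) = {x \<in> chart_img c. chart_inv c x \<in> S}"
    by (auto simp: space_restrict_space)
  moreover have "chart_img c \<inter> space borel \<in> sets borel" using open_img[OF c] by simp
  ultimately show ?thesis by (simp add: sets_restrict_space_iff)
qed

text \<open>With the indicator as a real factor, continuity on the open chart image alone gives
  Borel measurability on the whole space.\<close>

definition volume_density :: "('a, 'n) chart \<Rightarrow> real^'n \<Rightarrow> ennreal" where
  "volume_density c x = ennreal (indicator (chart_img c) x *\<^sub>R sqrt (det (g c (chart_inv c x))))"

lemma volume_density_measurable: "c \<in> A \<Longrightarrow> volume_density c \<in> borel_measurable borel"
proof -
  assume c: "c \<in> A"
  have "continuous_on (chart_img c) (\<lambda>x. sqrt (det (g c (chart_inv c x))))"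
    by (intro continuous_on_real_sqrt smooth_on_imp_continuous_on smooth_on_det open_img g_smooth c)
  then have "(\<lambda>x. indicator (chart_img c) x *\<^sub>R sqrt (det (g c (chart_inv c x)))) \<in> borel_measurable borel"
    using open_img[OF c] by (intro borel_measurable_continuous_on_indicator) auto
  then show ?thesis unfolding volume_density_def[abs_def] by measurable
qed

lemma volume_density_pos: "c \<in> A \<Longrightarrow> x \<in> chart_img c \<Longrightarrow> 0 < volume_density c x"
  unfolding volume_density_def using posdef_det_pos[OF g_pos[OF _ chart_inv_in]] by simp

lemma chart_volume_eq:
  assumes c: "c \<in> A" and S: "S \<in> sets borel"
  shows "chart_volume g c S = emeasure (density lborel (volume_density c)) {x \<in> chart_img c. chart_inv c x \<in> S}"
proof -
  have "emeasure (density lborel (volume_density c)) {x \<in> chart_img c. chart_inv c x \<in> S}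
     = (\<integral>\<^sup>+x. volume_density c x * indicator {x \<in> chart_img c. chart_inv c x \<in> S} x \<partial>lborel)"
    using volume_density_measurable[OF c] chart_preimage_borel[OF assms] by (intro emeasure_density) auto
  also have "\<dots> = chart_volume g c S"
    unfolding chart_volume_def by (intro nn_integral_cong) (auto simp: volume_density_def indicator_def)
  finally show ?thesis by simp
qed

abbreviation cover_part :: "nat \<Rightarrow> 'a set" where
  "cover_part k \<equiv> disjointed (\<lambda>j. chart_dom (countable_cover A j)) k"

lemma cover_part_borel: "cover_part k \<in> sets borel"
  unfolding disjointed_def using open_dom countable_cover(1) by (intro sets.Diff sets.finite_UN) auto

lemma sets_riem_volume: "sets (riem_volume A g) = sets borel"
  unfolding riem_volume_def using sets.sigma_sets_eq[of "borel :: 'a measure"] by (simp add: sets_measure_of_conv)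

text \<open>\<open>measure_of\<close> yields the zero measure unless the given set function is a
  measure, so countable additivity must be established before any value can be computed.\<close>

lemma emeasure_riem_volume:
  assumes S: "S \<in> sets borel"
  shows "emeasure (riem_volume A g) S = (\<Sum>k. chart_volume g (countable_cover A k) (S \<inter> cover_part k))"
proof (rule emeasure_measure_of[OF riem_volume_def[of A g]])
  let ?\<mu> = "\<lambda>S. \<Sum>k. chart_volume g (countable_cover A k) (S \<inter> cover_part k)"
  note sets = sets_riem_volume
  show "S \<in> sets (riem_volume A g)" using S sets by simp
  show "sets borel \<subseteq> Pow (UNIV :: 'a set)" by simp
  show "positive (sets (riem_volume A g)) ?\<mu>"
    by (simp add: positive_def chart_volume_def)
  show "countably_additive (sets (riem_volume A g)) ?\<mu>"
    unfolding countably_additive_def sets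
  proof (intro allI impI)
    fix F :: "nat \<Rightarrow> 'a set" assume F: "range F \<subseteq> sets borel" "disjoint_family F" "\<Union>(range F) \<in> sets borel"
    have Fi: "F i \<inter> cover_part k \<in> sets borel" for i k using F(1) cover_part_borel by auto
    \<comment> \<open>The two infinite sums are exchanged by reading one of them as an integral over
      the counting measure.\<close>
    have "(\<Sum>i. ?\<mu> (F i)) = (\<Sum>i. \<integral>\<^sup>+k. chart_volume g (countable_cover A k) (F i \<inter> cover_part k) \<partial>count_space UNIV)"
      by (simp add: nn_integral_count_space_nat)
    also have "\<dots> = (\<integral>\<^sup>+k. (\<Sum>i. chart_volume g (countable_cover A k) (F i \<inter> cover_part k)) \<partial>count_space UNIV)"
      by (rule nn_integral_suminf[symmetric]) simp
    also have "\<dots> = (\<Sum>k. \<Sum>i. chart_volume g (countable_cover A k) (F i \<inter> cover_part k))"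
      by (simp add: nn_integral_count_space_nat)
    also have "\<dots> = ?\<mu> (\<Union>(range F))"
    proof (rule arg_cong[where f = suminf], rule ext)
      fix k
      let ?c = "countable_cover A k"
      have c: "?c \<in> A" by (rule countable_cover(1))
      let ?T = "\<lambda>i. {x \<in> chart_img ?c. chart_inv ?c x \<in> F i \<inter> cover_part k}"
      have "(\<Sum>i. emeasure (density lborel (volume_density ?c)) (?T i)) = emeasure (density lborel (volume_density ?c)) (\<Union>(range ?T))"
      proof (rule suminf_emeasure)
        show "range ?T \<subseteq> sets (density lborel (volume_density ?c))"
          using chart_preimage_borel[OF c Fi] by auto
        show "disjoint_family ?T"
          using F(2) unfolding disjoint_family_on_def by blast
      qed
      also have "\<Union>(range ?T) = {x \<in> chart_img ?c. chart_inv ?c x \<in> \<Union>(range F) \<inter> cover_part k}" by auto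
      finally show "(\<Sum>i. chart_volume g ?c (F i \<inter> cover_part k)) = chart_volume g ?c (\<Union>(range F) \<inter> cover_part k)"
        using chart_volume_eq[OF c Fi] chart_volume_eq[OF c sets.Int[OF F(3) cover_part_borel[of k]]] by simp
    qed
    finally show "(\<Sum>i. ?\<mu> (F i)) = ?\<mu> (\<Union>(range F))" .
  qed
qed

text \<open>The first nonempty chart of the cover is not reduced when the cover is made disjoint, so positivity
  of the volume near its points needs no change of variables.\<close>

lemma riem_volume_open_pos: "\<exists>p. \<forall>S. open S \<and> p \<in> S \<longrightarrow> 0 < emeasure (riem_volume A g) S"
proof -
  let ?C = "countable_cover A"
  have "(undefined :: 'a) \<in> (\<Union>k. chart_dom (?C k))" unfolding countable_cover(2) by (rule UNIV_I)
  then have "\<exists>k. chart_dom (?C k) \<noteq> {}" by blast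
  then obtain k where k: "chart_dom (?C k) \<noteq> {}" "\<And>j. j < k \<Longrightarrow> chart_dom (?C j) = {}"
    using exists_least_iff[of "\<lambda>k. chart_dom (?C k) \<noteq> {}"] by blast
  have part: "cover_part k = chart_dom (?C k)" unfolding disjointed_def using k(2) by auto
  obtain p where p: "p \<in> chart_dom (?C k)" using k(1) by blast
  have c: "?C k \<in> A" by (rule countable_cover(1))
  have "0 < emeasure (riem_volume A g) S" if S: "open S" "p \<in> S" for S
  proof -
    let ?S = "S \<inter> cover_part k"
    let ?T = "{x \<in> chart_img (?C k). chart_inv (?C k) x \<in> ?S}"
    have Sb: "S \<in> sets borel" "?S \<in> sets borel" using S cover_part_borel by auto
    have "?T = coord (?C k) ` (chart_dom (?C k) \<inter> ?S)" using coord_image_iff[OF c] by blast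
    then have T: "open ?T" "coord (?C k) p \<in> ?T"
      using open_coord_image[OF c, of ?S] S open_dom[OF c] part p by (auto simp: chart_inv_coord[OF c])
    have "emeasure (density lborel (volume_density (?C k))) ?T \<noteq> 0"
    proof
      assume "emeasure (density lborel (volume_density (?C k))) ?T = 0"
      then have "(\<integral>\<^sup>+x. volume_density (?C k) x * indicator ?T x \<partial>lborel) = 0"
        using volume_density_measurable[OF c] T(1) by (subst (asm) emeasure_density) auto
      then have "AE x in lborel. volume_density (?C k) x * indicator ?T x = 0"
        using volume_density_measurable[OF c] T(1) by (subst (asm) nn_integral_0_iff_AE) auto
      then have "AE x in lborel. x \<notin> ?T"
      proof (rule AE_mp, intro AE_I2 impI notI)
        fix x assume "volume_density (?C k) x * indicator ?T x = 0" "x \<in> ?T"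
        then show False using volume_density_pos[OF c, of x] by auto
      qed
      then have "?T \<in> null_sets lborel" using T(1) by (subst AE_iff_null_sets) auto
      then have "negligible ?T" by (simp add: negligible_iff_null_sets null_sets_completionI)
      then show False using open_not_negligible[OF T(1)] T(2) by blast
    qed
    then have pos: "0 < chart_volume g (?C k) ?S"
      unfolding chart_volume_eq[OF c Sb(2)] by (simp add: zero_less_iff_neq_zero)
    also have "\<dots> \<le> (\<Sum>k. chart_volume g (?C k) (S \<inter> cover_part k))"
      using sum_le_suminf[of "\<lambda>k. chart_volume g (?C k) (S \<inter> cover_part k)" "{k}"] by simp
    finally show ?thesis unfolding emeasure_riem_volume[OF Sb(1)] .
  qed
  then show ?thesis by blast
qed

text \<open>Gives a neighbourhood independent of \<open>R\<close> on which every cutoff with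
  gradient at most \<open>1 / R\<close> differs from its value at \<open>p\<close> by at most
  \<open>1 / R\<close>.\<close>

lemma unit_neighbourhood: "\<exists>S. open S \<and> p \<in> S \<and> (\<forall>q\<in>S. reach 1 p q)"
proof -
  obtain c where c: "c \<in> A" "p \<in> chart_dom c" using ex_chart by blast
  define x0 where "x0 = coord c p"
  have x0: "x0 \<in> chart_img c" "chart_inv c x0 = p" using c by (auto simp: x0_def chart_inv_coord)
  obtain \<rho> where \<rho>: "\<rho> > 0" "cball x0 \<rho> \<subseteq> chart_img c"
    and near: "\<And>x v. x \<in> cball x0 \<rho> \<Longrightarrow> v \<bullet> (g c (chart_inv c x) *v v) \<le> 4 * (v \<bullet> (g c p *v v))"
    using metric_near[OF c(1) x0(1) open_UNIV UNIV_I] unfolding x0(2) by blast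
  define N2 where "N2 y = (y - x0) \<bullet> (g c p *v (y - x0))" for y
  have "smooth_on UNIV N2"
    unfolding N2_def[abs_def]
    by (intro smooth_on_inner smooth_on_matrix_vector_mult smooth_on_diff smooth_on_ident smooth_on_const open_UNIV)
  \<comment> \<open>The bound \<open>1/4\<close> offsets the factor 4 between the metric and its
    value frozen at \<open>p\<close>.\<close>
  then have "open (N2 -` {..<1/4} \<inter> UNIV)"
    using continuous_on_open_vimage[OF open_UNIV, of N2] smooth_on_imp_continuous_on open_lessThan by blast
  then have X: "open (ball x0 \<rho> \<inter> N2 -` {..<1/4})" using open_Int[OF open_ball] by simp
  have "reach 1 p q" if q: "q \<in> chart_dom c" "coord c q \<in> ball x0 \<rho> \<inter> N2 -` {..<1/4}" for q
  proof -
    have seg: "closed_segment x0 (coord c q) \<subseteq> cball x0 \<rho>"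
      by (rule closed_segment_subset) (use q \<rho> in auto)
    have "reach 1 (chart_inv c x0) (chart_inv c (coord c q))"
    proof (rule reach_segment[OF c(1)])
      show "closed_segment x0 (coord c q) \<subseteq> chart_img c" using seg \<rho> by blast
      fix z assume "z \<in> closed_segment x0 (coord c q)"
      then have "(coord c q - x0) \<bullet> (g c (chart_inv c z) *v (coord c q - x0)) \<le> 4 * N2 (coord c q)"
        unfolding N2_def using near seg by blast
      also have "\<dots> \<le> 1\<^sup>2" using q by simp
      finally show "(coord c q - x0) \<bullet> (g c (chart_inv c z) *v (coord c q - x0)) \<le> 1\<^sup>2" .
    qed simp
    then show ?thesis using x0(2) by (simp add: chart_inv_coord c q)
  qed
  moreover have "p \<in> {q \<in> chart_dom c. coord c q \<in> ball x0 \<rho> \<inter> N2 -` {..<1/4}}"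
    using c \<rho> by (simp add: x0_def[symmetric] N2_def)
  ultimately show ?thesis using open_chart_preimage[OF c(1) X] by blast
qed

end

section \<open>Weighted measure and the stability argument\<close>

context hypersurface
begin

abbreviation wmeas :: "'b measure" where "wmeas \<equiv> weighted_measure B A g f \<iota>"

lemma sets_wmeas: "sets wmeas = sets borel"
  by (simp add: weighted_measure_def sig.sets_riem_volume)

lemma space_wmeas: "space wmeas = UNIV"
  using sets_eq_imp_space_eq[OF sets_wmeas] by simp

lemma continuous_measurable_wmeas:
  fixes u :: "'b \<Rightarrow> real"
  assumes "continuous_on UNIV u"
  shows "u \<in> borel_measurable wmeas"
  using borel_measurable_continuous_onI[OF assms] measurable_cong_sets[OF sets_wmeas refl] by blast

text \<open>The density \<open>exp (- f)\<close> is positive, so sets of positive volume keep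
  positive measure.\<close>

lemma wmeas_open_pos: "\<exists>p. \<forall>S. open S \<and> p \<in> S \<longrightarrow> 0 < emeasure wmeas S"
proof -
  let ?M = "riem_volume B h"
  obtain p where p: "\<And>S. open S \<Longrightarrow> p \<in> S \<Longrightarrow> 0 < emeasure ?M S" using sig.riem_volume_open_pos by blast
  have "continuous_on UNIV (\<lambda>p. exp (- f (\<iota> p)))"
    by (intro continuous_on_exp continuous_on_minus continuous_on_compose2[OF amb.smooth_fun_continuous[OF f] cont_\<iota>]) simp
  then have "(\<lambda>p. exp (- f (\<iota> p))) \<in> borel_measurable borel" by (rule borel_measurable_continuous_onI)
  then have m: "(\<lambda>p. ennreal (exp (- f (\<iota> p)))) \<in> borel_measurable ?M"
    unfolding measurable_cong_sets[OF sig.sets_riem_volume refl] by measurable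
  have "0 < emeasure wmeas S" if S: "open S" "p \<in> S" for S
  proof -
    have Sb: "S \<in> sets ?M" using S sig.sets_riem_volume by simp
    have "emeasure wmeas S \<noteq> 0"
    proof
      assume "emeasure wmeas S = 0"
      then have "(\<integral>\<^sup>+p. ennreal (exp (- f (\<iota> p))) * indicator S p \<partial>?M) = 0"
        unfolding weighted_measure_def emeasure_density[OF m Sb] .
      then have "AE p in ?M. ennreal (exp (- f (\<iota> p))) * indicator S p = 0"
        using m Sb by (subst (asm) nn_integral_0_iff_AE) auto
      then have "AE p in ?M. p \<notin> S"
        by (rule AE_mp, intro AE_I2) (auto simp: indicator_def split: if_splits)
      then have "S \<in> null_sets ?M" using Sb by (subst AE_iff_null_sets) auto
      then show False using p[OF S] by auto
    qed
    then show ?thesis by (simp add: zero_less_iff_neq_zero)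
  qed
  then show ?thesis by blast
qed

lemma stable_minimal_infinite_measure:
  assumes ric: "positive_ric_one A g f" and complete: "riem_complete B h"
    and minimal: "f_minimal B A g f \<iota> \<nu>" and stable: "f_stable B A g f \<iota> \<nu>"
  shows "emeasure wmeas UNIV = \<infinity>"
proof (rule ccontr)
  assume "emeasure wmeas UNIV \<noteq> \<infinity>"
  then interpret finite_measure wmeas by (intro finite_measureI) (simp add: space_wmeas)
  define m where "m = measure wmeas UNIV"
  have m: "m \<ge> 0" by (simp add: m_def)
  obtain p where p: "\<And>S. open S \<Longrightarrow> p \<in> S \<Longrightarrow> 0 < emeasure wmeas S" using wmeas_open_pos by blast
  obtain S where S: "open S" "p \<in> S" "\<And>q. q \<in> S \<Longrightarrow> sig.reach 1 p q" using sig.unit_neighbourhood[of p] by blast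
  have Sm: "S \<in> sets wmeas" using S(1) sets_wmeas by simp
  have potm: "jacobi_potential \<in> borel_measurable wmeas" by (rule continuous_measurable_wmeas[OF jacobi_potential_continuous])
  have pot0: "0 \<le> jacobi_potential q" for q using jacobi_potential_pos[OF ric minimal, of q] by simp
  \<comment> \<open>For \<open>R \<ge> 2\<close> the cutoff is at least
    \<open>1 - 1 / R \<ge> 1 / 2\<close> on \<open>S\<close>, which explains the factor 1/4;
    \<open>I\<close> itself does not depend on \<open>R\<close>.\<close>
  define I where "I = (\<integral>\<^sup>+q. ennreal (jacobi_potential q / 4) * indicator S q \<partial>wmeas)"
  have bound: "I \<le> ennreal (m / R\<^sup>2)" if R: "R \<ge> 2" for R
  proof -
    have R0: "R > 0" using R by simp
    obtain u where u: "smooth_fun B u" "sig.grad_bound u (1 / R)" "compact (closure {q. u q \<noteq> 0})" "u p \<ge> 1"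
      using sig.cutoff_exists[OF complete R0, of p] by blast
    have uc: "continuous_on UNIV u" by (rule sig.smooth_fun_continuous[OF u(1)])
    have c: "continuous_on UNIV (\<lambda>q. jacobi_potential q * (u q)\<^sup>2)"
      by (intro continuous_on_mult continuous_on_power jacobi_potential_continuous uc)
    obtain b where b: "\<And>q. q \<in> closure {q. u q \<noteq> 0} \<Longrightarrow> \<bar>jacobi_potential q * (u q)\<^sup>2\<bar> \<le> b"
    proof -
      have "compact ((\<lambda>q. jacobi_potential q * (u q)\<^sup>2) ` closure {q. u q \<noteq> 0})"
        by (rule compact_continuous_image[OF continuous_on_subset[OF c] u(3)]) simp
      then have "bounded ((\<lambda>q. jacobi_potential q * (u q)\<^sup>2) ` closure {q. u q \<noteq> 0})" by (rule compact_imp_bounded)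
      then obtain b where "\<forall>y\<in>(\<lambda>q. jacobi_potential q * (u q)\<^sup>2) ` closure {q. u q \<noteq> 0}. norm y \<le> b"
        unfolding bounded_iff by (elim exE)
      then show ?thesis by (intro that[of b]) simp
    qed
    have "\<bar>jacobi_potential q * (u q)\<^sup>2\<bar> \<le> max b 0" for q
    proof (cases "u q = 0")
      case False
      then have "q \<in> closure {q. u q \<noteq> 0}" by (intro subsetD[OF closure_subset]) simp
      then show ?thesis using b by (simp add: le_max_iff_disj)
    qed simp
    \<comment> \<open>The integrand is bounded, being continuous with compact support, and the
      measure is finite. Integrability identifies the Bochner integral with the nonnegative one used
      for \<open>I\<close>.\<close>
    then have int: "integrable wmeas (\<lambda>q. jacobi_potential q * (u q)\<^sup>2)"
      by (intro integrable_const_bound[of _ "max b 0"] continuous_measurable_wmeas[OF c]) simp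
    have "(LINT q|wmeas. jacobi_potential q * (u q)\<^sup>2) \<le> (LINT q|wmeas. grad_norm2 B h u q)"
      using stable u(1,3) unfolding f_stable_def jacobi_potential_def by blast
    \<comment> \<open>The constant is integrable since the measure is finite; were the gradient term
      not integrable, its integral would be 0 and the estimate would hold as well.\<close>
    also have "\<dots> \<le> (LINT q|wmeas. (1 / R)\<^sup>2)"
      by (rule integral_mono') (use sig.grad_bound_grad_norm2[OF u(2)] R0 in auto)
    also have "\<dots> = m / R\<^sup>2" by (simp add: m_def space_wmeas power_divide)
    finally have le: "(LINT q|wmeas. jacobi_potential q * (u q)\<^sup>2) \<le> m / R\<^sup>2" .
    have "I \<le> (\<integral>\<^sup>+q. ennreal (jacobi_potential q * (u q)\<^sup>2) \<partial>wmeas)"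
      unfolding I_def
    proof (rule nn_integral_mono)
      fix q
      show "ennreal (jacobi_potential q / 4) * indicator S q \<le> ennreal (jacobi_potential q * (u q)\<^sup>2)"
      proof (cases "q \<in> S")
        case True
        have "\<bar>u q - u p\<bar> \<le> 1 / R * 1"
          by (rule sig.lipschitz_reach[OF u(1,2) _ S(3)[OF True]]) (use R0 in simp)
        moreover have "1 / R \<le> 1 / 2" using R by simp
        ultimately have "1 / 2 \<le> u q" using u(4) by linarith
        then have "(1 / 2)\<^sup>2 \<le> (u q)\<^sup>2" by (intro power_mono) auto
        then have "jacobi_potential q * (1 / 4) \<le> jacobi_potential q * (u q)\<^sup>2" using pot0[of q] by (intro mult_left_mono) (auto simp: power2_eq_square)
        then show ?thesis using True by (simp add: ennreal_leI)
      qed simp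
    qed
    also have "\<dots> = ennreal (LINT q|wmeas. jacobi_potential q * (u q)\<^sup>2)"
      by (rule nn_integral_eq_integral[OF int]) (simp add: pot0)
    also have "\<dots> \<le> ennreal (m / R\<^sup>2)" using le by (rule ennreal_leI)
    finally show ?thesis .
  qed
  have "I = 0"
  proof (rule ccontr)
    assume "I \<noteq> 0"
    have "I < \<infinity>" using bound[of 2] by (simp add: le_less_trans)
    then obtain t where t: "I = ennreal t" "t \<ge> 0" by (metis ennreal_cases infinity_ennreal_def less_irrefl)
    then have t0: "t > 0" using \<open>I \<noteq> 0\<close> by (simp add: less_le)
    \<comment> \<open>This choice gives \<open>t * R^2 \<ge> t * R = m + 2 * t > m\<close>, against
      the bound \<open>t * R^2 \<le> m\<close>.\<close>
    define R where "R = m / t + 2"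
    have R: "R \<ge> 2" using m t0 by (simp add: R_def)
    have "t \<le> m / R\<^sup>2" using bound[OF R] t m by (simp add: ennreal_le_iff)
    then have "t * R\<^sup>2 \<le> m" using R by (simp add: pos_le_divide_eq)
    moreover have "R \<le> R\<^sup>2" using R by (simp add: power2_eq_square)
    then have "t * R \<le> t * R\<^sup>2" using t0 by (intro mult_left_mono) auto
    moreover have "t * R = m + 2 * t" using t0 by (simp add: R_def distrib_left)
    ultimately show False using t0 by simp
  qed
  then have "AE q in wmeas. ennreal (jacobi_potential q / 4) * indicator S q = 0"
    using potm Sm unfolding I_def by (subst (asm) nn_integral_0_iff_AE) auto
  then have "AE q in wmeas. q \<notin> S"
  proof (rule AE_mp, intro AE_I2 impI notI)
    fix q assume "ennreal (jacobi_potential q / 4) * indicator S q = 0" "q \<in> S"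
    then show False using jacobi_potential_pos[OF ric minimal, of q] by simp
  qed
  then have "S \<in> null_sets wmeas" using Sm by (subst AE_iff_null_sets) auto
  then show False using p[OF S(1,2)] by auto
qed

end

theorem proposition4p1:
  fixes A :: "('a::{t2_space,second_countable_topology}, 'n::finite) chart set"
    and g :: "('a, 'n) metric"
    and f :: "'a \<Rightarrow> real"
  assumes "CARD('n) \<ge> 2"
    and "weighted_manifold A g f"
    and "riem_complete A g"
    and "positive_ric_one A g f"
  shows "\<not> (\<exists>(B :: ('b::{t2_space,second_countable_topology}, 'm::finite) chart set) \<iota> \<nu>.
            immersed_hypersurface B A \<iota> \<and>
            unit_normal_field B A g \<iota> \<nu> \<and>
            riem_complete B (induced_metric A g \<iota>) \<and>
            f_minimal B A g f \<iota> \<nu> \<and>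
            f_stable B A g f \<iota> \<nu> \<and>
            emeasure (weighted_measure B A g f \<iota>) UNIV < \<infinity>)"
proof
  assume "\<exists>(B :: ('b, 'm) chart set) \<iota> \<nu>.
            immersed_hypersurface B A \<iota> \<and>
            unit_normal_field B A g \<iota> \<nu> \<and>
            riem_complete B (induced_metric A g \<iota>) \<and>
            f_minimal B A g f \<iota> \<nu> \<and>
            f_stable B A g f \<iota> \<nu> \<and>
            emeasure (weighted_measure B A g f \<iota>) UNIV < \<infinity>"
  then obtain B :: "('b, 'm) chart set" and \<iota> \<nu> where H: "immersed_hypersurface B A \<iota>"
    "unit_normal_field B A g \<iota> \<nu>" "riem_complete B (induced_metric A g \<iota>)"
    "f_minimal B A g f \<iota> \<nu>" "f_stable B A g f \<iota> \<nu>" "emeasure (weighted_measure B A g f \<iota>) UNIV < \<infinity>"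
    by blast
  interpret hypersurface A g B f \<iota> \<nu>
    by unfold_locales
      (use assms(2) H(1,2) in \<open>auto simp: weighted_manifold_def immersed_hypersurface_def\<close>)
  show False
    using stable_minimal_infinite_measure[OF assms(4) H(3-5)] H(6) by simp
qed

end
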